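(* Let $n>1$ be an integer, let $m>0$ be an integer, $0\le\sigma<\infty$, $1<p<\infty$, $m+\sigma>\frac{n}{p}$, and let $\alpha$ be a real number such that neither $n+\alpha$ nor $n+\alpha+m$ is a negative integer. Let $\mu$ be a positive Borel measure on the unit ball $B$ of $\mathbf{C}^n$. (i) Suppose $\sigma>0$. If $\mu$ is a Carleson measure for $B_p^\sigma(B)$, then $\mu$ is a $\frac{\sigma p}{n}$-Carleson measure. Conversely, if $\varepsilon>0$ and $\mu$ is a $\frac{\sigma p+\varepsilon}{n}$-Carleson measure, then $\mu$ is a Carleson measure for $B_p^\sigma(B)$. (ii) Suppose $\sigma=0$. If $\mu$ is a Carleson measure for $B_p^0(B)$, then $$\sup\left\{\frac{\mu(Q_\delta(\xi))}{\left(\log\frac{2}{\delta}\right)^{1-p}}:\ \xi\in S,\ 0<\delta<2\right\}<\infty.$$ Conversely, if $\varepsilon>0$ and $$\sup\left\{\frac{\mu(Q_\delta(\xi))}{\left(\log\frac{2}{\delta}\right)^{1-p-\varepsilon}}:\ \xi\in S,\ 0<\delta<2\right\}<\infty,$$ then $\mu$ is a Carleson measure for $B_p^0(B)$.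
   Context: $B=\{z\in\mathbf{C}^n:|z|<1\}$, $S=\{z\in\mathbf{C}^n:|z|=1\}$, $\langle z,w\rangle=\sum_{j=1}^n z_j\overline{w_j}$, $dv$ is Lebesgue measure on $B$ normalized by $v(B)=1$, and $d\lambda(z)=(1-|z|^2)^{-n-1}dv(z)$. $H(B)$ is the space of holomorphic functions on $B$. For $f\in H(B)$ with homogeneous expansion $f=\sum_{k\ge0}f_k$, and real $\alpha,t$ such that neither $n+\alpha$ nor $n+\alpha+t$ is a negative integer, $$R^{\alpha,t}f(z)=\sum_{k=0}^\infty\frac{\Gamma(n+1+\alpha)\,\Gamma(n+1+k+\alpha+t)}{\Gamma(n+1+\alpha+t)\,\Gamma(n+1+k+\alpha)}f_k(z).$$ Besov-Sobolev space: for an integer $m>0$, $0\le\sigma<\infty$, $1<p<\infty$ with $m+\sigma>n/p$, $B_p^\sigma(B)$ is the space of $f\in H(B)$ with $$\left\{\sum_{k=0}^{m-1}|f^{(k)}(0)|^p+\int_B|(1-|z|^2)^{m+\sigma}f^{(m)}(z)|^p\,d\lambda(z)\right\}^{1/p}<\infty,$$ where $f^{(k)}$ denotes the $k$-th order complex derivative of $f$ (the collection of all its $k$-th order holomorphic partial derivatives). The space does not depend on $m$ (different $m$ give equivalent norms). For $\alpha$ such that neither $n+\alpha$ nor $n+\alpha+m$ is a negative integer, this is equivalent to $$\|f\|_{B_p^\sigma(B)}^p=\int_B|R^{\alpha,m}f(z)|^p(1-|z|^2)^{mp+\sigma p-n-1}\,dv(z)<\infty,$$ and $\|f\|_{B_p^\sigma(B)}$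 denotes this quantity. A positive Borel measure $\mu$ on $B$ is a Carleson measure for $B_p^\sigma(B)$ if there is a constant $C>0$ such that $\int_B|f(z)|^p\,d\mu(z)\le C\|f\|_{B_p^\sigma(B)}^p$ for all $f\in B_p^\sigma(B)$. For $\xi\in S$, $\delta>0$, $Q_\delta(\xi)=\{z\in B:|1-\langle z,\xi\rangle|<\delta\}$. For a real number $q>0$, a positive Borel measure $\mu$ on $B$ is a $q$-Carleson measure if $\sup\{\mu(Q_\delta(\xi))/\delta^{nq}:\xi\in S,\ \delta>0\}<\infty$. *)

theory Defs
  imports "HOL-Complex_Analysis.Complex_Analysis" "HOL-Probability.Probability"
begin

text \<open>Complex $n$-space is \<^typ>\<open>complex ^ 'n\<close> with its Euclidean norm, and $n$ is
  \<^term>\<open>CARD('n)\<close>. Functions on the unit ball are total functions whose values outside the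
  ball are never used. Integrals of nonnegative functions, and suprema of quotients of
  measures, are taken in the extended nonnegative reals.\<close>

abbreviation unit_ball :: "(complex ^ 'n::finite) set" where
  "unit_ball \<equiv> ball 0 1"

abbreviation unit_sphere :: "(complex ^ 'n::finite) set" where
  "unit_sphere \<equiv> sphere 0 1"

definition cinner :: "complex ^ 'n::finite \<Rightarrow> complex ^ 'n \<Rightarrow> complex" where
  "cinner z w = (\<Sum>j\<in>UNIV. z $ j * cnj (w $ j))"

definition ball_volume :: "(complex ^ 'n::finite) measure" where
  "ball_volume = restrict_space (uniform_measure lborel unit_ball) unit_ball"

definition ball_lambda :: "(complex ^ 'n::finite) measure" where
  "ball_lambda =
     density ball_volume (\<lambda>z. ennreal ((1 - (norm z)\<^sup>2) powr (- real CARD('n) - 1)))"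

definition borel_measure_on_ball :: "(complex ^ 'n::finite) measure \<Rightarrow> bool" where
  "borel_measure_on_ball \<mu> \<longleftrightarrow> sets \<mu> = sets (restrict_space borel unit_ball)"


subsection \<open>Holomorphic functions on the ball and their derivatives\<close>

text \<open>Holomorphic means differentiable with a complex-linear derivative at every point.\<close>

definition holomorphic_ball :: "(complex ^ 'n::finite \<Rightarrow> complex) set" where
  "holomorphic_ball =
     {f. \<forall>z\<in>unit_ball. \<exists>D. (f has_derivative D) (at z) \<and> (\<forall>c v. D (c *s v) = c * D v)}"

definition partial_deriv ::
    "'n::finite \<Rightarrow> (complex ^ 'n \<Rightarrow> complex) \<Rightarrow> complex ^ 'n \<Rightarrow> complex" where
  "partial_deriv j f z = deriv (\<lambda>t. f (z + axis j t)) 0"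

text \<open>$|f^{(k)}(z)|$ is the Euclidean norm of the family of all $k$-th order partial derivatives
  $\partial_{j_1} \cdots \partial_{j_k} f(z)$, indexed by the words $j_1 \ldots j_k$.
  A mixed derivative therefore occurs once for each order of differentiation, which changes the
  norm only up to constants depending on $n$ and $k$.\<close>

definition deriv_norm ::
    "nat \<Rightarrow> (complex ^ 'n::finite \<Rightarrow> complex) \<Rightarrow> complex ^ 'n \<Rightarrow> real" where
  "deriv_norm k f z = L2_set (\<lambda>js. cmod (foldr partial_deriv js f z)) {js. length js = k}"


subsection \<open>Homogeneous expansion and fractional radial derivatives\<close>

definition homogeneous_poly :: "nat \<Rightarrow> (complex ^ 'n::finite \<Rightarrow> complex) \<Rightarrow> bool" where
  "homogeneous_poly k P \<longleftrightarrow>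
     (\<exists>c :: ('n \<Rightarrow> nat) \<Rightarrow> complex.
        \<forall>z. P z = (\<Sum>\<beta> | (\<Sum>i\<in>UNIV. \<beta> i) = k. c \<beta> * (\<Prod>i\<in>UNIV. (z $ i) ^ \<beta> i)))"

definition is_homogeneous_expansion ::
    "(complex ^ 'n::finite \<Rightarrow> complex) \<Rightarrow> (nat \<Rightarrow> complex ^ 'n \<Rightarrow> complex) \<Rightarrow> bool" where
  "is_homogeneous_expansion f F \<longleftrightarrow>
     (\<forall>k. homogeneous_poly k (F k)) \<and> (\<forall>z\<in>unit_ball. (\<lambda>k. F k z) sums f z)"

text \<open>The expansion exists and is unique for every holomorphic function on the ball.\<close>

definition homogeneous_expansion ::
    "(complex ^ 'n::finite \<Rightarrow> complex) \<Rightarrow> nat \<Rightarrow> complex ^ 'n \<Rightarrow> complex" where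
  "homogeneous_expansion f = (THE F. is_homogeneous_expansion f F)"

definition radial_deriv ::
    "real \<Rightarrow> real \<Rightarrow> (complex ^ 'n::finite \<Rightarrow> complex) \<Rightarrow> complex ^ 'n \<Rightarrow> complex" where
  "radial_deriv \<alpha> t f z =
     (let n = real CARD('n) in
      \<Sum>k. of_real (Gamma (n + 1 + \<alpha>) * Gamma (n + 1 + real k + \<alpha> + t) /
                    (Gamma (n + 1 + \<alpha> + t) * Gamma (n + 1 + real k + \<alpha>)))
           * homogeneous_expansion f k z)"


subsection \<open>Besov-Sobolev spaces and Carleson measures\<close>

text \<open>Up to equivalence of norms the space is the same for all $m > n/p - \sigma$. The outer
  power $1/p$ of the defining quantity is omitted, as only finiteness matters.\<close>

definition besov_sobolev ::
    "nat \<Rightarrow> real \<Rightarrow> real \<Rightarrow> (complex ^ 'n::finite \<Rightarrow> complex) set" where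
  "besov_sobolev m p \<sigma> =
     {f \<in> holomorphic_ball.
        ennreal (\<Sum>k<m. deriv_norm k f 0 powr p)
        + (\<integral>\<^sup>+z. ennreal (((1 - (norm z)\<^sup>2) powr (m + \<sigma>) * deriv_norm m f z) powr p)
             \<partial>ball_lambda) < \<infinity>}"

text \<open>The $p$-th power of the norm of $f$.\<close>

definition besov_norm_pow ::
    "nat \<Rightarrow> real \<Rightarrow> real \<Rightarrow> real \<Rightarrow> (complex ^ 'n::finite \<Rightarrow> complex) \<Rightarrow> ennreal" where
  "besov_norm_pow m \<alpha> p \<sigma> f =
     (\<integral>\<^sup>+z. ennreal (cmod (radial_deriv \<alpha> (real m) f z) powr p
                   * (1 - (norm z)\<^sup>2) powr (m * p + \<sigma> * p - real CARD('n) - 1)) \<partial>ball_volume)"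

definition besov_carleson ::
    "nat \<Rightarrow> real \<Rightarrow> real \<Rightarrow> real \<Rightarrow> (complex ^ 'n::finite) measure \<Rightarrow> bool" where
  "besov_carleson m \<alpha> p \<sigma> \<mu> \<longleftrightarrow>
     (\<exists>C>0. \<forall>f\<in>besov_sobolev m p \<sigma>.
        (\<integral>\<^sup>+z. ennreal (cmod (f z) powr p) \<partial>\<mu>) \<le> ennreal C * besov_norm_pow m \<alpha> p \<sigma> f)"

definition carleson_region :: "real \<Rightarrow> complex ^ 'n::finite \<Rightarrow> (complex ^ 'n) set" where
  "carleson_region \<delta> \<xi> = {z \<in> unit_ball. cmod (1 - cinner z \<xi>) < \<delta>}"

definition q_carleson :: "real \<Rightarrow> (complex ^ 'n::finite) measure \<Rightarrow> bool" where
  "q_carleson q \<mu> \<longleftrightarrow>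
     (SUP (\<xi>, \<delta>) \<in> unit_sphere \<times> {0<..}.
        emeasure \<mu> (carleson_region \<delta> \<xi>) / ennreal (\<delta> powr (real CARD('n) * q))) < \<infinity>"

end

theory Submission
  imports Defs
begin

text \<open>Everything is governed by the size of $d(z,w) = |1-\langle z,w\rangle|$. The region $Q_\delta(\xi)$ lies in a box of
  width $\delta$ in the complex direction $\xi$ and $\sqrt\delta$ in the $n-1$ orthogonal ones, so its volume is
  $O(\delta^{n+1})$. For $w$ in the ball, the set of all $z$ with $d(z,w) < 2\cdot 2^{-k}$ is empty or contained in
  $Q_{4\cdot 2^{-k}}(w/|w|)$. Hence the integral of a function of $d(\cdot,w)$, with respect to any measure on the ball, is
  bounded by a sum over dyadic scales of masses of such regions (\<open>nn_integral_kernel_le\<close>). All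
  estimates of integrals of powers of $d$ are instances of this bound.

  Since $m$ is an integer, $R^{\alpha,m}$ is, up to a constant, the product of the first-order operators $n+1+\alpha+j+R$
  over $0 \le j < m$, where $R$ is the radial derivative. The mean value property on a small box about $z$ gives
  $$|g(z)| \le C \int |g(w)| (1-|w|^2)^N d(z,w)^{-(n+1+N)}\, dv(w)$$
  for holomorphic $g$ (\<open>pointwise_kernel_bound\<close>). Undoing one of the first-order operators means
  solving a linear differential equation along the radius; this is one integration, and lowers the exponent of the
  kernel by one (\<open>kernel_step\<close>). After $m$ steps
  $$|f(z)| \le C \int |R^{\alpha,m}f(w)| (1-|w|^2)^N d(z,w)^{-(n+1+N-m)}\, dv(w)$$
  (\<open>radial_representation_bound\<close>). This positive kernel takes the place of a reproducing formula.

  Sufficiency. Let $\omega_k > 0$ be summable, and give the scale $d \approx 2^{-k}$ the weight $\omega_k$. The integral of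
  $d(z,w)^{-(n+1)}$ times this weight over all $w$ is bounded, as each scale contributes $O(\omega_k)$. Hoelder's
  inequality then bounds $|f(z)|^p$ by an integral over $w$, and integration with respect to $\mu$ shows that
  $\mu$ is a Carleson measure as soon as $\mu(Q_{4\cdot 2^{-k}}(\xi)) \le D\, 2^{-k\sigma p} \omega_k^{p-1}$ for all $\xi$ and
  $k$ (\<open>dyadic_carleson_sufficient\<close>). The additional $\varepsilon$ in the hypotheses is exactly what makes a
  suitable $\omega$ summable: a geometric sequence for $\sigma > 0$, and $(k+1)^{-1-\varepsilon/(p-1)}$ for $\sigma = 0$.

  Necessity. The Carleson inequality is tested on functions $\varphi(\langle z,w\rangle)$ with $w = (1-\delta)\xi$, where
  $\varphi(u) = (1-u)^{-s}$ with an integer $s > \sigma$, or $\varphi(u) = \log(1-u)$ if $\sigma = 0$. On $Q_\delta(\xi)$ one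
  has $d(z,w) < 2\delta$, so the function is at least of order $\delta^{-s}$ or $\log\frac{2}{\delta}$ there when $\delta$
  is small, while the $p$-th power of its norm is of order at most $\delta^{-(s-\sigma)p}$ or
  $\log\frac{2}{\delta}$ (\<open>ridge_test_estimate\<close>).\<close>

section \<open>Lebesgue measure under isometries and stretches\<close>

lemma nn_integral_lborel_translate:
  fixes f :: "'a::euclidean_space \<Rightarrow> ennreal"
  assumes [measurable]: "f \<in> borel_measurable borel"
  shows "(\<integral>\<^sup>+x. f (c + x) \<partial>lborel) = (\<integral>\<^sup>+x. f x \<partial>lborel)"
proof -
  have "(\<integral>\<^sup>+x. f x \<partial>lborel) = (\<integral>\<^sup>+x. f x \<partial>distr lborel borel ((+) c))"
    by (simp add: lborel_distr_plus)
  also have "\<dots> = (\<integral>\<^sup>+x. f (c + x) \<partial>lborel)"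
    by (subst nn_integral_distr) auto
  finally show ?thesis by simp
qed

lemma emeasure_lborel_vimage_translate:
  fixes A :: "'a::euclidean_space set"
  assumes [measurable]: "A \<in> sets borel"
  shows "emeasure lborel ((+) c -` A) = emeasure lborel A"
  using emeasure_distr[of "(+) c" lborel borel A] by (simp add: lborel_distr_plus)

lemma emeasure_lborel_ball: "emeasure lborel (ball (c :: 'a::euclidean_space) r) = ennreal (measure lborel (ball c r))"
  using emeasure_lborel_ball_finite[of c r] by (simp add: emeasure_eq_ennreal_measure less_top)

lemma linear_borel_measurable:
  fixes U :: "'a::euclidean_space \<Rightarrow> 'b::euclidean_space"
  assumes "linear U"
  shows "U \<in> borel_measurable borel"
  using assms by (intro borel_measurable_continuous_onI linear_continuous_on) (simp add: linear_linear)

text \<open>The classical argument for the uniqueness of Haar measure. Let $b$ be the indicator function of the unit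
  ball, and consider the double integral of $1_A(Ux)\, b(y-Ux)$. Integration over $y$ first gives the product of
  the measures of $U^{-1}A$ and of the ball. In the integral over $x$ the substitution of $x + U^{-1}y$
  for $x$ turns the integrand into $1_A(Ux+y)\, b(x)$, because $b(-Ux) = b(x)$, and now the double integral is
  the product of the measures of $A$ and of the ball.\<close>

lemma emeasure_lborel_isometry:
  fixes U :: "'a::euclidean_space \<Rightarrow> 'a"
  assumes "linear U" and iso: "\<And>x. norm (U x) = norm x" and A[measurable]: "A \<in> sets borel"
  shows "emeasure lborel (U -` A) = emeasure lborel A"
proof -
  have U[measurable]: "U \<in> borel_measurable borel"
    using assms(1) by (rule linear_borel_measurable)
  have "inj U"
    using assms(1) iso by (metis linear_injective_0 norm_eq_zero)
  then have "surj U"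
    using assms(1) linear_injective_imp_surjective by blast
  define B where "B = ball (0::'a) 1"
  let ?B = B
  have B[measurable]: "B \<in> sets borel" by (simp add: B_def)
  let ?A = "indicator A :: 'a \<Rightarrow> ennreal"
  let ?b = "indicator ?B :: 'a \<Rightarrow> ennreal"
  have b_even: "?b (- U x) = ?b x" for x
    by (simp add: indicator_def iso B_def)
  have A': "U -` A \<in> sets borel"
    using measurable_sets[OF U A] by simp
  have inner: "(\<integral>\<^sup>+x. ?A (U x) * ?b (y - U x) \<partial>lborel) = (\<integral>\<^sup>+x. ?A (U x + y) * ?b x \<partial>lborel)" for y
  proof -
    obtain y' where y: "y = U y'" using \<open>surj U\<close> by (metis surjD)
    have "(\<integral>\<^sup>+x. ?A (U x) * ?b (y - U x) \<partial>lborel) = (\<integral>\<^sup>+x. ?A (U (y' + x)) * ?b (y - U (y' + x)) \<partial>lborel)"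
      by (subst nn_integral_lborel_translate) auto
    also have "\<dots> = (\<integral>\<^sup>+x. ?A (U x + y) * ?b (- U x) \<partial>lborel)"
      by (simp add: y linear_add[OF assms(1)] add.commute)
    finally show ?thesis by (simp only: b_even)
  qed
  have "emeasure lborel (U -` A) * emeasure lborel ?B
      = (\<integral>\<^sup>+x. ?A (U x) \<partial>lborel) * emeasure lborel ?B"
    using A' by (simp flip: nn_integral_indicator add: indicator_vimage o_def)
  also have "\<dots> = (\<integral>\<^sup>+x. ?A (U x) * (\<integral>\<^sup>+y. ?b (y - U x) \<partial>lborel) \<partial>lborel)"
  proof -
    have "(\<integral>\<^sup>+y. ?b (y - U x) \<partial>lborel) = emeasure lborel ?B" for x
      using nn_integral_lborel_translate[of ?b "- U x"] by simp
    then show ?thesis by (simp add: nn_integral_multc)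
  qed
  also have "\<dots> = (\<integral>\<^sup>+x. (\<integral>\<^sup>+y. ?A (U x) * ?b (y - U x) \<partial>lborel) \<partial>lborel)"
    by (intro nn_integral_cong nn_integral_cmult[symmetric]) measurable
  also have "\<dots> = (\<integral>\<^sup>+y. (\<integral>\<^sup>+x. ?A (U x) * ?b (y - U x) \<partial>lborel) \<partial>lborel)"
    by (intro lborel_pair.Fubini') measurable
  also have "\<dots> = (\<integral>\<^sup>+y. (\<integral>\<^sup>+x. ?A (U x + y) * ?b x \<partial>lborel) \<partial>lborel)"
    by (simp only: inner)
  also have "\<dots> = (\<integral>\<^sup>+x. (\<integral>\<^sup>+y. ?A (U x + y) * ?b x \<partial>lborel) \<partial>lborel)"
    by (intro lborel_pair.Fubini') measurable
  also have "\<dots> = (\<integral>\<^sup>+x. (\<integral>\<^sup>+y. ?A (U x + y) \<partial>lborel) * ?b x \<partial>lborel)"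
    by (intro nn_integral_cong nn_integral_multc) measurable
  also have "\<dots> = (\<integral>\<^sup>+x. emeasure lborel A * ?b x \<partial>lborel)"
    by (subst nn_integral_lborel_translate) auto
  also have "\<dots> = emeasure lborel A * emeasure lborel ?B"
    by (subst nn_integral_cmult) auto
  finally have eq: "emeasure lborel (U -` A) * emeasure lborel ?B = emeasure lborel A * emeasure lborel ?B" .
  have "emeasure lborel ?B \<noteq> \<infinity>" "emeasure lborel ?B \<noteq> 0"
    using emeasure_lborel_ball_finite[of "0::'a" 1] content_ball_pos[of 1 "0::'a"]
    by (auto simp: B_def measure_def)
  then show ?thesis using eq
    by (metis ennreal_mult_cancel_left infinity_ennreal_def mult.commute)
qed

lemma nn_integral_lborel_isometry:
  fixes U :: "'a::euclidean_space \<Rightarrow> 'a"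
  assumes U: "linear U" and iso: "\<And>x. norm (U x) = norm x" and [measurable]: "f \<in> borel_measurable borel"
  shows "(\<integral>\<^sup>+x. f (U x) \<partial>lborel) = (\<integral>\<^sup>+x. f x \<partial>lborel)"
proof -
  have [measurable]: "U \<in> borel_measurable borel" by (rule linear_borel_measurable[OF U])
  have "distr lborel borel U = lborel"
    by (rule measure_eqI) (simp_all add: emeasure_distr emeasure_lborel_isometry[OF U iso])
  then have "(\<integral>\<^sup>+x. f x \<partial>lborel) = (\<integral>\<^sup>+x. f x \<partial>distr lborel borel U)" by simp
  also have "\<dots> = (\<integral>\<^sup>+x. f (U x) \<partial>lborel)" by (subst nn_integral_distr) auto
  finally show ?thesis by simp
qed

definition stretch :: "'a::euclidean_space \<Rightarrow> real \<Rightarrow> 'a \<Rightarrow> 'a" where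
  "stretch v s x = x + ((s - 1) * (x \<bullet> v)) *\<^sub>R v"

lemma linear_stretch: "linear (stretch v s)"
  by (auto simp: stretch_def linear_iff algebra_simps)

lemma stretch_measurable[measurable]: "stretch v s \<in> borel_measurable borel"
  by (rule linear_borel_measurable[OF linear_stretch])

text \<open>For a basis vector the stretch is a diagonal map. The general case follows by conjugation with the
  Householder reflection that exchanges the unit vector with a basis vector.\<close>

lemma emeasure_vimage_stretch:
  fixes v :: "'a::euclidean_space"
  assumes "norm v = 1" "s > 0" and A[measurable]: "A \<in> sets borel"
  shows "ennreal s * emeasure lborel (stretch v s -` A) = emeasure lborel A"
proof -
  obtain b :: 'a where b: "b \<in> Basis" using nonempty_Basis by blast
  have basis: "ennreal s * emeasure lborel (stretch b s -` A) = emeasure lborel A"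
    if [measurable]: "A \<in> sets borel" for A
  proof -
    let ?c = "\<lambda>j. if j = b then s else 1"
    have S: "stretch b s = (\<lambda>x. 0 + (\<Sum>j\<in>Basis. (?c j * (x \<bullet> j)) *\<^sub>R j))"
    proof
      fix x :: 'a
      have "(\<Sum>j\<in>Basis. (?c j * (x \<bullet> j)) *\<^sub>R j) = (\<Sum>j\<in>Basis. (x \<bullet> j) *\<^sub>R j + (if j = b then ((s - 1) * (x \<bullet> b)) *\<^sub>R b else 0))"
        by (intro sum.cong) (auto simp: algebra_simps)
      also have "\<dots> = stretch b s x"
        using b by (simp add: sum.distrib euclidean_representation stretch_def)
      finally show "stretch b s x = 0 + (\<Sum>j\<in>Basis. (?c j * (x \<bullet> j)) *\<^sub>R j)" by simp
    qed
    have "(\<Prod>j\<in>Basis. \<bar>?c j\<bar>) = s"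
      using b assms(2) by (simp add: if_distrib[of abs] prod.If_cases cong: if_cong)
    then have "lborel = density (distr lborel borel (stretch b s)) (\<lambda>_. ennreal s)"
      using lborel_affine_euclidean[of ?c 0] assms(2) unfolding S by auto
    then have "emeasure lborel A = emeasure (density (distr lborel borel (stretch b s)) (\<lambda>_. ennreal s)) A"
      by simp
    also have "\<dots> = ennreal s * emeasure lborel (stretch b s -` A)"
      by (simp add: emeasure_density_const emeasure_distr)
    finally show ?thesis by simp
  qed
  define u where "u = v - b"
  define R where "R x = x - (2 * (x \<bullet> u) / (u \<bullet> u)) *\<^sub>R u" for x
  have vv: "v \<bullet> v = 1" "b \<bullet> b = 1"
    using assms(1) b by (auto simp: dot_square_norm)
  have linR: "linear R"
    by (auto simp: R_def linear_iff algebra_simps add_divide_distrib)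
  have RR: "R x \<bullet> R y = x \<bullet> y" for x y
    by (cases "u = 0") (simp_all add: R_def inner_diff_left inner_diff_right inner_commute)
  have normR: "norm (R x) = norm x" for x
    by (simp add: norm_eq_sqrt_inner RR)
  have Rb: "R b = v"
  proof (cases "u = 0")
    case False
    have "u \<bullet> u = 2 * (1 - b \<bullet> v)" "b \<bullet> u = b \<bullet> v - 1"
      by (simp_all add: u_def inner_diff_left inner_diff_right vv inner_commute)
    then have "2 * (b \<bullet> u) = - (u \<bullet> u)" by simp
    moreover have "u \<bullet> u \<noteq> 0" using False by simp
    ultimately have "2 * (b \<bullet> u) / (u \<bullet> u) = -1"
      by (metis divide_minus_left divide_self)
    then show ?thesis by (simp add: R_def u_def)
  qed (simp add: R_def u_def)
  have inv: "R (R x) = x" for x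
    by (cases "u = 0") (simp_all add: R_def inner_diff_left inner_diff_right algebra_simps)
  have conj: "R (stretch b s (R x)) = stretch v s x" for x
  proof -
    have "R (stretch b s (R x)) = R (R x) + ((s - 1) * (R x \<bullet> b)) *\<^sub>R R b"
      unfolding stretch_def by (simp add: linear_add[OF linR] linear_scale[OF linR])
    also have "R x \<bullet> b = x \<bullet> v"
      using RR[of x "R b"] inv[of b] RR[of "R x" b] Rb by (metis RR)
    finally show ?thesis by (simp add: inv Rb stretch_def)
  qed
  have [measurable]: "R \<in> borel_measurable borel" by (rule linear_borel_measurable[OF linR])
  have m: "R -` A \<in> sets borel" "stretch b s -` (R -` A) \<in> sets borel"
    using measurable_sets[of R borel borel A] measurable_sets[of "stretch b s" borel borel "R -` A"] by auto
  have "stretch v s -` A = R -` (stretch b s -` (R -` A))"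
    using conj by auto
  then have "emeasure lborel (stretch v s -` A) = emeasure lborel (stretch b s -` (R -` A))"
    using emeasure_lborel_isometry[OF linR normR m(2)] by simp
  then show ?thesis
    using basis[OF m(1)] emeasure_lborel_isometry[OF linR normR A] by simp
qed

lemma emeasure_vimage_scaleR:
  fixes A :: "'a::euclidean_space set"
  assumes "s > 0" and [measurable]: "A \<in> sets borel"
  shows "ennreal (s ^ DIM('a)) * emeasure lborel ((*\<^sub>R) s -` A) = emeasure lborel A"
proof -
  have "lborel = density (distr lborel borel (\<lambda>x::'a. 0 + s *\<^sub>R x)) (\<lambda>_. ennreal (\<bar>s\<bar> ^ DIM('a)))"
    by (rule lborel_affine) (use assms in auto)
  then have "emeasure lborel A = emeasure (density (distr lborel borel ((*\<^sub>R) s)) (\<lambda>_. ennreal (s ^ DIM('a)))) A"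
    using assms(1) by simp
  also have "\<dots> = ennreal (s ^ DIM('a)) * emeasure lborel ((*\<^sub>R) s -` A)"
    by (simp add: emeasure_density_const emeasure_distr)
  finally show ?thesis by simp
qed

section \<open>The Hermitian inner product\<close>

lemma cinner_Re: "Re (cinner z w) = z \<bullet> w"
  by (simp add: cinner_def inner_vec_def inner_complex_def)

lemma cinner_add_left: "cinner (x + y) w = cinner x w + cinner y w"
  by (simp add: cinner_def algebra_simps sum.distrib)
lemma cinner_scale_left: "cinner (c *s x) w = c * cinner x w"
  by (simp add: cinner_def algebra_simps sum_distrib_left)
lemma scaleR_vec_component: "(c *\<^sub>R x) $ i = complex_of_real c * x $ i"
  unfolding vector_scaleR_component by (rule scaleR_conv_of_real)

lemma cinner_scaleR_left: "cinner (c *\<^sub>R x) w = of_real c * cinner x w"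
  unfolding cinner_def scaleR_vec_component by (simp add: mult.assoc sum_distrib_left)
lemma cinner_scaleR_right: "cinner x (c *\<^sub>R w) = of_real c * cinner x w"
  unfolding cinner_def scaleR_vec_component by (simp add: mult.left_commute sum_distrib_left)
lemma cinner_diff_left: "cinner (x - y) w = cinner x w - cinner y w"
  by (simp add: cinner_def algebra_simps sum_subtractf)
lemma cinner_add_right: "cinner x (w + y) = cinner x w + cinner x y"
  by (simp add: cinner_def algebra_simps sum.distrib)
lemma cinner_commute: "cinner w z = cnj (cinner z w)"
  by (simp add: cinner_def mult.commute)
lemma cinner_self: "cinner z z = of_real ((norm z)\<^sup>2)"
proof -
  have "Im (cinner z z) = 0" by (simp add: cinner_def mult.commute)
  moreover have "Re (cinner z z) = (norm z)\<^sup>2" by (simp add: cinner_Re dot_square_norm)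
  ultimately show ?thesis by (simp add: complex_eq_iff)
qed

lemma norm_vector_smult: "norm (c *s (z :: complex ^ 'n::finite)) = cmod c * norm z"
  by (simp add: norm_vec_def norm_mult L2_set_right_distrib)

text \<open>Multiplying the first argument by a unimodular scalar makes the Hermitian product real, and then it
  is the Euclidean inner product.\<close>

lemma cmod_cinner_le: "cmod (cinner z w) \<le> norm z * norm w"
proof (cases "cinner z w = 0")
  case False
  let ?c = "cnj (cinner z w) / cmod (cinner z w)"
  have c: "cmod ?c = 1" using False by (simp add: norm_divide)
  have "cmod (cinner z w) = Re (?c * cinner z w)"
  proof -
    have "?c * cinner z w = of_real ((cmod (cinner z w))\<^sup>2 / cmod (cinner z w))"
      by (metis complex_norm_square mult.commute of_real_divide times_divide_eq_left)
    then show ?thesis using False by (simp add: power2_eq_square)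
  qed
  also have "\<dots> = (?c *s z) \<bullet> w" by (simp only: cinner_scale_left[symmetric] cinner_Re)
  also have "\<dots> \<le> norm (?c *s z) * norm w" by (rule norm_cauchy_schwarz)
  finally show ?thesis by (simp only: norm_vector_smult c mult_1)
qed simp

lemma cmod_cinner_less: "norm z < 1 \<Longrightarrow> norm w < 1 \<Longrightarrow> cmod (cinner z w) < 1"
proof -
  assume z: "norm z < 1" and w: "norm w < 1"
  have "cmod (cinner z w) \<le> norm z * norm w" by (rule cmod_cinner_le)
  also have "\<dots> \<le> norm z * 1" using w by (intro mult_left_mono) auto
  finally show ?thesis using z by simp
qed

lemma unit_direction:
  obtains \<xi> :: "complex ^ 'n::finite" where "norm \<xi> = 1" "z = norm z *\<^sub>R \<xi>"
proof (cases "z = 0")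
  case True
  then show ?thesis using that[of "axis undefined 1"] by (simp add: norm_axis_1)
next
  case False
  then show ?thesis using that[of "(1 / norm z) *\<^sub>R z"] by simp
qed

lemma continuous_on_cinner[continuous_intros]:
  "continuous_on S f \<Longrightarrow> continuous_on S g \<Longrightarrow> continuous_on S (\<lambda>x. cinner (f x) (g x))"
  unfolding cinner_def by (intro continuous_intros)

lemma cinner_measurable[measurable]:
  fixes f g :: "'a \<Rightarrow> complex ^ 'n::finite"
  shows "f \<in> borel_measurable M \<Longrightarrow> g \<in> borel_measurable M \<Longrightarrow> (\<lambda>x. cinner (f x) (g x)) \<in> borel_measurable M"
proof -
  assume [measurable]: "f \<in> borel_measurable M" "g \<in> borel_measurable M"
  have "(\<lambda>p. cinner (fst p) (snd p)) \<in> borel_measurable (borel :: ((complex ^ 'n) \<times> (complex ^ 'n)) measure)"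
    by (intro borel_measurable_continuous_onI continuous_intros)
  then have "(\<lambda>x. (\<lambda>p. cinner (fst p) (snd p)) (f x, g x)) \<in> borel_measurable M"
    by (rule measurable_compose[rotated]) measurable
  then show ?thesis by simp
qed

section \<open>Anisotropic boxes\<close>

text \<open>Up to constants, and for $\delta \le 1$, these boxes have width $\delta$ in the complex direction $\xi$ and
  $\sqrt\delta$ in the orthogonal directions. The factor 2 is the one produced by Carleson regions: if
  $|1-\langle z,\xi\rangle| < \delta$ and $|z| < 1$, then $|z-\xi|^2 < 2 - 2\,\mathrm{Re}\langle z,\xi\rangle
  < 2\delta$.\<close>

definition aniso_box :: "complex ^ 'n::finite \<Rightarrow> real \<Rightarrow> (complex ^ 'n) set" where
  "aniso_box \<xi> \<delta> = {h. cmod (cinner h \<xi>) < \<delta> \<and> (norm h)\<^sup>2 < 2 * \<delta>}"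

lemma aniso_box_borel[measurable]: "aniso_box \<xi> \<delta> \<in> sets borel"
proof -
  have "{h \<in> space borel. cmod (cinner h \<xi>) < \<delta> \<and> (norm h)\<^sup>2 < 2 * \<delta>} \<in> sets borel"
    by measurable
  then show ?thesis by (simp add: aniso_box_def)
qed

text \<open>Multiplication by $\delta$ on the complex line of $\xi$ and by $\sqrt\delta$ on its orthogonal
  complement: the common factor $\sqrt\delta$ is taken out, and what remains are two stretches in the
  orthonormal real directions $\xi$ and $i\xi$.\<close>

definition aniso_scale :: "complex ^ 'n::finite \<Rightarrow> real \<Rightarrow> complex ^ 'n \<Rightarrow> complex ^ 'n" where
  "aniso_scale \<xi> \<delta> h = sqrt \<delta> *\<^sub>R stretch \<xi> (sqrt \<delta>) (stretch (\<i> *s \<xi>) (sqrt \<delta>) h)"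

lemma inner_i: "x \<bullet> (\<i> *s \<xi>) = Im (cinner x \<xi>)"
proof -
  have "cinner x (\<i> *s \<xi>) = - \<i> * cinner x \<xi>"
    by (simp add: cinner_def sum_distrib_left algebra_simps)
  then show ?thesis by (simp flip: cinner_Re)
qed

lemma norm_stretch: 
  assumes "norm v = 1" shows "(norm (stretch v s x))\<^sup>2 = (norm x)\<^sup>2 + (s\<^sup>2 - 1) * (x \<bullet> v)\<^sup>2"
proof -
  have "v \<bullet> v = 1" using assms by (simp add: dot_square_norm)
  then show ?thesis
    unfolding power2_norm_eq_inner stretch_def inner_add_left inner_add_right inner_scaleR_left inner_scaleR_right
    by (simp add: inner_commute power2_eq_square algebra_simps)
qed

text \<open>The volume factor is $(\sqrt\delta)^{2n}$ from the common factor, times $\sqrt\delta$ from each of the two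
  stretches.\<close>

lemma aniso_scale_props:
  assumes "norm \<xi> = 1" "\<delta> > 0"
  shows "cinner (aniso_scale \<xi> \<delta> h) \<xi> = of_real \<delta> * cinner h \<xi>"
    and "(norm (aniso_scale \<xi> \<delta> h))\<^sup>2 = \<delta> * ((norm h)\<^sup>2 - (cmod (cinner h \<xi>))\<^sup>2) + \<delta>\<^sup>2 * (cmod (cinner h \<xi>))\<^sup>2"
    and "A \<in> sets borel \<Longrightarrow> ennreal (\<delta> ^ (CARD('n::finite) + 1)) * emeasure lborel (aniso_scale (\<xi>::complex^'n) \<delta> -` A) = emeasure lborel A"
proof -
  let ?s = "sqrt \<delta>"
  have i1: "norm (\<i> *s \<xi>) = 1" using assms by (simp add: norm_vector_smult)
  have self: "cinner \<xi> \<xi> = 1" using assms by (simp add: cinner_self)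
  have self_i: "cinner (\<i> *s \<xi>) \<xi> = \<i>" by (simp add: cinner_scale_left self)
  let ?x = "stretch (\<i> *s \<xi>) ?s h"
  have x: "cinner ?x \<xi> = Complex (Re (cinner h \<xi>)) (?s * Im (cinner h \<xi>))"
    unfolding stretch_def cinner_add_left cinner_scaleR_left self_i inner_i
    by (simp add: complex_eq_iff algebra_simps)
  have y: "cinner (stretch \<xi> ?s ?x) \<xi> = Complex (?s * Re (cinner h \<xi>)) (?s * Im (cinner h \<xi>))"
    using x unfolding stretch_def[of \<xi>] cinner_add_left cinner_scaleR_left self
    by (simp add: complex_eq_iff algebra_simps cinner_Re[symmetric])
  show "cinner (aniso_scale \<xi> \<delta> h) \<xi> = of_real \<delta> * cinner h \<xi>"
    using assms(2) unfolding aniso_scale_def cinner_scaleR_left y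
    by (simp add: complex_eq_iff)
  have "(norm (aniso_scale \<xi> \<delta> h))\<^sup>2 = \<delta> * (norm (stretch \<xi> ?s ?x))\<^sup>2"
    using assms(2) by (simp add: aniso_scale_def power_mult_distrib)
  also have "(norm (stretch \<xi> ?s ?x))\<^sup>2 = (norm ?x)\<^sup>2 + (\<delta> - 1) * (Re (cinner h \<xi>))\<^sup>2"
    using assms x by (simp add: norm_stretch flip: cinner_Re)
  also have "(norm ?x)\<^sup>2 = (norm h)\<^sup>2 + (\<delta> - 1) * (Im (cinner h \<xi>))\<^sup>2"
    using assms i1 by (simp add: norm_stretch inner_i)
  finally show "(norm (aniso_scale \<xi> \<delta> h))\<^sup>2 = \<delta> * ((norm h)\<^sup>2 - (cmod (cinner h \<xi>))\<^sup>2) + \<delta>\<^sup>2 * (cmod (cinner h \<xi>))\<^sup>2"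
    unfolding cmod_power2 by (simp add: power2_eq_square[of \<delta>] algebra_simps)
  assume A: "A \<in> sets borel"
  have pos: "?s > 0" using assms by simp
  have 1: "(*\<^sub>R) ?s -` A \<in> sets borel"
    using measurable_sets[of "(*\<^sub>R) ?s" borel borel A] A by auto
  have 2: "stretch \<xi> ?s -` ((*\<^sub>R) ?s -` A) \<in> sets borel"
    using measurable_sets[of "stretch \<xi> ?s" borel borel] 1 by auto
  have "DIM(complex^'n) = CARD('n) + CARD('n)" by simp
  then have d: "?s ^ DIM(complex^'n) = \<delta> ^ CARD('n)"
    using assms(2) by (simp only: power_add flip: power_mult_distrib) simp
  have "emeasure lborel A = ennreal (\<delta> ^ CARD('n)) * (ennreal ?s * (ennreal ?s * emeasure lborel (stretch (\<i> *s \<xi>) ?s -` stretch \<xi> ?s -` (*\<^sub>R) ?s -` A)))"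
    unfolding emeasure_vimage_stretch[OF i1 pos 2] emeasure_vimage_stretch[OF assms(1) pos 1]
    using emeasure_vimage_scaleR[OF pos A] d by simp
  also have "stretch (\<i> *s \<xi>) ?s -` stretch \<xi> ?s -` (*\<^sub>R) ?s -` A = aniso_scale \<xi> \<delta> -` A"
    by (auto simp: aniso_scale_def)
  also have "ennreal (\<delta> ^ CARD('n)) * (ennreal ?s * (ennreal ?s * x)) = ennreal (\<delta> ^ (CARD('n) + 1)) * x" for x
    using assms(2) by (simp add: ennreal_mult'[symmetric] mult.assoc[symmetric] mult.commute[of \<delta>])
  finally show "ennreal (\<delta> ^ (CARD('n) + 1)) * emeasure lborel (aniso_scale \<xi> \<delta> -` A) = emeasure lborel A" by simp
qed

lemma measurable_aniso_scale[measurable]: "aniso_scale \<xi> \<delta> \<in> borel_measurable borel"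
  unfolding aniso_scale_def[abs_def] by measurable

lemma emeasure_aniso_box:
  fixes \<xi> :: "complex ^ 'n::finite"
  assumes "norm \<xi> = 1" "\<delta> > 0"
  shows "emeasure lborel (aniso_box \<xi> \<delta>) = ennreal (\<delta> ^ (CARD('n) + 1)) * emeasure lborel (aniso_scale \<xi> \<delta> -` aniso_box \<xi> \<delta>)"
    and "aniso_scale \<xi> \<delta> -` aniso_box \<xi> \<delta> \<in> sets borel"
  using aniso_scale_props(3)[OF assms aniso_box_borel] measurable_sets[OF measurable_aniso_scale aniso_box_borel] by simp_all

text \<open>The preimage of the box under the anisotropic scaling lies in a ball of radius 2, whatever
  $\xi$ and $\delta$ are.\<close>

lemma aniso_box_volume_le:
  "\<exists>C>0. \<forall>(\<xi> :: complex ^ 'n::finite) \<delta>. norm \<xi> = 1 \<longrightarrow> \<delta> > 0 \<longrightarrow>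
     emeasure lborel (aniso_box \<xi> \<delta>) \<le> ennreal (C * \<delta> ^ (CARD('n) + 1))"
proof -
  let ?c2 = "measure lborel (ball (0 :: complex ^ 'n) 2)"
  have "emeasure lborel (aniso_box \<xi> \<delta>) \<le> ennreal (?c2 * \<delta> ^ (CARD('n) + 1))"
    if 1: "norm \<xi> = 1" and d: "\<delta> > 0" for \<xi> :: "complex ^ 'n" and \<delta> :: real
  proof -
    have "aniso_scale \<xi> \<delta> -` aniso_box \<xi> \<delta> \<subseteq> ball 0 2"
    proof
      fix h assume "h \<in> aniso_scale \<xi> \<delta> -` aniso_box \<xi> \<delta>"
      then have "cmod (cinner h \<xi>) < 1" and a: "\<delta> * ((norm h)\<^sup>2 - (cmod (cinner h \<xi>))\<^sup>2) + \<delta>\<^sup>2 * (cmod (cinner h \<xi>))\<^sup>2 < \<delta> * 2"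
        using d unfolding aniso_box_def by (auto simp: aniso_scale_props[OF 1 d] norm_mult simp del: of_real_mult)
      have "\<delta> * ((norm h)\<^sup>2 - (cmod (cinner h \<xi>))\<^sup>2) < \<delta> * 2"
        using a by (smt (verit) mult_nonneg_nonneg zero_le_power2)
      then have "(norm h)\<^sup>2 - (cmod (cinner h \<xi>))\<^sup>2 < 2" using d by simp
      moreover have "(cmod (cinner h \<xi>))\<^sup>2 < 1"
        using \<open>cmod (cinner h \<xi>) < 1\<close> by (simp add: power_less_one_iff)
      ultimately have "(norm h)\<^sup>2 < 2\<^sup>2" by simp
      then have "norm h < 2" by (rule power_less_imp_less_base) simp
      then show "h \<in> ball 0 2" by simp
    qed
    then have "emeasure lborel (aniso_scale \<xi> \<delta> -` aniso_box \<xi> \<delta>) \<le> ennreal ?c2"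
      unfolding emeasure_lborel_ball[symmetric] by (intro emeasure_mono) auto
    then have "ennreal (\<delta> ^ (CARD('n) + 1)) * emeasure lborel (aniso_scale \<xi> \<delta> -` aniso_box \<xi> \<delta>) \<le> ennreal (\<delta> ^ (CARD('n) + 1)) * ennreal ?c2"
      by (rule mult_left_mono) simp
    then show ?thesis
      unfolding emeasure_aniso_box[OF that] using d by (simp add: ennreal_mult'[symmetric] mult.commute)
  qed
  moreover have "?c2 > 0" by (simp add: content_ball_pos)
  ultimately show ?thesis by blast
qed

text \<open>For $\delta \le 1$ the preimage of the box under the scaling contains the unit ball.\<close>

lemma aniso_box_volume_ge:
  "\<exists>c>0. \<forall>(\<xi> :: complex ^ 'n::finite) \<delta>. norm \<xi> = 1 \<longrightarrow> 0 < \<delta> \<longrightarrow> \<delta> \<le> 1 \<longrightarrow>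
     ennreal (c * \<delta> ^ (CARD('n) + 1)) \<le> emeasure lborel (aniso_box \<xi> \<delta>)"
proof -
  let ?c1 = "measure lborel (ball (0 :: complex ^ 'n) 1)"
  have "ennreal (?c1 * \<delta> ^ (CARD('n) + 1)) \<le> emeasure lborel (aniso_box \<xi> \<delta>)"
    if 1: "norm \<xi> = 1" and d: "\<delta> > 0" and d1: "\<delta> \<le> 1" for \<xi> :: "complex ^ 'n" and \<delta> :: real
  proof -
    have "ball 0 1 \<subseteq> aniso_scale \<xi> \<delta> -` aniso_box \<xi> \<delta>"
    proof
      fix h :: "complex ^ 'n" assume "h \<in> ball 0 1"
      then have h: "norm h < 1" by simp
      have c: "cmod (cinner h \<xi>) < 1"
        using cmod_cinner_le[of h \<xi>] 1 h by simp
      let ?a = "(cmod (cinner h \<xi>))\<^sup>2"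
      have "\<delta>\<^sup>2 * ?a \<le> \<delta> * ?a"
        using d d1 by (intro mult_right_mono) (auto simp: power2_eq_square mult_left_le)
      then have "\<delta> * ((norm h)\<^sup>2 - ?a) + \<delta>\<^sup>2 * ?a \<le> \<delta> * (norm h)\<^sup>2" by (simp add: algebra_simps)
      also have "(norm h)\<^sup>2 < 1" using h by (simp add: power_less_one_iff)
      then have "\<delta> * (norm h)\<^sup>2 < \<delta> * 2"
        using d by (intro mult_strict_left_mono) auto
      finally show "h \<in> aniso_scale \<xi> \<delta> -` aniso_box \<xi> \<delta>"
        using d c by (auto simp: aniso_box_def aniso_scale_props[OF 1 d] norm_mult)
    qed
    then have "ennreal ?c1 \<le> emeasure lborel (aniso_scale \<xi> \<delta> -` aniso_box \<xi> \<delta>)"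
      unfolding emeasure_lborel_ball[symmetric] using emeasure_aniso_box(2)[OF 1 d] by (intro emeasure_mono) auto
    then have "ennreal (\<delta> ^ (CARD('n) + 1)) * ennreal ?c1 \<le> ennreal (\<delta> ^ (CARD('n) + 1)) * emeasure lborel (aniso_scale \<xi> \<delta> -` aniso_box \<xi> \<delta>)"
      by (rule mult_left_mono) simp
    then show ?thesis
      unfolding emeasure_aniso_box[OF 1 d] using d by (simp add: ennreal_mult'[symmetric] mult.commute)
  qed
  moreover have "?c1 > 0" by (simp add: content_ball_pos)
  ultimately show ?thesis by blast
qed

section \<open>Volumes of Carleson regions\<close>

lemma norm_le_kernel:
  assumes "norm w \<le> 1" shows "1 - norm z \<le> cmod (1 - cinner z w)"
proof -
  have "cmod (cinner z w) \<le> norm z"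
    using cmod_cinner_le[of z w] assms by (meson mult_left_le norm_ge_zero order_trans)
  then show ?thesis using norm_triangle_ineq2[of 1 "cinner z w"] by simp
qed

lemma kernel_pos: "norm z < 1 \<Longrightarrow> norm w \<le> 1 \<Longrightarrow> 0 < cmod (1 - cinner z w)"
  using norm_le_kernel[of w z] by linarith

lemma kernel_le_2: "norm z < 1 \<Longrightarrow> norm w \<le> 1 \<Longrightarrow> cmod (1 - cinner z w) < 2"
proof -
  assume "norm z < 1" "norm w \<le> 1"
  have "cmod (cinner z w) \<le> norm z * norm w" by (rule cmod_cinner_le)
  also have "\<dots> \<le> norm z" using \<open>norm w \<le> 1\<close> by (simp add: mult_left_le)
  finally show ?thesis using norm_triangle_ineq4[of 1 "cinner z w"] \<open>norm z < 1\<close> by simp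
qed

lemma kernel_commute: "cmod (1 - cinner z w) = cmod (1 - cinner w z)"
  using complex_mod_cnj[of "1 - cinner w z"] by (simp add: cinner_commute[of z w])

lemma carleson_region_subset_aniso_box:
  assumes "norm \<xi> = 1" "z \<in> carleson_region \<delta> \<xi>"
  shows "z - \<xi> \<in> aniso_box \<xi> \<delta>"
proof -
  have z: "norm z < 1" "cmod (1 - cinner z \<xi>) < \<delta>" using assms(2) by (auto simp: carleson_region_def)
  have "cmod (cinner (z - \<xi>) \<xi>) < \<delta>"
    using z by (simp add: cinner_diff_left cinner_self assms(1) norm_minus_commute)
  moreover have "(norm (z - \<xi>))\<^sup>2 = (norm z)\<^sup>2 + 1 - 2 * Re (cinner z \<xi>)"
  proof -
    have "\<xi> \<bullet> \<xi> = 1" using assms(1) by (simp add: dot_square_norm)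
    then show ?thesis
      unfolding power2_norm_eq_inner cinner_Re
      by (simp add: inner_diff_left inner_diff_right inner_commute)
  qed
  moreover have "(norm z)\<^sup>2 < 1" using z by (simp add: power_less_one_iff)
  moreover have "1 - Re (cinner z \<xi>) < \<delta>"
    using z complex_Re_le_cmod[of "1 - cinner z \<xi>"] by simp
  ultimately show ?thesis by (simp add: aniso_box_def)
qed

lemma carleson_region_measurable[measurable]: "carleson_region \<delta> \<xi> \<in> sets borel"
proof -
  have "unit_ball \<inter> {z \<in> space borel. cmod (1 - cinner z \<xi>) < \<delta>} \<in> sets borel"
    by (intro sets.Int) measurable
  then show ?thesis by (simp add: carleson_region_def Int_def)
qed

lemma carleson_region_volume:
  "\<exists>C>0. \<forall>(\<xi> :: complex ^ 'n::finite) \<delta>. norm \<xi> = 1 \<longrightarrow> \<delta> > 0 \<longrightarrow>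
     emeasure lborel (carleson_region \<delta> \<xi>) \<le> ennreal (C * \<delta> ^ (CARD('n) + 1))"
proof -
  obtain c2 where c2: "c2 > 0" "\<And>\<xi> \<delta>. norm (\<xi> :: complex ^ 'n) = 1 \<Longrightarrow> \<delta> > 0 \<Longrightarrow> emeasure lborel (aniso_box \<xi> \<delta>) \<le> ennreal (c2 * \<delta> ^ (CARD('n) + 1))"
    using aniso_box_volume_le by metis
  have "emeasure lborel (carleson_region \<delta> \<xi>) \<le> ennreal (c2 * \<delta> ^ (CARD('n) + 1))"
    if "norm (\<xi> :: complex ^ 'n) = 1" "\<delta> > 0" for \<xi> \<delta>
  proof -
    have m: "(+) (- \<xi>) -` aniso_box \<xi> \<delta> \<in> sets borel"
      using measurable_sets[of "(+) (- \<xi>)" borel borel "aniso_box \<xi> \<delta>"] by simp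
    have "carleson_region \<delta> \<xi> \<subseteq> (+) (- \<xi>) -` aniso_box \<xi> \<delta>"
      using carleson_region_subset_aniso_box[OF that(1)] by auto
    then have "emeasure lborel (carleson_region \<delta> \<xi>) \<le> emeasure lborel ((+) (- \<xi>) -` aniso_box \<xi> \<delta>)"
      using m by (intro emeasure_mono) auto
    also have "\<dots> = emeasure lborel (aniso_box \<xi> \<delta>)"
      by (rule emeasure_lborel_vimage_translate) simp
    finally show ?thesis using c2(2)[OF that] by (rule order_trans)
  qed
  then show ?thesis using c2(1) by blast
qed

text \<open>The shell is the part of the region within distance about $\delta/(4K)$ from the sphere. A packing
  argument bounds its volume: $K$ suitable dilates of the shell are disjoint, they all lie in the Carleson
  region of radius $2\delta$, and their volumes are comparable to that of the shell.\<close>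

lemma carleson_shell_volume:
  "\<exists>C>0. \<forall>(\<xi> :: complex ^ 'n::finite) \<delta> K. norm \<xi> = 1 \<longrightarrow> 0 < \<delta> \<longrightarrow> \<delta> \<le> 2 \<longrightarrow> K > 0 \<longrightarrow>
     emeasure lborel {z \<in> carleson_region \<delta> \<xi>. 1 - (norm z)\<^sup>2 < \<delta> / (4 * real K)} \<le> ennreal (C * \<delta> ^ (CARD('n) + 1) / real K)"
proof -
  obtain C where C: "C > 0" "\<And>\<xi> \<delta>. norm (\<xi> :: complex ^ 'n) = 1 \<Longrightarrow> \<delta> > 0 \<Longrightarrow>
     emeasure lborel (carleson_region \<delta> \<xi>) \<le> ennreal (C * \<delta> ^ (CARD('n) + 1))"
    using carleson_region_volume by metis
  let ?D = "DIM(complex ^ 'n)"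
  let ?C = "C * 2 ^ (CARD('n) + 1) * 2 ^ ?D"
  have "emeasure lborel {z \<in> carleson_region \<delta> \<xi>. 1 - (norm z)\<^sup>2 < \<delta> / (4 * real K)} \<le> ennreal (?C * \<delta> ^ (CARD('n) + 1) / real K)"
    if "norm (\<xi> :: complex ^ 'n) = 1" and d: "0 < \<delta>" "\<delta> \<le> 2" and K: "K > 0" for \<xi> \<delta> K
  proof -
    define \<eta> where "\<eta> = \<delta> / (4 * real K)"
    define A where "A = {z \<in> carleson_region \<delta> \<xi>. 1 - (norm z)\<^sup>2 < \<eta>}"
    have \<eta>: "\<eta> > 0" "real K * \<eta> = \<delta> / 4" using d K by (auto simp: \<eta>_def)
    have \<eta>1: "\<eta> \<le> 1/2"
    proof -
      have "\<eta> \<le> \<delta> / 4" using K d by (simp add: \<eta>_def field_simps)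
      then show ?thesis using d by simp
    qed
    have [measurable]: "A \<in> sets borel"
    proof -
      have "{z \<in> space borel. z \<in> carleson_region \<delta> \<xi> \<and> 1 - (norm z)\<^sup>2 < \<eta>} \<in> sets borel" by measurable
      then show ?thesis by (simp add: A_def)
    qed
    \<comment> \<open>the norm of a point of A lies between 1 - \<eta> and 1, so the dilates by the factors r i occupy disjoint ranges of norms\<close>
    define r where "r i = 1 - real i * \<eta>" for i :: nat
    have r: "1/2 \<le> r i" "r i \<le> 1" if "i < K" for i
    proof -
      have "real i * \<eta> \<le> real K * \<eta>" using that \<eta> by (intro mult_right_mono) auto
      then show "1/2 \<le> r i" using \<eta> d by (simp add: r_def)
      show "r i \<le> 1" using \<eta> by (simp add: r_def)
    qed
    define B where "B i = (*\<^sub>R) (1 / r i) -` A" for i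
    have Bm: "B i \<in> sets borel" for i
      using measurable_sets[of "(*\<^sub>R) (1 / r i)" borel borel A] by (simp add: B_def)
    have vol: "emeasure lborel A \<le> ennreal (2 ^ ?D) * emeasure lborel (B i)" if "i < K" for i
    proof -
      have "emeasure lborel A = ennreal ((1 / r i) ^ ?D) * emeasure lborel (B i)"
        unfolding B_def using r[OF that] by (subst emeasure_vimage_scaleR) auto
      also have "\<dots> \<le> ennreal (2 ^ ?D) * emeasure lborel (B i)"
        using r[OF that] by (intro mult_right_mono ennreal_leI power_mono) (auto simp: field_simps)
      finally show ?thesis .
    qed
    have BA: "\<exists>y. y \<in> A \<and> z = r i *\<^sub>R y" if "z \<in> B i" "i < K" for z i
      using that r[OF that(2)] by (intro exI[of _ "(1 / r i) *\<^sub>R z"]) (auto simp: B_def)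
    have nA: "1 - \<eta> < norm y" "norm y < 1" if "y \<in> A" for y
    proof -
      show y1: "norm y < 1" using that by (auto simp: A_def carleson_region_def)
      then have "(norm y)\<^sup>2 \<le> norm y" by (simp add: power2_eq_square mult_left_le)
      then show "1 - \<eta> < norm y" using that by (auto simp: A_def)
    qed
    have disj: "B i \<inter> B j = {}" if "i < j" "j < K" for i j
    proof (rule ccontr)
      assume "B i \<inter> B j \<noteq> {}"
      then obtain z where z: "z \<in> B i" "z \<in> B j" by blast
      obtain y where y: "y \<in> A" "z = r i *\<^sub>R y" using BA[OF z(1)] \<open>i < j\<close> \<open>j < K\<close> by auto
      obtain x where x: "x \<in> A" "z = r j *\<^sub>R x" using BA[OF z(2)] \<open>j < K\<close> by blast
      have ri: "1/2 \<le> r i" "1/2 \<le> r j" using r that by auto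
      have "norm z < r j" using x nA[OF x(1)] ri by simp
      moreover have "r i * (1 - \<eta>) < norm z" using y nA[OF y(1)] ri by simp
      moreover have "r j \<le> r i * (1 - \<eta>)"
      proof -
        have "real (i + 1) * \<eta> \<le> real j * \<eta>" using that \<eta> by (intro mult_right_mono) auto
        then have "r j \<le> 1 - real i * \<eta> - \<eta>" by (simp add: r_def algebra_simps)
        moreover have "0 \<le> real i * \<eta> * \<eta>" using \<eta> by simp
        ultimately show ?thesis by (simp add: r_def algebra_simps)
      qed
      ultimately show False by linarith
    qed
    then have "disjoint_family_on B {..<K}"
      unfolding disjoint_family_on_def by (metis inf_commute lessThan_iff linorder_neqE_nat)
    then have "(\<Sum>i<K. emeasure lborel (B i)) = emeasure lborel (\<Union>i<K. B i)"
      using Bm by (intro sum_emeasure) auto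
    also have "\<dots> \<le> emeasure lborel (carleson_region (2 * \<delta>) \<xi>)"
    proof (intro emeasure_mono subsetI)
      fix z assume "z \<in> (\<Union>i<K. B i)"
      then obtain i where i: "i < K" "z \<in> B i" by auto
      obtain y where y: "y \<in> A" "z = r i *\<^sub>R y" using BA[OF i(2,1)] by auto
      have "r i * norm y \<le> norm y" "0 \<le> r i" using r[OF i(1)] by (auto intro: mult_left_le_one_le)
      then have "norm z < 1" using y nA[OF y(1)] by simp
      moreover have "cmod (1 - cinner z \<xi>) < 2 * \<delta>"
      proof -
        have "1 - cinner z \<xi> = (1 - cinner y \<xi>) + of_real (1 - r i) * cinner y \<xi>"
          unfolding y(2) cinner_scaleR_left by (simp add: algebra_simps)
        then have "cmod (1 - cinner z \<xi>) \<le> cmod (1 - cinner y \<xi>) + (1 - r i) * cmod (cinner y \<xi>)"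
          using r[OF i(1)] by (metis (no_types, opaque_lifting) abs_of_nonneg diff_ge_0_iff_ge norm_mult norm_of_real norm_triangle_ineq)
        moreover have "cmod (1 - cinner y \<xi>) < \<delta>" using y by (auto simp: A_def carleson_region_def)
        moreover have "(1 - r i) * cmod (cinner y \<xi>) \<le> (1 - r i) * 1"
          using r[OF i(1)] cmod_cinner_le[of y \<xi>] nA[OF y(1)] \<open>norm \<xi> = 1\<close> by (intro mult_left_mono) auto
        moreover have "1 - r i \<le> \<delta> / 4"
        proof -
          have "real i * \<eta> \<le> real K * \<eta>" using i \<eta> by (intro mult_right_mono) auto
          then show ?thesis using \<eta> by (simp add: r_def)
        qed
        ultimately show ?thesis using d by simp
      qed
      ultimately show "z \<in> carleson_region (2 * \<delta>) \<xi>" by (simp add: carleson_region_def)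
    qed simp
    also have "\<dots> \<le> ennreal (C * (2 * \<delta>) ^ (CARD('n) + 1))"
      using C(2)[OF that(1), of "2 * \<delta>"] d by simp
    finally have sum: "(\<Sum>i<K. emeasure lborel (B i)) \<le> ennreal (C * (2 * \<delta>) ^ (CARD('n) + 1))" .
    have "ennreal (real K) * emeasure lborel A = (\<Sum>i<K. emeasure lborel A)"
      by (simp add: ennreal_of_nat_eq_real_of_nat)
    also have "\<dots> \<le> (\<Sum>i<K. ennreal (2 ^ ?D) * emeasure lborel (B i))"
      using vol by (intro sum_mono) auto
    also have "\<dots> = ennreal (2 ^ ?D) * (\<Sum>i<K. emeasure lborel (B i))"
      by (simp only: sum_distrib_left)
    also have "\<dots> \<le> ennreal (2 ^ ?D) * ennreal (C * (2 * \<delta>) ^ (CARD('n) + 1))"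
      using sum by (rule mult_left_mono) simp
    also have "\<dots> = ennreal (?C * \<delta> ^ (CARD('n) + 1))"
      using C(1) d by (subst ennreal_mult[symmetric]) (simp_all only: power_mult_distrib mult_ac, auto)
    finally have main: "ennreal (real K) * emeasure lborel A \<le> ennreal (?C * \<delta> ^ (CARD('n) + 1))" .
    have "emeasure lborel A = ennreal (1 / real K) * (ennreal (real K) * emeasure lborel A)"
      using K by (simp flip: ennreal_mult' mult.assoc)
    also have "\<dots> \<le> ennreal (1 / real K) * ennreal (?C * \<delta> ^ (CARD('n) + 1))"
      using main by (rule mult_left_mono) simp
    also have "\<dots> = ennreal (?C * \<delta> ^ (CARD('n) + 1) / real K)"
      using C(1) d by (subst ennreal_mult[symmetric]) auto
    finally show ?thesis by (simp only: A_def \<eta>_def)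
  qed
  moreover have "?C > 0" using C(1) by simp
  ultimately show ?thesis by blast
qed

section \<open>Dyadic sums for integrals against the kernel\<close>

lemma dyadic_scale_exists:
  assumes "0 < x" "x < (2::real)"
  obtains k :: nat where "(1/2) ^ k \<le> x" "x < 2 * (1/2) ^ k"
proof -
  have ex: "\<exists>k. (1/2::real) ^ k \<le> x"
    using real_arch_pow_inv[of x "1/2"] assms by (auto intro: less_imp_le)
  define k where "k = (LEAST k. (1/2::real) ^ k \<le> x)"
  have k: "(1/2) ^ k \<le> x" unfolding k_def by (rule LeastI_ex[OF ex])
  show thesis
  proof (cases k)
    case 0
    then show ?thesis using that[of k] k assms by simp
  next
    case (Suc j)
    then have "\<not> (1/2) ^ j \<le> x" using not_less_Least[of j "\<lambda>k. (1/2::real) ^ k \<le> x"] by (simp add: k_def)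
    then show ?thesis using that[of k] k Suc by simp
  qed
qed

text \<open>The bound on $F$ is only needed at the scale to which a point belongs, whereas the sum uses the full
  sublevel sets of $d$; these, unlike the shells, are easy to compare with Carleson regions.\<close>

lemma nn_integral_dyadic_le:
  fixes F :: "'a \<Rightarrow> ennreal" and d :: "'a \<Rightarrow> real"
  assumes d[measurable]: "d \<in> borel_measurable M"
    and d2: "\<And>z. z \<in> space M \<Longrightarrow> 0 < d z \<and> d z < 2"
    and F: "\<And>z k. z \<in> space M \<Longrightarrow> (1/2) ^ k \<le> d z \<Longrightarrow> d z < 2 * (1/2) ^ k \<Longrightarrow> F z \<le> c k"
  shows "(\<integral>\<^sup>+z. F z \<partial>M) \<le> (\<Sum>k. c k * emeasure M {z \<in> space M. d z < 2 * (1/2) ^ k})"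
proof -
  let ?A = "\<lambda>k::nat. {z \<in> space M. d z < 2 * (1/2) ^ k}"
  have [measurable]: "?A k \<in> sets M" for k by measurable
  have "(\<integral>\<^sup>+z. F z \<partial>M) \<le> (\<integral>\<^sup>+z. (\<Sum>k. c k * indicator (?A k) z) \<partial>M)"
  proof (rule nn_integral_mono)
    fix z assume z: "z \<in> space M"
    obtain k where k: "(1/2) ^ k \<le> d z" "d z < 2 * (1/2) ^ k"
      using dyadic_scale_exists[of "d z"] d2[OF z] by blast
    have "F z \<le> (\<Sum>j\<in>{k}. c j * indicator (?A j) z)" using F[OF z k] z k by simp
    also have "\<dots> \<le> (\<Sum>k. c k * indicator (?A k) z)"
      by (rule sum_le_suminf) auto
    finally show "F z \<le> (\<Sum>k. c k * indicator (?A k) z)" .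
  qed
  also have "\<dots> = (\<Sum>k. c k * emeasure M (?A k))"
    by (subst nn_integral_suminf) (auto simp: nn_integral_cmult)
  finally show ?thesis .
qed

lemma dyadic_index_le:
  fixes s :: real
  assumes "(1/2) ^ K \<le> s" "s < 2 * (1/2) ^ k"
  shows "k \<le> K"
proof (rule ccontr)
  assume "\<not> k \<le> K"
  then have "(1/2::real) ^ k \<le> (1/2) ^ Suc K" by (intro power_decreasing) auto
  then show False using assms by simp
qed

lemma finite_dyadic:
  assumes "0 < s" shows "finite {k::nat. s < 2 * (1/2::real) ^ k}"
proof -
  obtain K where "(1/2::real) ^ K \<le> s"
    using real_arch_pow_inv[of s "1/2"] assms by (auto intro: less_imp_le)
  then have "{k::nat. s < 2 * (1/2) ^ k} \<subseteq> {..K}" using dyadic_index_le by auto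
  then show ?thesis using finite_subset by blast
qed

text \<open>The main device of the whole development. Write $d(z) = |1-\langle z,w\rangle|$. Since
  $d \ge 1-|w|$ on the ball, only scales $2^{-k}$ above $(1-|w|)/2$ occur. For these, moving $w$
  radially to the sphere changes $d$ by at most $1-|w| < 2\cdot 2^{-k}$, so the set $d < 2\cdot 2^{-k}$ lies
  in the Carleson region of radius $4\cdot 2^{-k}$ about $w/|w|$. The measure is arbitrary: below it is
  a weighted Lebesgue measure or the measure that is tested for the Carleson property.\<close>

lemma nn_integral_kernel_le:
  fixes M :: "(complex ^ 'n::finite) measure" and F :: "complex ^ 'n \<Rightarrow> ennreal"
  assumes M: "sets M = sets (restrict_space borel unit_ball)" and w: "norm w < 1"
    and a: "\<And>\<xi> k. norm \<xi> = 1 \<Longrightarrow> emeasure M (carleson_region (4 * (1/2) ^ k) \<xi>) \<le> a k"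
    and F: "\<And>z k. norm z < 1 \<Longrightarrow> (1/2) ^ k \<le> cmod (1 - cinner z w) \<Longrightarrow> cmod (1 - cinner z w) < 2 * (1/2) ^ k \<Longrightarrow> F z \<le> c k"
  shows "(\<integral>\<^sup>+z. F z \<partial>M) \<le> (\<Sum>k\<in>{k. 1 - norm w < 2 * (1/2) ^ k}. c k * a k)"
proof -
  have space: "space M = unit_ball" using sets_eq_imp_space_eq[OF M] by (simp add: space_restrict_space)
  obtain \<xi> :: "complex ^ 'n" where \<xi>: "norm \<xi> = 1" "w = norm w *\<^sub>R \<xi>" by (rule unit_direction)
  let ?A = "\<lambda>k::nat. {z \<in> space M. cmod (1 - cinner z w) < 2 * (1/2) ^ k}"
  have meas: "(\<lambda>z. cmod (1 - cinner z w)) \<in> borel_measurable M"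
    unfolding measurable_cong_sets[OF M refl] by (intro measurable_restrict_space1) measurable
  have A: "emeasure M (?A k) \<le> (if 1 - norm w < 2 * (1/2) ^ k then a k else 0)" for k
  proof (cases "1 - norm w < 2 * (1/2) ^ k")
    case False
    have "?A k = {}"
    proof (rule ccontr)
      assume "?A k \<noteq> {}"
      then obtain z where z: "norm z < 1" "cmod (1 - cinner z w) < 2 * (1/2) ^ k" by (auto simp: space)
      have "1 - norm w \<le> cmod (1 - cinner w z)" using z by (intro norm_le_kernel) auto
      then show False using z False kernel_commute[of z w] by linarith
    qed
    then show ?thesis by (simp only: emeasure_empty) simp
  next
    case True
    have "?A k \<subseteq> carleson_region (4 * (1/2) ^ k) \<xi>"
    proof
      fix z assume "z \<in> ?A k"
      then have z: "norm z < 1" "cmod (1 - cinner z w) < 2 * (1/2) ^ k" by (auto simp: space)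
      have "1 - cinner z \<xi> = (1 - cinner z w) - of_real (1 - norm w) * cinner z \<xi>"
      proof -
        have "cinner z w = of_real (norm w) * cinner z \<xi>"
          using \<xi>(2) by (metis cinner_scaleR_right)
        then show ?thesis by (simp add: algebra_simps)
      qed
      moreover have "cmod (of_real (1 - norm w) * cinner z \<xi>) = (1 - norm w) * cmod (cinner z \<xi>)"
        using w by (simp add: norm_mult del: of_real_diff)
      ultimately have "cmod (1 - cinner z \<xi>) \<le> cmod (1 - cinner z w) + (1 - norm w) * cmod (cinner z \<xi>)"
        using norm_triangle_ineq4[of "1 - cinner z w" "of_real (1 - norm w) * cinner z \<xi>"] by (simp only:)
      also have "(1 - norm w) * cmod (cinner z \<xi>) \<le> (1 - norm w) * 1"
        using w z cmod_cinner_le[of z \<xi>] \<xi> by (intro mult_left_mono) auto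
      finally show "z \<in> carleson_region (4 * (1/2) ^ k) \<xi>"
        using z True by (simp add: carleson_region_def)
    qed
    moreover have "carleson_region (4 * (1/2) ^ k) \<xi> \<in> sets M"
      unfolding M by (simp add: sets_restrict_space_iff) (auto simp: carleson_region_def)
    ultimately have "emeasure M (?A k) \<le> emeasure M (carleson_region (4 * (1/2) ^ k) \<xi>)"
      by (rule emeasure_mono)
    also have "\<dots> \<le> a k" by (rule a) (use \<xi> in simp)
    finally show ?thesis using True by simp
  qed
  have "(\<integral>\<^sup>+z. F z \<partial>M) \<le> (\<Sum>k. c k * emeasure M (?A k))"
  proof (rule nn_integral_dyadic_le[OF meas])
    show "0 < cmod (1 - cinner z w) \<and> cmod (1 - cinner z w) < 2" if "z \<in> space M" for z
      using kernel_pos[of z w] kernel_le_2[of z w] that w by (simp add: space)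
    show "F z \<le> c k" if "z \<in> space M" "(1/2) ^ k \<le> cmod (1 - cinner z w)" "cmod (1 - cinner z w) < 2 * (1/2) ^ k" for z k
      using F[of z k] that by (simp add: space)
  qed
  also have "\<dots> \<le> (\<Sum>k. c k * (if 1 - norm w < 2 * (1/2) ^ k then a k else 0))"
    by (intro suminf_le mult_left_mono A) auto
  also have "\<dots> = (\<Sum>k\<in>{k. 1 - norm w < 2 * (1/2) ^ k}. c k * a k)"
    using finite_dyadic[of "1 - norm w"] w by (subst suminf_finite[of "{k. 1 - norm w < 2 * (1/2) ^ k}"]) auto
  finally show ?thesis .
qed

text \<open>A geometric sum is comparable to its largest term, which belongs to the scale $2^{-k}$ close to $s$.\<close>

lemma sum_dyadic_powr:
  assumes "\<beta> > 0"
  shows "\<exists>C>0. \<forall>s. 0 < s \<longrightarrow> s \<le> 1 \<longrightarrow> (\<Sum>k\<in>{k. s < 2 * (1/2) ^ k}. 2 powr (\<beta> * real k)) \<le> C * s powr (- \<beta>)"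
proof -
  define q where "q = 2 powr (- \<beta>)"
  have q: "0 < q" "q < 1" using assms powr_less_mono[of "-\<beta>" 0 2] by (auto simp: q_def)
  have "(\<Sum>k\<in>{k. s < 2 * (1/2) ^ k}. 2 powr (\<beta> * real k)) \<le> (2 powr \<beta> / (1 - q)) * s powr (- \<beta>)"
    if s: "0 < s" "s \<le> 1" for s :: real
  proof -
    obtain K where K: "(1/2) ^ K \<le> s" "s < 2 * (1/2) ^ K" using dyadic_scale_exists[of s] s by auto
    have sub: "{k::nat. s < 2 * (1/2) ^ k} \<subseteq> {..K}"
      using dyadic_index_le[OF K(1)] by auto
    have "(\<Sum>k\<in>{k. s < 2 * (1/2) ^ k}. 2 powr (\<beta> * real k)) \<le> (\<Sum>k\<le>K. 2 powr (\<beta> * real k))"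
      using sub by (intro sum_mono2) auto
    also have "\<dots> = (\<Sum>k\<le>K. 2 powr (\<beta> * real K) * q ^ (K - k))"
    proof (intro sum.cong refl)
      fix k assume "k \<in> {..K}"
      then show "2 powr (\<beta> * real k) = 2 powr (\<beta> * real K) * q ^ (K - k)"
        by (simp add: q_def powr_powr flip: powr_realpow powr_add) (simp add: of_nat_diff algebra_simps)
    qed
    also have "\<dots> = 2 powr (\<beta> * real K) * (\<Sum>k\<le>K. q ^ k)"
      by (subst sum_distrib_left[symmetric], rule arg_cong[where f="(*) _"],
          rule sum.reindex_bij_witness[of _ "\<lambda>k. K - k" "\<lambda>k. K - k"]) auto
    also have "\<dots> \<le> 2 powr (\<beta> * real K) * (1 / (1 - q))"
    proof (intro mult_left_mono)
      show "(\<Sum>k\<le>K. q ^ k) \<le> 1 / (1 - q)"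
      proof -
        have "(1 - q) * (\<Sum>k\<le>K. q ^ k) \<le> 1" using q by (simp only: sum_gp_basic) simp
        then show ?thesis using q by (simp add: field_simps)
      qed
    qed simp
    also have "2 powr (\<beta> * real K) = (2 ^ K) powr \<beta>"
      by (simp add: powr_powr mult.commute flip: powr_realpow)
    also have "(2 ^ K) powr \<beta> * (1 / (1 - q)) \<le> (2 / s) powr \<beta> * (1 / (1 - q))"
      using K s assms q by (intro mult_right_mono powr_mono2) (auto simp: field_simps power_divide)
    also have "(2 / s) powr \<beta> = 2 powr \<beta> * s powr (-\<beta>)"
      using s by (simp add: powr_divide powr_minus_divide)
    finally show ?thesis by (simp add: mult_ac)
  qed
  moreover have "2 powr \<beta> / (1 - q) > 0" using q by simp
  ultimately show ?thesis by blast
qed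

lemma card_dyadic_le:
  assumes "0 < s" "s \<le> 1"
  shows "real (card {k::nat. s < 2 * (1/2) ^ k}) \<le> 1 + log 2 (2 / s)"
proof -
  obtain K where K: "(1/2) ^ K \<le> s" "s < 2 * (1/2) ^ K" using dyadic_scale_exists[of s] assms by auto
  have "{k::nat. s < 2 * (1/2) ^ k} \<subseteq> {..K}"
    using dyadic_index_le[OF K(1)] by auto
  then have "card {k::nat. s < 2 * (1/2) ^ k} \<le> Suc K" using card_mono[of "{..K}"] by auto
  moreover have "real K \<le> log 2 (2 / s)"
    using K assms by (simp add: le_log_iff powr_realpow field_simps power_divide)
  ultimately show ?thesis by linarith
qed

section \<open>Weighted volumes of Carleson regions\<close>

text \<open>The region is cut into the shells on which $1-|z|^2$ is about $2^{-k}\delta$. Such a shell has volume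
  $O(2^{-k}\delta^{n+1})$ by the packing argument, and for $t > -1$ the sum of $2^{-k(1+t)}$ converges.\<close>

lemma carleson_region_weighted_volume:
  assumes t: "t > -1"
  shows "\<exists>C>0. \<forall>(\<xi> :: complex ^ 'n::finite) \<delta>. norm \<xi> = 1 \<longrightarrow> 0 < \<delta> \<longrightarrow>
    (\<integral>\<^sup>+z\<in>carleson_region \<delta> \<xi>. ennreal ((1 - (norm z)\<^sup>2) powr t) \<partial>lborel) \<le> ennreal (C * \<delta> powr (real CARD('n) + 1 + t))"
proof -
  obtain C1 where C1: "C1 > 0" "\<And>\<xi> \<delta>. norm (\<xi> :: complex ^ 'n) = 1 \<Longrightarrow> \<delta> > 0 \<Longrightarrow>
     emeasure lborel (carleson_region \<delta> \<xi>) \<le> ennreal (C1 * \<delta> ^ (CARD('n) + 1))"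
    using carleson_region_volume by metis
  obtain C2 where C2: "C2 > 0" "\<And>\<xi> \<delta> K. norm (\<xi> :: complex ^ 'n) = 1 \<Longrightarrow> 0 < \<delta> \<Longrightarrow> \<delta> \<le> 2 \<Longrightarrow> K > 0 \<Longrightarrow>
     emeasure lborel {z \<in> carleson_region \<delta> \<xi>. 1 - (norm z)\<^sup>2 < \<delta> / (4 * real K)} \<le> ennreal (C2 * \<delta> ^ (CARD('n) + 1) / real K)"
    using carleson_shell_volume by blast
  \<comment> \<open>the factor 8 lets one bound, proportional to (1/2)^k, serve both the shells with k = j + 3 and the three largest scales, where the whole region is used\<close>
  define C3 where "C3 = 8 * (C1 + C2)"
  have C3: "C3 > 0" using C1(1) C2(1) by (simp add: C3_def)
  define q where "q = (1/2) powr (t + 1)"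
  have q: "0 < q" "q < 1" using t powr01_less_one[of "1/2" "t + 1"] by (simp_all add: q_def)
  define C where "C = 2 powr \<bar>t\<bar> * C3 * (1 / (1 - q))"
  have small: "(\<integral>\<^sup>+z\<in>carleson_region \<delta> \<xi>. ennreal ((1 - (norm z)\<^sup>2) powr t) \<partial>lborel) \<le> ennreal (C * \<delta> powr (real CARD('n) + 1 + t))"
    if \<xi>: "norm (\<xi> :: complex ^ 'n) = 1" and d: "0 < \<delta>" "\<delta> \<le> 2" for \<xi> \<delta>
  proof -
    let ?Q = "carleson_region \<delta> \<xi>"
    let ?M = "restrict_space lborel ?Q"
    let ?d = "\<lambda>z :: complex ^ 'n. (1 - (norm z)\<^sup>2) / \<delta>"
    let ?n1 = "CARD('n) + 1"
    have space: "space ?M = ?Q" by (simp add: space_restrict_space)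
    have dQ: "0 < ?d z \<and> ?d z < 2" if "z \<in> ?Q" for z
    proof -
      have z: "norm z < 1" "cmod (1 - cinner z \<xi>) < \<delta>" using that by (auto simp: carleson_region_def)
      have "1 - norm z < \<delta>" using norm_le_kernel[of \<xi> z] \<xi> z by simp
      moreover have "1 - (norm z)\<^sup>2 = (1 - norm z) * (1 + norm z)" by (simp add: power2_eq_square algebra_simps)
      moreover have "(1 - norm z) * (1 + norm z) \<le> (1 - norm z) * 2" using z by (intro mult_left_mono) auto
      moreover have "(norm z)\<^sup>2 < 1" using z by (simp add: power_less_one_iff)
      ultimately show ?thesis using d by (simp add: field_simps)
    qed
    have e: "emeasure ?M {z \<in> space ?M. ?d z < 2 * (1/2) ^ k} \<le> ennreal (C3 * \<delta> ^ ?n1 * (1/2) ^ k)" for k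
    proof -
      have "{z \<in> space ?M. ?d z < 2 * (1/2) ^ k} = {z \<in> ?Q. 1 - (norm z)\<^sup>2 < \<delta> * (2 * (1/2) ^ k)}"
        unfolding space using d by (auto simp: field_simps)
      then have eq: "emeasure ?M {z \<in> space ?M. ?d z < 2 * (1/2) ^ k} = emeasure lborel {z \<in> ?Q. 1 - (norm z)\<^sup>2 < \<delta> * (2 * (1/2) ^ k)}"
        by (simp add: emeasure_restrict_space)
      show ?thesis
      proof (cases "k < 3")
        case True
        have "emeasure lborel {z \<in> ?Q. 1 - (norm z)\<^sup>2 < \<delta> * (2 * (1/2) ^ k)} \<le> emeasure lborel ?Q"
          by (intro emeasure_mono) auto
        also have "\<dots> \<le> ennreal (C1 * \<delta> ^ ?n1)" using C1(2)[OF \<xi> d(1)] .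
        also have "\<dots> \<le> ennreal (C3 * \<delta> ^ ?n1 * (1/2) ^ k)"
        proof (rule ennreal_leI)
          have "(1/2::real) ^ 3 \<le> (1/2) ^ k" using True by (intro power_decreasing) auto
          then have "1 \<le> 8 * (1/2::real) ^ k" by (simp only: power_divide) simp
          then have "(C1 * \<delta> ^ ?n1) * 1 \<le> (C1 * \<delta> ^ ?n1) * (8 * (1/2) ^ k)"
            using C1 d by (intro mult_left_mono) auto
          also have "\<dots> \<le> (C1 * \<delta> ^ ?n1) * (8 * (1/2) ^ k) + (C2 * \<delta> ^ ?n1) * (8 * (1/2) ^ k)"
            using C2 d by simp
          also have "\<dots> = C3 * \<delta> ^ ?n1 * (1/2) ^ k" by (simp add: C3_def algebra_simps)
          finally show "C1 * \<delta> ^ ?n1 \<le> C3 * \<delta> ^ ?n1 * (1/2) ^ k" by simp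
        qed
        finally show ?thesis unfolding eq .
      next
        case False
        define j where "j = k - 3"
        have k: "k = j + 3" using False by (simp add: j_def)
        have "\<delta> * (2 * (1/2) ^ k) = \<delta> / (4 * real (2 ^ j))" by (simp add: k power_add power_divide)
        then have "emeasure lborel {z \<in> ?Q. 1 - (norm z)\<^sup>2 < \<delta> * (2 * (1/2) ^ k)} \<le> ennreal (C2 * \<delta> ^ ?n1 / real (2 ^ j))"
          using C2(2)[OF \<xi> d, of "2 ^ j"] by simp
        also have "\<dots> \<le> ennreal (C3 * \<delta> ^ ?n1 * (1/2) ^ k)"
        proof (rule ennreal_leI)
          have "C2 * \<delta> ^ ?n1 / real (2 ^ j) = C2 * \<delta> ^ ?n1 * (8 * (1/2) ^ k)"
            by (simp add: k power_add power_divide)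
          also have "\<dots> \<le> C2 * \<delta> ^ ?n1 * (8 * (1/2) ^ k) + C1 * \<delta> ^ ?n1 * (8 * (1/2) ^ k)"
            using C1 d by simp
          also have "\<dots> = C3 * \<delta> ^ ?n1 * (1/2) ^ k" by (simp add: C3_def algebra_simps)
          finally show "C2 * \<delta> ^ ?n1 / real (2 ^ j) \<le> C3 * \<delta> ^ ?n1 * (1/2) ^ k" .
        qed
        finally show ?thesis unfolding eq .
      qed
    qed
    have "(\<integral>\<^sup>+z\<in>?Q. ennreal ((1 - (norm z)\<^sup>2) powr t) \<partial>lborel) = (\<integral>\<^sup>+z. ennreal ((1 - (norm z)\<^sup>2) powr t) \<partial>?M)"
      by (simp add: nn_integral_restrict_space)
    also have "\<dots> \<le> (\<Sum>k. ennreal (2 powr \<bar>t\<bar> * \<delta> powr t * ((1/2) ^ k) powr t) * emeasure ?M {z \<in> space ?M. ?d z < 2 * (1/2) ^ k})"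
    proof (rule nn_integral_dyadic_le)
      show "?d \<in> borel_measurable ?M" by (intro measurable_restrict_space1) measurable
      show "0 < ?d z \<and> ?d z < 2" if "z \<in> space ?M" for z using dQ that by (simp add: space)
      fix z k assume z: "z \<in> space ?M" "(1/2) ^ k \<le> ?d z" "?d z < 2 * (1/2) ^ k"
      define x where "x = ?d z / (1/2) ^ k"
      have x: "1 \<le> x" "x \<le> 2" using z by (auto simp: x_def field_simps)
      have "x powr t \<le> 2 powr \<bar>t\<bar>"
      proof (cases "t \<ge> 0")
        case True then show ?thesis using x by (simp add: powr_mono2)
      next
        case False
        then have "x powr t \<le> 1" using x powr_mono2'[of "t" 1 x] by simp
        also have "1 \<le> 2 powr \<bar>t\<bar>" by (simp add: ge_one_powr_ge_zero)
        finally show ?thesis .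
      qed
      moreover have "1 - (norm z)\<^sup>2 = \<delta> * (1/2) ^ k * x" using d by (simp add: x_def)
      then have "(1 - (norm z)\<^sup>2) powr t = \<delta> powr t * ((1/2) ^ k) powr t * x powr t"
        using d x by (simp only: powr_mult mult_nonneg_nonneg less_imp_le zero_le_power zero_le_divide_1_iff zero_le_numeral)
      ultimately have "(1 - (norm z)\<^sup>2) powr t \<le> \<delta> powr t * ((1/2) ^ k) powr t * 2 powr \<bar>t\<bar>"
        by (simp add: mult_left_mono)
      then show "ennreal ((1 - (norm z)\<^sup>2) powr t) \<le> ennreal (2 powr \<bar>t\<bar> * \<delta> powr t * ((1/2) ^ k) powr t)"
        by (intro ennreal_leI) (simp add: mult_ac)
    qed
    also have "\<dots> \<le> (\<Sum>k. ennreal (2 powr \<bar>t\<bar> * \<delta> powr t * ((1/2) ^ k) powr t) * ennreal (C3 * \<delta> ^ ?n1 * (1/2) ^ k))"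
      by (intro suminf_le mult_left_mono e) auto
    also have "\<dots> = (\<Sum>k. ennreal (2 powr \<bar>t\<bar> * C3 * \<delta> powr (real CARD('n) + 1 + t) * q ^ k))"
    proof (intro suminf_cong)
      fix k
      have a: "\<delta> powr (real CARD('n) + 1 + t) = \<delta> powr t * \<delta> ^ ?n1"
      proof -
        have "real CARD('n) + 1 + t = t + real ?n1" by simp
        then show ?thesis by (simp only: powr_add powr_realpow[OF d(1)])
      qed
      have b: "q ^ k = ((1/2) ^ k) powr t * (1/2) ^ k"
      proof -
        have "q ^ k = q powr real k" using q by (simp only: powr_realpow)
        also have "\<dots> = (1/2) powr (real k * t + real k)" by (simp only: q_def powr_powr) (simp add: algebra_simps)
        also have "\<dots> = ((1/2) powr real k) powr t * (1/2) powr real k" by (simp only: powr_add powr_powr)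
        also have "(1/2::real) powr real k = (1/2) ^ k" by (rule powr_realpow) simp
        finally show ?thesis .
      qed
      show "ennreal (2 powr \<bar>t\<bar> * \<delta> powr t * ((1/2) ^ k) powr t) * ennreal (C3 * \<delta> ^ ?n1 * (1/2) ^ k)
         = ennreal (2 powr \<bar>t\<bar> * C3 * \<delta> powr (real CARD('n) + 1 + t) * q ^ k)"
        unfolding a b using d(1) C3 by (subst ennreal_mult[symmetric]) (simp_all only: mult_ac, simp_all)
    qed
    also have "\<dots> = ennreal (\<Sum>k. 2 powr \<bar>t\<bar> * C3 * \<delta> powr (real CARD('n) + 1 + t) * q ^ k)"
      using q C3 by (intro suminf_ennreal2 summable_mult summable_geometric) (simp_all add: mult_nonneg_nonneg)
    also have "(\<Sum>k. 2 powr \<bar>t\<bar> * C3 * \<delta> powr (real CARD('n) + 1 + t) * q ^ k) = C * \<delta> powr (real CARD('n) + 1 + t)"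
      using q by (subst suminf_mult) (auto simp: suminf_geometric C_def summable_geometric)
    finally show ?thesis .
  qed
  have Cpos: "C > 0" using q C3 by (simp add: C_def)
  have "(\<integral>\<^sup>+z\<in>carleson_region \<delta> \<xi>. ennreal ((1 - (norm z)\<^sup>2) powr t) \<partial>lborel) \<le> ennreal (C * \<delta> powr (real CARD('n) + 1 + t))"
    if \<xi>: "norm (\<xi> :: complex ^ 'n) = 1" and d: "0 < \<delta>" for \<xi> \<delta>
  proof (cases "\<delta> \<le> 2")
    case False
    have "carleson_region \<delta> \<xi> = carleson_region 2 \<xi>"
      using kernel_le_2[of _ \<xi>] \<xi> False by (auto simp: carleson_region_def intro: less_trans)
    then have "(\<integral>\<^sup>+z\<in>carleson_region \<delta> \<xi>. ennreal ((1 - (norm z)\<^sup>2) powr t) \<partial>lborel) \<le> ennreal (C * 2 powr (real CARD('n) + 1 + t))"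
      using small[OF \<xi>, of 2] by simp
    also have "\<dots> \<le> ennreal (C * \<delta> powr (real CARD('n) + 1 + t))"
      using False t Cpos by (intro ennreal_leI mult_left_mono powr_mono2) auto
    finally show ?thesis .
  qed (use small \<xi> d in blast)
  then show ?thesis using Cpos by blast
qed

section \<open>Functions holomorphic along complex lines\<close>

text \<open>Continuity together with holomorphy on every complex line. By Osgood's lemma this is the usual
  notion of holomorphy; the form chosen here is the one that the proofs use, and it is visibly stable under
  locally uniform limits.\<close>

definition line_holomorphic :: "(complex ^ 'n::finite \<Rightarrow> complex) \<Rightarrow> bool" where
  "line_holomorphic f \<longleftrightarrow> continuous_on unit_ball f \<and>
     (\<forall>x y. (\<lambda>u. f (x + u *s y)) holomorphic_on {u. x + u *s y \<in> unit_ball})"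

lemma continuous_on_smult[continuous_intros]:
  "continuous_on S f \<Longrightarrow> continuous_on S h \<Longrightarrow> continuous_on S (\<lambda>x. f x *s (h x :: complex ^ 'n::finite))"
  unfolding vector_scalar_mult_def by (intro continuous_intros)

lemma open_line: "open {u. x + u *s (y :: complex ^ 'n::finite) \<in> unit_ball}"
proof -
  have "open ((\<lambda>u. x + u *s y) -` unit_ball)"
    by (intro open_vimage continuous_intros) auto
  then show ?thesis by (simp add: vimage_def)
qed

lemma bounded_linear_smult: "bounded_linear (\<lambda>u. u *s (y :: complex ^ 'n::finite))"
proof (rule bounded_linear_intro[of _ "norm y"])
  show "(u + v) *s y = u *s y + v *s y" for u v by (simp add: vec_eq_iff algebra_simps)
  show "(r *\<^sub>R u) *s y = r *\<^sub>R (u *s y)" for r u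
    by (simp add: vec_eq_iff)
  show "norm (u *s y) \<le> norm u * norm y" for u by (simp add: norm_vector_smult)
qed

lemma holomorphic_ball_imp_line:
  assumes "f \<in> holomorphic_ball"
  shows "line_holomorphic f"
  unfolding line_holomorphic_def
proof (intro conjI allI)
  show "continuous_on unit_ball f"
  proof (intro continuous_at_imp_continuous_on ballI)
    fix z :: "complex ^ 'a" assume "z \<in> unit_ball"
    then obtain D where "(f has_derivative D) (at z)"
      using assms unfolding holomorphic_ball_def by fast
    then show "continuous (at z) f" by (rule has_derivative_continuous)
  qed
  fix x y :: "complex ^ 'a"
  have deriv: "\<exists>d. ((\<lambda>u. f (x + u *s y)) has_field_derivative d) (at u)" if "x + u *s y \<in> unit_ball" for u
  proof -
    have "\<exists>D. (f has_derivative D) (at (x + u *s y)) \<and> (\<forall>c v. D (c *s v) = c * D v)"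
      using assms that by (simp add: holomorphic_ball_def)
    then obtain D where D: "(f has_derivative D) (at (x + u *s y))" and D2: "\<forall>c v. D (c *s v) = c * D v"
      by (elim exE conjE)
    have "((\<lambda>u. x + u *s y) has_derivative (\<lambda>h. h *s y)) (at u)"
      using has_derivative_add[OF has_derivative_const[of x] bounded_linear_imp_has_derivative[OF bounded_linear_smult[of y]], of "at u"] by simp
    then have "((\<lambda>u. f (x + u *s y)) has_derivative (\<lambda>h. D (h *s y))) (at u)"
      using D by (rule has_derivative_compose)
    then have "((\<lambda>u. f (x + u *s y)) has_field_derivative D y) (at u)"
      unfolding has_field_derivative_def using D2 by (simp add: mult_commute_abs)
    then show ?thesis by blast
  qed
  show "(\<lambda>u. f (x + u *s y)) holomorphic_on {u. x + u *s y \<in> unit_ball}"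
    unfolding holomorphic_on_def
  proof
    fix u assume "u \<in> {u. x + u *s y \<in> unit_ball}"
    then have "x + u *s y \<in> unit_ball" by (rule CollectD)
    from deriv[OF this] obtain d where "((\<lambda>u. f (x + u *s y)) has_field_derivative d) (at u)"
      by (elim exE)
    then have "((\<lambda>u. f (x + u *s y)) has_field_derivative d) (at u within {u. x + u *s y \<in> unit_ball})"
      by (rule has_field_derivative_at_within)
    then show "(\<lambda>u. f (x + u *s y)) field_differentiable at u within {u. x + u *s y \<in> unit_ball}"
      unfolding field_differentiable_def by (rule exI)
  qed
qed

lemma line_holomorphicD:
  assumes "line_holomorphic f" "\<And>u. u \<in> S \<Longrightarrow> x + u *s y \<in> unit_ball"
  shows "(\<lambda>u. f (x + u *s y)) holomorphic_on S"
  using assms unfolding line_holomorphic_def by (meson holomorphic_on_subset mem_Collect_eq subsetI)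

lemma line_holomorphic_slice:
  assumes "line_holomorphic f" "\<And>u. u \<in> S \<Longrightarrow> cmod u * norm z < 1"
  shows "(\<lambda>u. f (u *s z)) holomorphic_on S"
  using line_holomorphicD[OF assms(1), of S 0 z] assms(2) by (simp add: norm_vector_smult)

text \<open>The part of degree $k$ in the homogeneous expansion, defined as the $k$-th Taylor coefficient of $f$ along the
  complex line through the origin and $z$; it is defined for every $z$, not only in the ball.\<close>

definition hom_part :: "(complex ^ 'n::finite \<Rightarrow> complex) \<Rightarrow> nat \<Rightarrow> complex ^ 'n \<Rightarrow> complex" where
  "hom_part f k z = (deriv ^^ k) (\<lambda>u. f (u *s z)) 0 / fact k"

lemma hom_part_sums:
  assumes f: "line_holomorphic f" and u: "cmod u * norm z < 1"
  shows "(\<lambda>k. hom_part f k z * u ^ k) sums f (u *s z)"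
proof -
  obtain r where r: "cmod u < r" "r * norm z \<le> 1"
  proof (cases "z = 0")
    case True
    then show ?thesis using that[of "cmod u + 1"] by simp
  next
    case False
    then show ?thesis using that[of "1 / norm z"] u by (simp add: field_simps)
  qed
  have "(\<lambda>u. f (u *s z)) holomorphic_on ball 0 r"
  proof (rule line_holomorphic_slice[OF f])
    fix v :: complex assume "v \<in> ball 0 r"
    then have v: "cmod v < r" by simp
    show "cmod v * norm z < 1"
    proof (cases "z = 0")
      case False
      then have "cmod v * norm z < r * norm z" using v by simp
      then show ?thesis using r by simp
    qed simp
  qed
  then have "(\<lambda>n. (deriv ^^ n) (\<lambda>u. f (u *s z)) 0 / fact n * (u - 0) ^ n) sums f (u *s z)"
    by (rule holomorphic_power_series) (use r in simp)
  then show ?thesis by (simp add: hom_part_def)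
qed

lemma hom_part_smult:
  assumes f: "line_holomorphic f"
  shows "hom_part f k (c *s z) = c ^ k * hom_part f k z"
proof -
  let ?T = "{u. 0 + u *s z \<in> unit_ball}" and ?S = "{u. 0 + u *s (c *s z) \<in> unit_ball}"
  have "(deriv ^^ k) (\<lambda>u. (\<lambda>v. f (v *s z)) (c * u)) 0 = c ^ k * (deriv ^^ k) (\<lambda>v. f (v *s z)) (c * 0)"
  proof (rule higher_deriv_compose_linear[where S = ?S and T = ?T])
    show "(\<lambda>v. f (v *s z)) holomorphic_on ?T"
      using line_holomorphicD[OF f, of ?T 0 z] by simp
    show "open ?S" "open ?T" by (rule open_line)+
  qed (auto simp: vector_smult_assoc mult.commute)
  then show ?thesis by (simp add: hom_part_def vector_smult_assoc mult.commute)
qed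

lemma hom_part_0_left: "hom_part f 0 z = f 0"
  by (simp add: hom_part_def)

text \<open>Cauchy's inequality on the circle of radius $r/|z|$ in the line through $z$.\<close>

lemma hom_part_bound:
  assumes f: "line_holomorphic f" and r: "0 < r" "r < 1" and M: "\<And>w. norm w \<le> r \<Longrightarrow> cmod (f w) \<le> M"
  shows "cmod (hom_part f k z) \<le> M * (norm z / r) ^ k"
proof (cases "z = 0")
  case True
  show ?thesis
  proof (cases k)
    case 0 then show ?thesis using M[of 0] r by (simp add: hom_part_0_left)
  next
    case (Suc j)
    have "hom_part f k z = 0" using hom_part_smult[OF f, of k 0 z] True Suc by simp
    then show ?thesis using True Suc by simp
  qed
next
  case False
  define s where "s = r / norm z"
  have s: "s > 0" "s * norm z = r" using r False by (auto simp: s_def)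
  have cl: "cmod u * norm z \<le> r" if "cmod u \<le> s" for u
    using that s by (metis mult_right_mono norm_ge_zero)
  have h: "(\<lambda>u. f (u *s z)) holomorphic_on cball 0 s"
    by (rule line_holomorphic_slice[OF f]) (use cl r in fastforce)
  have "cmod ((deriv ^^ k) (\<lambda>u. f (u *s z)) 0) \<le> fact k * M / s ^ k"
  proof (rule Cauchy_inequality)
    show "(\<lambda>u. f (u *s z)) holomorphic_on ball 0 s" using h by (rule holomorphic_on_subset) auto
    show "continuous_on (cball 0 s) (\<lambda>u. f (u *s z))" using h by (rule holomorphic_on_imp_continuous_on)
    show "cmod (f (u *s z)) \<le> M" if "cmod (0 - u) = s" for u
      using cl[of u] that by (intro M) (simp add: norm_vector_smult)
  qed (use s in simp)
  then have "cmod (hom_part f k z) \<le> M / s ^ k"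
    by (simp add: hom_part_def norm_divide field_simps)
  also have "\<dots> = M * (norm z / r) ^ k" by (simp add: s_def power_divide)
  finally show ?thesis .
qed

lemma line_holomorphic_bounded:
  assumes "line_holomorphic f" "r < 1"
  obtains M where "M \<ge> 0" "\<And>w. norm w \<le> r \<Longrightarrow> cmod (f w) \<le> M"
proof -
  have "continuous_on (cball 0 r) f"
    using assms unfolding line_holomorphic_def by (auto intro: continuous_on_subset)
  then have "bounded (f ` cball 0 r)"
    using compact_continuous_image compact_cball compact_imp_bounded by blast
  then obtain M where "M > 0" "\<And>w. w \<in> cball 0 r \<Longrightarrow> cmod (f w) \<le> M"
    unfolding bounded_pos by auto
  then show ?thesis using that[of M] by auto
qed

lemma hom_part_remainder:
  assumes f: "line_holomorphic f" and M: "\<And>w. norm w \<le> 1/2 \<Longrightarrow> cmod (f w) \<le> M"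
    and q: "2 * norm z * cmod u \<le> q" "q \<le> 1/2"
  shows "cmod (f (u *s z) - (\<Sum>j<K. hom_part f j z * u ^ j)) \<le> 2 * M * q ^ K"
proof -
  have M0: "M \<ge> 0" using norm_ge_zero[of "f 0"] M[of 0] by (simp del: norm_ge_zero)
  have q0: "0 \<le> q" by (rule order_trans[OF _ q(1)]) simp
  have s: "(\<lambda>k. hom_part f k z * u ^ k) sums f (u *s z)"
    by (rule hom_part_sums[OF f]) (use q in \<open>simp add: mult.commute\<close>)
  have s1: "(\<lambda>k. hom_part f (k + K) z * u ^ (k + K)) sums (f (u *s z) - (\<Sum>j<K. hom_part f j z * u ^ j))"
    using sums_split_initial_segment[OF s] .
  have b: "cmod (hom_part f (k + K) z * u ^ (k + K)) \<le> M * q ^ K * (1/2) ^ k" for k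
  proof -
    have "cmod (hom_part f (k + K) z) \<le> M * (norm z / (1/2)) ^ (k + K)"
      by (rule hom_part_bound[OF f]) (use M in auto)
    then have "cmod (hom_part f (k + K) z * u ^ (k + K)) \<le> M * (norm z / (1/2)) ^ (k + K) * cmod u ^ (k + K)"
      by (simp add: norm_mult norm_power mult_right_mono)
    also have "\<dots> = M * (2 * norm z * cmod u) ^ (k + K)" by (simp add: power_mult_distrib mult_ac)
    also have "\<dots> \<le> M * q ^ (k + K)" using q M0 by (intro mult_left_mono power_mono) auto
    also have "\<dots> = M * q ^ K * q ^ k" by (simp add: power_add mult_ac)
    also have "\<dots> \<le> M * q ^ K * (1/2) ^ k" using q q0 M0 by (intro mult_left_mono power_mono) auto
    finally show ?thesis .
  qed
  have s2: "(\<lambda>k. M * q ^ K * (1/2) ^ k) sums (M * q ^ K * 2)"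
    using geometric_sums[of "1/2::real"] by (intro sums_mult) simp
  have "cmod (f (u *s z) - (\<Sum>j<K. hom_part f j z * u ^ j)) \<le> M * q ^ K * 2"
    unfolding sums_unique[OF s1] sums_unique[OF s2]
    by (rule norm_suminf_le[OF b sums_summable[OF s2]])
  then show ?thesis by (simp add: mult_ac)
qed

text \<open>By induction on $k$: the function $f_k(z)$ is the limit of the Taylor remainders
  $t^{-k}(f(tz) - \sum_{j<k} t^j f_j(z))$ as $t \to 0$, uniformly for $z$ in bounded sets, and the
  remainders are holomorphic along lines by the induction hypothesis.\<close>

lemma hom_part_line_holomorphic:
  assumes f: "line_holomorphic (f :: complex ^ 'n::finite \<Rightarrow> complex)"
  shows "(\<lambda>u. hom_part f k (x + u *s y)) holomorphic_on UNIV"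
proof (induction k arbitrary: x y rule: less_induct)
  case (less k)
  obtain M where M: "M \<ge> 0" "\<And>w. norm w \<le> 1/2 \<Longrightarrow> cmod (f w) \<le> M"
    using line_holomorphic_bounded[OF f, of "1/2"] by auto
  have "(\<lambda>u. hom_part f k (x + u *s y)) holomorphic_on ball 0 R" if "R > 0" for R
  proof -
    define Z where "Z = norm x + R * norm y + 1"
    have Z: "Z > 0" using that by (simp add: Z_def add_nonneg_pos)
    have zZ: "norm (x + u *s y) \<le> Z" if "u \<in> ball 0 R" for u
    proof -
      have "norm (x + u *s y) \<le> norm x + cmod u * norm y" by (metis norm_triangle_ineq norm_vector_smult)
      also have "cmod u * norm y \<le> R * norm y" using that by (intro mult_right_mono) auto
      finally show ?thesis by (simp add: Z_def)
    qed
    \<comment> \<open>small enough that the scaled points stay in the ball of radius 1/2, where f is bounded by M\<close>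
    define t where "t N = 1 / (4 * Z * real (Suc N))" for N
    have t: "0 < t N" "2 * Z * t N \<le> 1/2" for N
    proof -
      show "0 < t N" using Z by (simp add: t_def)
      have "2 * Z * (1 / (4 * Z * S)) = 1 / (2 * S)" if "S > 0" for S :: real
        using Z that by (simp add: field_simps)
      then have "2 * Z * t N = 1 / (2 * real (Suc N))" unfolding t_def by simp
      also have "\<dots> \<le> 1 / 2" by (rule divide_left_mono) simp_all
      finally show "2 * Z * t N \<le> 1/2" .
    qed
    have tlim: "t \<longlonglongrightarrow> 0"
    proof -
      have "(\<lambda>N. 1 / (4 * Z) * inverse (real (Suc N))) \<longlonglongrightarrow> 1 / (4 * Z) * 0"
        by (intro tendsto_intros LIMSEQ_inverse_real_of_nat)
      moreover have "t = (\<lambda>N. 1 / (4 * Z) * inverse (real (Suc N)))"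
        by (rule ext) (simp only: t_def divide_inverse inverse_mult_distrib mult_1_left)
      ultimately show ?thesis by simp
    qed
    define G where "G N u = (f (of_real (t N) *s (x + u *s y)) - (\<Sum>j<k. hom_part f j (x + u *s y) * of_real (t N) ^ j)) / of_real (t N) ^ k" for N u
    have bd: "cmod (G N u - hom_part f k (x + u *s y)) \<le> 2 * M * (2 * Z) ^ Suc k * t N" if u: "u \<in> ball 0 R" for N u
    proof -
      let ?z = "x + u *s y" and ?t = "complex_of_real (t N)"
      have q: "2 * norm ?z * cmod ?t \<le> 2 * Z * t N"
        using zZ[OF u] t[of N] by (simp add: mult_right_mono)
      have "G N u - hom_part f k ?z = (f (?t *s ?z) - (\<Sum>j<Suc k. hom_part f j ?z * ?t ^ j)) / ?t ^ k"
        using t(1)[of N] by (simp add: G_def field_simps)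
      then have "cmod (G N u - hom_part f k ?z) = cmod (f (?t *s ?z) - (\<Sum>j<Suc k. hom_part f j ?z * ?t ^ j)) / t N ^ k"
        using t(1)[of N] by (simp add: norm_divide norm_power del: sum.lessThan_Suc)
      also have "\<dots> \<le> 2 * M * (2 * Z * t N) ^ Suc k / t N ^ k"
        using hom_part_remainder[OF f M(2) q t(2), of "Suc k"] t(1)[of N] by (intro divide_right_mono) auto
      also have "\<dots> = 2 * M * (2 * Z) ^ Suc k * t N"
        using t(1)[of N] by (simp add: power_mult_distrib)
      finally show ?thesis .
    qed
    show ?thesis
    proof (rule holomorphic_uniform_sequence[of "ball 0 R" G])
      show "open (ball (0::complex) R)" by simp
      show "G N holomorphic_on ball 0 R" for N
      proof -
        have eq: "of_real (t N) *s x + u *s (of_real (t N) *s y) = of_real (t N) *s (x + u *s y)" for u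
          by (simp add: vec_eq_iff algebra_simps)
        have "(\<lambda>u. f (of_real (t N) *s x + u *s (of_real (t N) *s y))) holomorphic_on ball 0 R"
        proof (rule line_holomorphicD[OF f])
          fix u :: complex assume u: "u \<in> ball 0 R"
          have "norm (of_real (t N) *s (x + u *s y)) \<le> t N * Z"
            using zZ[OF u] t(1)[of N] by (simp only: norm_vector_smult norm_of_real) simp
          also have "t N * Z = (2 * Z * t N) / 2" by simp
          also have "\<dots> < 1" using t(2)[of N] by linarith
          finally have "norm (of_real (t N) *s (x + u *s y)) < 1" .
          then show "of_real (t N) *s x + u *s (of_real (t N) *s y) \<in> unit_ball"
            unfolding eq by (simp only: mem_ball_0)
        qed
        then have "(\<lambda>u. f (of_real (t N) *s (x + u *s y))) holomorphic_on ball 0 R"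
          unfolding eq .
        moreover have "(\<lambda>u. hom_part f j (x + u *s y)) holomorphic_on ball 0 R" if "j < k" for j
          by (rule holomorphic_on_subset[OF less.IH[OF that]]) simp
        ultimately show ?thesis
          unfolding G_def using t(1)[of N]
          by (intro holomorphic_on_divide holomorphic_on_diff holomorphic_on_sum holomorphic_on_mult holomorphic_on_const) simp_all
      qed
      fix u0 :: complex assume "u0 \<in> ball 0 R"
      then obtain d where d: "d > 0" "cball u0 d \<subseteq> ball 0 R" using open_contains_cball[of "ball 0 R"] by blast
      have "uniform_limit (cball u0 d) G (\<lambda>u. hom_part f k (x + u *s y)) sequentially"
        unfolding uniform_limit_iff
      proof (intro allI impI)
        fix e :: real assume e: "e > 0"
        have "(\<lambda>N. 2 * M * (2 * Z) ^ Suc k * t N) \<longlonglongrightarrow> 2 * M * (2 * Z) ^ Suc k * 0"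
          by (intro tendsto_intros tlim)
        then have "\<forall>\<^sub>F N in sequentially. 2 * M * (2 * Z) ^ Suc k * t N < e"
          using e by (intro order_tendstoD(2)[where y = "2 * M * (2 * Z) ^ Suc k * 0"]) auto
        then show "\<forall>\<^sub>F N in sequentially. \<forall>u\<in>cball u0 d. dist (G N u) (hom_part f k (x + u *s y)) < e"
        proof eventually_elim
          case (elim N)
          show ?case
          proof
            fix u assume "u \<in> cball u0 d"
            then have "u \<in> ball 0 R" using d by blast
            from le_less_trans[OF bd[OF this] elim]
            show "dist (G N u) (hom_part f k (x + u *s y)) < e" by (simp only: dist_norm)
          qed
        qed
      qed
      then show "\<exists>d>0. cball u0 d \<subseteq> ball 0 R \<and> uniform_limit (cball u0 d) G (\<lambda>u. hom_part f k (x + u *s y)) sequentially"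
        using d by blast
    qed
  qed
  then have ball: "(\<lambda>u. hom_part f k (x + u *s y)) holomorphic_on ball 0 R" if "R > 0" for R
    using that by blast
  have "(\<lambda>u. hom_part f k (x + u *s y)) field_differentiable at u" for u
  proof (rule holomorphic_on_imp_differentiable_at)
    show "(\<lambda>u. hom_part f k (x + u *s y)) holomorphic_on ball 0 (cmod u + 1)"
      by (rule ball) (simp add: add_nonneg_pos)
  qed simp_all
  then show ?case by (simp add: holomorphic_on_def)
qed

text \<open>An entire function of growth $O(|u|^k)$ is a polynomial of degree at most $k$.\<close>

lemma hom_part_polynomial_on_line:
  assumes f: "line_holomorphic (f :: complex ^ 'n::finite \<Rightarrow> complex)"
  shows "\<exists>c. \<forall>u. hom_part f k (x + u *s y) = (\<Sum>j\<le>k. c j * u ^ j)"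
proof -
  obtain M where M: "M \<ge> 0" "\<And>w. norm w \<le> 1/2 \<Longrightarrow> cmod (f w) \<le> M"
    using line_holomorphic_bounded[OF f, of "1/2"] by auto
  have "cmod (hom_part f k (x + u *s y)) \<le> (M * (2 * (norm x + norm y)) ^ k) * cmod u ^ k" if "1 \<le> cmod u" for u
  proof -
    have "cmod (hom_part f k (x + u *s y)) \<le> M * (norm (x + u *s y) / (1/2)) ^ k"
      by (rule hom_part_bound[OF f]) (use M in auto)
    also have "\<dots> \<le> M * ((cmod u * norm x + cmod u * norm y) / (1/2)) ^ k"
    proof (intro mult_left_mono power_mono divide_right_mono M(1))
      have "norm (x + u *s y) \<le> norm x + cmod u * norm y" using norm_triangle_ineq[of x "u *s y"] by (simp only: norm_vector_smult)
      also have "\<dots> \<le> cmod u * norm x + cmod u * norm y" using mult_right_mono[OF that norm_ge_zero[of x]] by simp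
      finally show "norm (x + u *s y) \<le> cmod u * norm x + cmod u * norm y" .
    qed simp_all
    also have "\<dots> = (M * (2 * (norm x + norm y)) ^ k) * cmod u ^ k"
      by (simp flip: distrib_left power_mult_distrib add: mult_ac)
    finally show ?thesis .
  qed
  then have "hom_part f k (x + u *s y) = (\<Sum>j\<le>k. (deriv ^^ j) (\<lambda>u. hom_part f k (x + u *s y)) 0 / fact j * u ^ j)" for u
    by (rule Liouville_polynomial[OF hom_part_line_holomorphic[OF f], of 1])
  then show ?thesis by (intro exI allI)
qed

section \<open>Homogeneous polynomials\<close>

text \<open>Polynomial functions, generated by monomials. They are a stepping stone between the qualitative
  statement that a function is polynomial in each variable and the explicit sums of homogeneous
  polynomials.\<close>

inductive mpoly :: "(complex ^ 'n::finite \<Rightarrow> complex) \<Rightarrow> bool" where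
  monomial: "mpoly (\<lambda>z. c * (\<Prod>i\<in>UNIV. (z $ i) ^ \<beta> i))"
| add: "mpoly f \<Longrightarrow> mpoly g \<Longrightarrow> mpoly (\<lambda>z. f z + g z)"

lemma mpoly_const: "mpoly (\<lambda>z :: complex ^ 'n::finite. c)"
  using mpoly.monomial[of c "\<lambda>_. 0"] by simp

lemma mpoly_scale: "mpoly (f :: complex ^ 'n::finite \<Rightarrow> complex) \<Longrightarrow> mpoly (\<lambda>z. a * f z)"
proof (induction rule: mpoly.induct)
  case (monomial c \<beta>)
  then show ?case using mpoly.monomial[of "a * c" \<beta>] by (simp add: mult.assoc)
next
  case (add f g)
  then show ?case using mpoly.add[OF add.IH] by (simp add: distrib_left)
qed

lemma mpoly_times_coord: "mpoly (f :: complex ^ 'n::finite \<Rightarrow> complex) \<Longrightarrow> mpoly (\<lambda>z. f z * z $ i)"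
proof (induction rule: mpoly.induct)
  case (monomial c \<beta>)
  have eq: "c * (\<Prod>j\<in>UNIV. (z $ j) ^ \<beta> j) * z $ i = c * (\<Prod>j\<in>UNIV. (z $ j) ^ (\<beta>(i := Suc (\<beta> i))) j)" for z :: "complex ^ 'n"
  proof -
    have "(\<Prod>j\<in>UNIV. (z $ j) ^ (\<beta>(i := Suc (\<beta> i))) j) = (\<Prod>j\<in>UNIV. (z $ j) ^ \<beta> j * (if j = i then z $ i else 1))"
      by (intro prod.cong refl) (auto simp: mult.commute)
    also have "\<dots> = (\<Prod>j\<in>UNIV. (z $ j) ^ \<beta> j) * z $ i"
      by (simp add: prod.distrib)
    finally show ?thesis by simp
  qed
  show ?case unfolding eq by (rule mpoly.monomial)
next
  case (add f g)
  then show ?case using mpoly.add[OF add.IH] by (simp add: distrib_right)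
qed

lemma mpoly_times_coord_power: "mpoly f \<Longrightarrow> mpoly (\<lambda>z. f z * (z $ i) ^ b)"
proof (induction b)
  case (Suc b)
  then show ?case using mpoly_times_coord[of "\<lambda>z. f z * (z $ i) ^ b" i] by (simp add: mult_ac)
qed simp

lemma mpoly_sum: "finite A \<Longrightarrow> (\<And>a. a \<in> A \<Longrightarrow> mpoly (f a)) \<Longrightarrow> mpoly (\<lambda>z. \<Sum>a\<in>A. f a z)"
proof (induction A rule: finite_induct)
  case empty
  show ?case by (simp add: mpoly_const)
next
  case (insert x A)
  have "mpoly (\<lambda>z. f x z + (\<Sum>a\<in>A. f a z))"
    by (rule mpoly.add) (use insert in simp_all)
  then show ?case using insert.hyps by simp
qed

lemma mpoly_continuous: "mpoly f \<Longrightarrow> continuous_on S f"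
  by (induction rule: mpoly.induct) (intro continuous_intros)+

text \<open>A polynomial of degree at most $k$ is determined by its values at $0,\dots,k$, through coefficients
  $a$ that do not depend on the polynomial. It is this uniformity that makes the coefficients of a
  separately polynomial function again separately polynomial.\<close>

lemma lagrange_interpolation:
  "\<exists>a. \<forall>c u. (\<Sum>j\<le>k. c j * u ^ j) = (\<Sum>l\<le>k. (\<Sum>j\<le>k. c j * of_nat l ^ j) * (\<Sum>b\<le>k. a l b * (u::complex) ^ b))"
proof -
  define L :: "nat \<Rightarrow> complex poly" where "L l = (\<Prod>j\<in>{..k}-{l}. smult (1 / (of_nat l - of_nat j)) [:- of_nat j, 1:])" for l
  have L_eval: "poly (L l) (of_nat i) = (if i = l then 1 else 0)" if "l \<le> k" "i \<le> k" for l i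
  proof (cases "i = l")
    case True
    have "poly (L l) (of_nat l) = (\<Prod>j\<in>{..k}-{l}. 1)"
      unfolding L_def poly_prod
    proof (intro prod.cong refl)
      fix j assume "j \<in> {..k} - {l}"
      then have "of_nat l - of_nat j \<noteq> (0 :: complex)" by simp
      moreover have "poly (smult (1 / d) [:- of_nat j, 1:]) (of_nat l) = (1 / d) * (of_nat l - of_nat j)" for d :: complex
        by (simp add: diff_divide_distrib)
      ultimately show "poly (smult (1 / (of_nat l - of_nat j)) [:- of_nat j, 1:]) (of_nat l) = (1 :: complex)" by (simp only:) simp
    qed
    then show ?thesis using True by simp
  next
    case False
    then show ?thesis using that unfolding L_def poly_prod by auto
  qed
  have L_deg: "degree (L l) \<le> k" if "l \<le> k" for l
  proof -
    have "degree (L l) \<le> (\<Sum>j\<in>{..k}-{l}. degree (smult (1 / (of_nat l - of_nat j)) [:- of_nat j, 1:: complex:]))"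
      unfolding L_def by (rule degree_prod_sum_le[unfolded o_def]) simp
    also have "\<dots> \<le> (\<Sum>j\<in>{..k}-{l}. 1)"
      by (intro sum_mono order_trans[OF degree_smult_le]) simp
    also have "\<dots> = k" using that by simp
    finally show ?thesis .
  qed
  have poly_coeffs: "poly p u = (\<Sum>b\<le>k. coeff p b * u ^ b)" if "degree p \<le> k" for p and u :: complex
  proof -
    have "poly p u = (\<Sum>b\<le>degree p. coeff p b * u ^ b)" by (rule poly_altdef)
    also have "\<dots> = (\<Sum>b\<le>k. coeff p b * u ^ b)"
      using that by (intro sum.mono_neutral_left) (auto simp: coeff_eq_0)
    finally show ?thesis .
  qed
  show ?thesis
  proof (intro exI[of _ "\<lambda>l b. coeff (L l) b"] allI)
    fix c :: "nat \<Rightarrow> complex" and u :: complex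
    define p where "p = (\<Sum>j\<le>k. monom (c j) j)"
    have p_eval: "poly p v = (\<Sum>j\<le>k. c j * v ^ j)" for v
      by (simp add: p_def poly_sum poly_monom)
    have p_deg: "degree p \<le> k"
      unfolding p_def by (intro degree_sum_le) (auto intro: order_trans[OF degree_monom_le])
    define q where "q = p - (\<Sum>l\<le>k. smult (poly p (of_nat l)) (L l))"
    have q_deg: "degree q \<le> k"
      unfolding q_def using p_deg L_deg by (intro degree_diff_le degree_sum_le) (auto intro: order_trans[OF degree_smult_le])
    have "q = 0"
    proof (rule ccontr)
      assume q0: "q \<noteq> 0"
      have "poly q (of_nat i) = 0" if "i \<le> k" for i
        using that by (simp add: q_def poly_sum L_eval if_distrib sum.delta cong: if_cong)
      then have sub: "of_nat ` {..k} \<subseteq> {x. poly q x = 0}" by auto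
      have "card (of_nat ` {..k} :: complex set) = Suc k"
        by (subst card_image) (auto simp: inj_on_def)
      moreover have "card (of_nat ` {..k} :: complex set) \<le> card {x. poly q x = 0}"
        using sub poly_roots_finite[OF q0] by (rule card_mono[rotated])
      moreover have "card {x. poly q x = 0} \<le> degree q" using q0 by (rule card_poly_roots_bound)
      ultimately show False using q_deg by linarith
    qed
    then have "poly q u = 0" by simp
    then have "poly p u = (\<Sum>l\<le>k. poly p (of_nat l) * poly (L l) u)"
      by (simp add: q_def poly_sum)
    also have "\<dots> = (\<Sum>l\<le>k. (\<Sum>j\<le>k. c j * of_nat l ^ j) * (\<Sum>b\<le>k. coeff (L l) b * u ^ b))"
      using L_deg by (intro sum.cong refl) (simp add: p_eval poly_coeffs)
    finally show "(\<Sum>j\<le>k. c j * u ^ j) = (\<Sum>l\<le>k. (\<Sum>j\<le>k. c j * of_nat l ^ j) * (\<Sum>b\<le>k. coeff (L l) b * u ^ b))"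
      by (simp only: p_eval)
  qed
qed

definition coord_update :: "complex ^ 'n::finite \<Rightarrow> 'n \<Rightarrow> complex \<Rightarrow> complex ^ 'n" where
  "coord_update z i u = (\<chi> j. if j = i then u else z $ j)"

text \<open>Induction over the set of variables on which $P$ depends: interpolation in one variable expresses $P$
  through the functions $P(\dots,l,\dots)$ with that variable fixed at $l = 0,\dots,k$, which depend on one
  variable less.\<close>

lemma separately_polynomial_imp_mpoly:
  fixes P :: "complex ^ 'n::finite \<Rightarrow> complex"
  assumes "finite S"
    and "\<And>z i. \<exists>c. \<forall>u. P (coord_update z i u) = (\<Sum>j\<le>k. c j * u ^ j)"
    and "\<And>z z'. (\<And>i. i \<in> S \<Longrightarrow> z $ i = z' $ i) \<Longrightarrow> P z = P z'"
  shows "mpoly P"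
  using assms
proof (induction S arbitrary: P rule: finite_induct)
  case empty
  have eq: "P = (\<lambda>z. P 0)"
  proof
    show "P z = P 0" for z using empty(2)[of z 0] by simp
  qed
  show ?case by (rule ssubst[OF eq, of mpoly]) (rule mpoly_const)
next
  case (insert i S)
  obtain a where a: "\<forall>c u. (\<Sum>j\<le>k. c j * u ^ j) = (\<Sum>l\<le>k. (\<Sum>j\<le>k. c j * of_nat l ^ j) * (\<Sum>b\<le>k. a l b * (u::complex) ^ b))"
    using lagrange_interpolation[of k] by (elim exE)
  have P: "P z = (\<Sum>l\<le>k. P (coord_update z i (of_nat l)) * (\<Sum>b\<le>k. a l b * (z $ i) ^ b))" for z
  proof -
    obtain c where c: "\<forall>u. P (coord_update z i u) = (\<Sum>j\<le>k. c j * u ^ j)" using insert.prems(1)[of z i] by (elim exE)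
    have "coord_update z i (z $ i) = z" by (simp add: coord_update_def vec_eq_iff)
    then have "P z = (\<Sum>j\<le>k. c j * (z $ i) ^ j)" using c[rule_format, of "z $ i"] by simp
    also have "\<dots> = (\<Sum>l\<le>k. (\<Sum>j\<le>k. c j * of_nat l ^ j) * (\<Sum>b\<le>k. a l b * (z $ i) ^ b))"
      by (rule a[rule_format])
    finally show ?thesis by (simp only: c)
  qed
  have "mpoly (\<lambda>z. P (coord_update z i (of_nat l)))" for l
  proof (rule insert.IH)
    fix z j
    show "\<exists>c. \<forall>u. P (coord_update (coord_update z j u) i (of_nat l)) = (\<Sum>j\<le>k. c j * u ^ j)"
    proof (cases "j = i")
      case True
      have "P (coord_update (coord_update z j u) i (of_nat l)) = (\<Sum>j\<le>k. (if j = 0 then P (coord_update z i (of_nat l)) else 0) * u ^ j)" for u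
      proof -
        have "coord_update (coord_update z j u) i (of_nat l) = coord_update z i (of_nat l)" using True by (simp add: coord_update_def vec_eq_iff)
        then show ?thesis by (simp add: if_distrib[of "\<lambda>x. x * _"] sum.delta cong: if_cong)
      qed
      then show ?thesis by (intro exI allI)
    next
      case False
      have "coord_update (coord_update z j u) i (of_nat l) = coord_update (coord_update z i (of_nat l)) j u" for u
        using False by (simp add: coord_update_def vec_eq_iff)
      then show ?thesis using insert.prems(1)[of "coord_update z i (of_nat l)" j] by simp
    qed
  next
    fix z z' :: "complex ^ 'n" assume "\<And>j. j \<in> S \<Longrightarrow> z $ j = z' $ j"
    then show "P (coord_update z i (of_nat l)) = P (coord_update z' i (of_nat l))"
      by (intro insert.prems(2)) (auto simp: coord_update_def)
  qed
  then have "mpoly (\<lambda>z. \<Sum>l\<le>k. \<Sum>b\<le>k. a l b * (P (coord_update z i (of_nat l)) * (z $ i) ^ b))"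
    by (intro mpoly_sum mpoly_scale mpoly_times_coord_power) simp_all
  also have "(\<lambda>z. \<Sum>l\<le>k. \<Sum>b\<le>k. a l b * (P (coord_update z i (of_nat l)) * (z $ i) ^ b)) = P"
    by (subst P[abs_def]) (simp add: sum_distrib_left mult_ac)
  finally show ?case .
qed

lemma finite_degree_set: "finite {\<beta> :: 'n::finite \<Rightarrow> nat. (\<Sum>i\<in>UNIV. \<beta> i) = k}"
proof (rule finite_subset)
  show "{\<beta> :: 'n \<Rightarrow> nat. (\<Sum>i\<in>UNIV. \<beta> i) = k} \<subseteq> PiE UNIV (\<lambda>_. {..k})"
    by (auto simp: PiE_def intro: member_le_sum)
  show "finite (PiE (UNIV :: 'n set) (\<lambda>_. {..k}))" by (intro finite_PiE) auto
qed

lemma homogeneous_poly_0: "homogeneous_poly d (\<lambda>z. 0)"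
  unfolding homogeneous_poly_def by (rule exI[of _ "\<lambda>_. 0"]) simp

lemma homogeneous_poly_add:
  assumes "homogeneous_poly d P" "homogeneous_poly d Q"
  shows "homogeneous_poly d (\<lambda>z. P z + Q z)"
proof -
  obtain c where c: "\<forall>z. P z = (\<Sum>\<beta> | (\<Sum>i\<in>UNIV. \<beta> i) = d. c \<beta> * (\<Prod>i\<in>UNIV. (z $ i) ^ \<beta> i))"
    using assms(1) unfolding homogeneous_poly_def by (elim exE)
  obtain c' where c': "\<forall>z. Q z = (\<Sum>\<beta> | (\<Sum>i\<in>UNIV. \<beta> i) = d. c' \<beta> * (\<Prod>i\<in>UNIV. (z $ i) ^ \<beta> i))"
    using assms(2) unfolding homogeneous_poly_def by (elim exE)
  show ?thesis
    unfolding homogeneous_poly_def c[rule_format] c'[rule_format]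
    by (rule exI[of _ "\<lambda>\<beta>. c \<beta> + c' \<beta>"]) (simp add: distrib_right sum.distrib)
qed

lemma homogeneous_poly_monomial:
  fixes \<beta> :: "'n::finite \<Rightarrow> nat"
  shows "homogeneous_poly (\<Sum>i\<in>UNIV. \<beta> i) (\<lambda>z :: complex ^ 'n. c * (\<Prod>i\<in>UNIV. (z $ i) ^ \<beta> i))"
  unfolding homogeneous_poly_def
proof (intro exI[of _ "\<lambda>\<gamma>. if \<gamma> = \<beta> then c else 0"] allI)
  fix z :: "complex ^ 'n"
  show "c * (\<Prod>i\<in>UNIV. (z $ i) ^ \<beta> i) = (\<Sum>\<gamma> | (\<Sum>i\<in>UNIV. \<gamma> i) = (\<Sum>i\<in>UNIV. \<beta> i). (if \<gamma> = \<beta> then c else 0) * (\<Prod>i\<in>UNIV. (z $ i) ^ \<gamma> i))"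
    using finite_degree_set by (subst sum.mono_neutral_right[of _ "{\<beta>}"]) auto
qed

lemma homogeneous_poly_smult:
  assumes "homogeneous_poly d P"
  shows "P (u *s z) = u ^ d * P z"
proof -
  obtain c where c: "\<forall>z. P z = (\<Sum>\<beta> | (\<Sum>i\<in>UNIV. \<beta> i) = d. c \<beta> * (\<Prod>i\<in>UNIV. (z $ i) ^ \<beta> i))"
    using assms(1) unfolding homogeneous_poly_def by (elim exE)
  show ?thesis
    unfolding c[rule_format] sum_distrib_left
    by (intro sum.cong refl) (auto simp: power_mult_distrib prod.distrib power_sum mult_ac)
qed

lemma mpoly_homogeneous_parts:
  "mpoly (P :: complex ^ 'n::finite \<Rightarrow> complex) \<Longrightarrow> \<exists>Q K. (\<forall>d. homogeneous_poly d (Q d)) \<and> (\<forall>z. \<forall>d>K. Q d z = 0) \<and> (\<forall>z. P z = (\<Sum>d\<le>K. Q d z))"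
proof (induction rule: mpoly.induct)
  case (monomial c \<beta>)
  let ?P = "\<lambda>z :: complex ^ 'n. c * (\<Prod>i\<in>UNIV. (z $ i) ^ \<beta> i)"
  let ?d = "\<Sum>i\<in>UNIV. \<beta> i"
  let ?Q = "\<lambda>d. if d = ?d then ?P else (\<lambda>z. 0)"
  have "homogeneous_poly d (?Q d)" for d
    using homogeneous_poly_monomial[of \<beta> c] homogeneous_poly_0[of d] by auto
  moreover have "?P z = (\<Sum>d\<le>?d. ?Q d z)" for z
    by (simp add: if_distrib[of "\<lambda>f. f z"] sum.delta cong: if_cong)
  ultimately show ?case by (intro exI[of _ ?Q] exI[of _ ?d]) auto
next
  case (add f g)
  obtain Q K where Q: "\<forall>d. homogeneous_poly d (Q d)" "\<forall>z. \<forall>d>K. Q d z = 0" "\<forall>z. f z = (\<Sum>d\<le>K. Q d z)"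
    using add.IH(1) by (elim exE conjE)
  obtain Q' K' where Q': "\<forall>d. homogeneous_poly d (Q' d)" "\<forall>z. \<forall>d>K'. Q' d z = 0" "\<forall>z. g z = (\<Sum>d\<le>K'. Q' d z)"
    using add.IH(2) by (elim exE conjE)
  let ?K = "max K K'"
  have "f z = (\<Sum>d\<le>?K. Q d z)" for z
    unfolding Q(3)[rule_format] by (intro sum.mono_neutral_left) (use Q(2) in auto)
  moreover have "g z = (\<Sum>d\<le>?K. Q' d z)" for z
    unfolding Q'(3)[rule_format] by (intro sum.mono_neutral_left) (use Q'(2) in auto)
  ultimately have "\<forall>z. f z + g z = (\<Sum>d\<le>?K. Q d z + Q' d z)" by (simp add: sum.distrib)
  moreover have "\<forall>d. homogeneous_poly d (\<lambda>z. Q d z + Q' d z)"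
    using Q(1) Q'(1) homogeneous_poly_add by blast
  moreover have "\<forall>z. \<forall>d>?K. Q d z + Q' d z = 0" using Q(2) Q'(2) by simp
  ultimately show ?case
    by (intro exI[of _ "\<lambda>d z. Q d z + Q' d z"] exI[of _ ?K]) simp
qed

text \<open>Along the line $u \mapsto uz$ both sides are polynomials in $u$, and comparison of coefficients shows that only
  the part of degree $k$ survives.\<close>

lemma mpoly_homogeneous_imp_homogeneous_poly:
  assumes "mpoly P" and hom: "\<And>u z. P (u *s z) = u ^ k * P z"
  shows "homogeneous_poly k P"
proof -
  obtain Q K where Q: "\<forall>d. homogeneous_poly d (Q d)" "\<forall>z. \<forall>d>K. Q d z = 0" "\<forall>z. P z = (\<Sum>d\<le>K. Q d z)"
    using mpoly_homogeneous_parts[OF assms(1)] by (elim exE conjE)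
  have "P z = Q k z" for z
  proof -
    let ?K = "max K k"
    have P: "P w = (\<Sum>d\<le>?K. Q d w)" for w
      unfolding Q(3)[rule_format] by (intro sum.mono_neutral_left) (use Q(2) in auto)
    have "(\<Sum>d\<le>?K. Q d z * u ^ d) = (\<Sum>d\<le>?K. (if d = k then P z else 0) * u ^ d)" for u
    proof -
      have "(\<Sum>d\<le>?K. Q d z * u ^ d) = P (u *s z)"
        unfolding P by (intro sum.cong refl) (simp add: homogeneous_poly_smult[OF Q(1)[rule_format]])
      also have "\<dots> = (\<Sum>d\<le>?K. (if d = k then P z else 0) * u ^ d)"
        by (simp add: hom if_distrib[of "\<lambda>x. x * _"] sum.delta cong: if_cong)
      finally show ?thesis .
    qed
    then have "\<forall>i\<le>?K. Q i z = (if i = k then P z else 0)"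
      by (subst polyfun_eq_coeffs[symmetric]) blast
    then show ?thesis by simp
  qed
  then have "P = Q k" by (rule ext)
  then show ?thesis using Q(1) by simp
qed

section \<open>The homogeneous expansion\<close>

lemma mpoly_hom_part:
  assumes f: "line_holomorphic (f :: complex ^ 'n::finite \<Rightarrow> complex)"
  shows "mpoly (hom_part f k)"
proof (rule separately_polynomial_imp_mpoly[of UNIV])
  fix z :: "complex ^ 'n" and i
  have eq: "coord_update z i u = coord_update z i 0 + u *s axis i 1" for u
    by (simp add: coord_update_def vec_eq_iff axis_def)
  obtain c where c: "\<forall>u. hom_part f k (coord_update z i 0 + u *s axis i 1) = (\<Sum>j\<le>k. c j * u ^ j)"
    using hom_part_polynomial_on_line[OF f] by (rule exE)
  show "\<exists>c. \<forall>u. hom_part f k (coord_update z i u) = (\<Sum>j\<le>k. c j * u ^ j)"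
  proof (rule exI, rule allI)
    show "hom_part f k (coord_update z i u) = (\<Sum>j\<le>k. c j * u ^ j)" for u
      unfolding eq[of u] by (rule c[rule_format])
  qed
next
  fix z z' :: "complex ^ 'n" assume "\<And>i. i \<in> UNIV \<Longrightarrow> z $ i = z' $ i"
  then have "z = z'" by (simp add: vec_eq_iff)
  then show "hom_part f k z = hom_part f k z'" by simp
qed simp

lemma homogeneous_poly_hom_part:
  assumes f: "line_holomorphic (f :: complex ^ 'n::finite \<Rightarrow> complex)"
  shows "homogeneous_poly k (hom_part f k)"
  by (rule mpoly_homogeneous_imp_homogeneous_poly[OF mpoly_hom_part[OF f] hom_part_smult[OF f]])

lemma power_series_coeffs_unique:
  fixes a b :: "nat \<Rightarrow> complex"
  assumes r: "r > 0" and a: "\<And>u. cmod u < r \<Longrightarrow> (\<lambda>k. a k * u ^ k) sums g u"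
    and b: "\<And>u. cmod u < r \<Longrightarrow> (\<lambda>k. b k * u ^ k) sums g u"
  shows "a = b"
proof -
  have conv: "fps_conv_radius (Abs_fps c) > 0" if c: "\<And>u. cmod u < r \<Longrightarrow> (\<lambda>k. c k * u ^ k) sums g u" for c :: "nat \<Rightarrow> complex"
  proof -
    have "summable (\<lambda>k. c k * complex_of_real (r / 2) ^ k)"
      by (rule sums_summable[OF c]) (use r in \<open>simp del: of_real_divide\<close>)
    then have "conv_radius c \<ge> norm (complex_of_real (r / 2))" by (rule conv_radius_geI)
    then have le: "ereal (r / 2) \<le> conv_radius c" using r by (simp del: of_real_divide)
    have "0 < ereal (r / 2)" using r by simp
    then have "0 < conv_radius c" using le by (rule less_le_trans)
    moreover have "fps_nth (Abs_fps c) = c" by (rule ext) simp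
    ultimately show ?thesis by (simp add: fps_conv_radius_def)
  qed
  have "Abs_fps a = Abs_fps b"
  proof (rule eval_fps_eqD[OF conv[OF a] conv[OF b]])
    have "eventually (\<lambda>u. u \<in> ball 0 r) (nhds (0::complex))"
      using r by (intro eventually_nhds_in_open) auto
    then show "eventually (\<lambda>u. eval_fps (Abs_fps a) u = eval_fps (Abs_fps b) u) (nhds 0)"
    proof eventually_elim
      case (elim u)
      then have u: "cmod u < r" by simp
      show ?case
        using sums_unique[OF a[OF u]] sums_unique[OF b[OF u]] by (simp add: eval_fps_def)
    qed
  qed
  then have "fps_nth (Abs_fps a) k = fps_nth (Abs_fps b) k" for k by (simp only:)
  then show ?thesis by (intro ext) simp
qed

text \<open>The Euler operator $a + u\frac{d}{du}$ multiplies the $k$-th Taylor coefficient by $k + a$.\<close>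

lemma power_series_euler:
  fixes b :: "nat \<Rightarrow> complex"
  assumes s: "\<And>u. cmod u < R \<Longrightarrow> (\<lambda>k. b k * u ^ k) sums f u" and f': "(f has_field_derivative D) (at u)" and u: "cmod u < R"
  shows "(\<lambda>k. of_real (real k + a) * b k * u ^ k) sums (of_real a * f u + u * D)"
proof -
  obtain K where K: "cmod u < K" "K < R" using dense[OF u] by blast
  then have K0: "0 < K" using norm_ge_zero[of u] by linarith
  have uK: "cmod u < cmod (of_real K :: complex)" using K K0 by simp
  have "summable (\<lambda>k. b k * of_real K ^ k)" by (rule sums_summable[OF s]) (use K K0 in simp)
  then have "((\<lambda>u. \<Sum>k. b k * u ^ k) has_field_derivative (\<Sum>k. diffs b k * u ^ k)) (at u)"
    by (rule termdiffs_strong[OF _ uK])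
  moreover have "\<forall>\<^sub>F v in nhds u. f v = (\<Sum>k. b k * v ^ k)"
  proof -
    have "\<forall>\<^sub>F v in nhds u. v \<in> ball 0 R" using u by (intro eventually_nhds_in_open) auto
    then show ?thesis
    proof eventually_elim
      case (elim v)
      then have "cmod v < R" by simp
      from sums_unique[OF s[OF this]] show ?case .
    qed
  qed
  ultimately have "(f has_field_derivative (\<Sum>k. diffs b k * u ^ k)) (at u)"
    by (subst DERIV_cong_ev[OF refl _ refl])
  then have D: "D = (\<Sum>k. diffs b k * u ^ k)" using f' by (rule DERIV_unique[rotated])
  have "summable (\<lambda>k. diffs b k * u ^ k)"
    by (rule termdiff_converges[OF u]) (rule sums_summable[OF s])
  then have "(\<lambda>k. of_nat k * b k * u ^ (k - Suc 0)) sums D" unfolding D by (rule diffs_equiv)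
  from sums_mult[OF this, of u]
  have "(\<lambda>k. u * (of_nat k * b k * u ^ (k - Suc 0))) sums (u * D)" .
  moreover have "u * (of_nat k * b k * u ^ (k - Suc 0)) = of_nat k * b k * u ^ k" for k
    by (cases k) simp_all
  ultimately have "(\<lambda>k. of_nat k * b k * u ^ k) sums (u * D)" by simp
  from sums_add[OF sums_mult[OF s[OF u], of "of_real a"] this]
  show ?thesis by (simp add: algebra_simps)
qed

lemma hom_part_eqI:
  assumes f: "line_holomorphic f" and r: "r > 0" "r * norm z \<le> 1"
    and b: "\<And>u. cmod u < r \<Longrightarrow> (\<lambda>k. b k * u ^ k) sums f (u *s z)"
  shows "hom_part f k z = b k"
proof -
  have "(\<lambda>k. hom_part f k z) = b"
  proof (rule power_series_coeffs_unique[of r _ "\<lambda>u. f (u *s z)"])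
    fix u :: complex assume u: "cmod u < r"
    have "cmod u * norm z < 1"
    proof (cases "z = 0")
      case False
      then have "cmod u * norm z < r * norm z" using u by simp
      then show ?thesis using r by linarith
    qed simp
    then show "(\<lambda>k. hom_part f k z * u ^ k) sums f (u *s z)" by (rule hom_part_sums[OF f])
  qed (use r b in simp_all)
  then show ?thesis by (rule fun_cong)
qed

text \<open>Uniqueness holds because a homogeneous expansion, restricted to a line through the origin, is a power
  series in one variable.\<close>

lemma homogeneous_expansion_eq_hom_part:
  assumes f: "line_holomorphic (f :: complex ^ 'n::finite \<Rightarrow> complex)"
  shows "homogeneous_expansion f = hom_part f"
  unfolding homogeneous_expansion_def
proof (rule the_equality)
  show "is_homogeneous_expansion f (hom_part f)"
    unfolding is_homogeneous_expansion_def
  proof (intro conjI allI ballI)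
    show "homogeneous_poly k (hom_part f k)" for k by (rule homogeneous_poly_hom_part[OF f])
    show "(\<lambda>k. hom_part f k z) sums f z" if "z \<in> unit_ball" for z
      using hom_part_sums[OF f, of 1 z] that by simp
  qed
  fix F assume "is_homogeneous_expansion f F"
  then have F: "homogeneous_poly k (F k)" "z \<in> unit_ball \<Longrightarrow> (\<lambda>k. F k z) sums f z" for k z
    unfolding is_homogeneous_expansion_def by blast+
  have "F k z = hom_part f k z" for k z
  proof (rule sym, rule hom_part_eqI[OF f, of "1 / (1 + norm z)"])
    have pos: "1 + norm z > 0" by (simp add: add_pos_nonneg)
    \<comment> \<open>the radius 1 / (1 + norm z) avoids a separate treatment of z = 0\<close>
    then show "1 / (1 + norm z) > 0" by simp
    show "1 / (1 + norm z) * norm z \<le> 1" using pos by (simp add: field_simps)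
    fix u :: complex assume "cmod u < 1 / (1 + norm z)"
    then have "cmod u * (1 + norm z) < 1" using pos by (simp add: field_simps)
    then have "cmod u * norm z < 1" by (simp add: distrib_left) (smt (verit) norm_ge_zero)
    then have "u *s z \<in> unit_ball" by (simp add: norm_vector_smult)
    from F(2)[OF this] show "(\<lambda>k. F k z * u ^ k) sums f (u *s z)"
      by (simp add: homogeneous_poly_smult[OF F(1)] mult.commute)
  qed
  then show "F = hom_part f" by (intro ext)
qed

section \<open>Coefficient multipliers\<close>

text \<open>Fractional radial derivatives and their inverses act on the homogeneous expansion by multiplying the part of
  degree $k$ by a number depending only on $k$.\<close>

definition multiplier :: "(nat \<Rightarrow> complex) \<Rightarrow> (complex ^ 'n::finite \<Rightarrow> complex) \<Rightarrow> complex ^ 'n \<Rightarrow> complex" where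
  "multiplier c f z = (\<Sum>k. c k * hom_part f k z)"

text \<open>The growth of the coefficients is at most subexponential, so that the multiplied expansion still converges
  in the whole ball.\<close>

definition subexponential :: "(nat \<Rightarrow> complex) \<Rightarrow> bool" where
  "subexponential c \<longleftrightarrow> (\<forall>r. 0 \<le> r \<longrightarrow> r < 1 \<longrightarrow> summable (\<lambda>k. cmod (c k) * r ^ k))"

lemma multiplier_majorant:
  assumes f: "line_holomorphic f" and c: "subexponential c" and r: "0 \<le> r" "r < 1"
  shows "\<exists>B. summable B \<and> (\<forall>k z. norm z \<le> r \<longrightarrow> cmod (c k * hom_part f k z) \<le> B k)"
proof -
  define \<rho> where "\<rho> = (1 + r) / 2"
  have \<rho>: "0 < \<rho>" "\<rho> < 1" "r < \<rho>" using r by (auto simp: \<rho>_def)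
  obtain M where M: "M \<ge> 0" "\<And>w. norm w \<le> \<rho> \<Longrightarrow> cmod (f w) \<le> M"
    using line_holomorphic_bounded[OF f \<rho>(2)] by auto
  have "summable (\<lambda>k. M * (cmod (c k) * (r / \<rho>) ^ k))"
    using c r \<rho> unfolding subexponential_def by (intro summable_mult) auto
  moreover have "cmod (c k * hom_part f k z) \<le> M * (cmod (c k) * (r / \<rho>) ^ k)" if "norm z \<le> r" for k z
  proof -
    have "cmod (hom_part f k z) \<le> M * (norm z / \<rho>) ^ k" by (rule hom_part_bound[OF f \<rho>(1,2) M(2)])
    also have "\<dots> \<le> M * (r / \<rho>) ^ k"
      using that M(1) \<rho> by (intro mult_left_mono power_mono divide_right_mono) auto
    finally have "cmod (c k) * cmod (hom_part f k z) \<le> cmod (c k) * (M * (r / \<rho>) ^ k)"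
      by (rule mult_left_mono) simp
    then show ?thesis by (simp add: norm_mult mult_ac)
  qed
  ultimately show ?thesis by blast
qed

lemma multiplier_sums:
  assumes f: "line_holomorphic f" and c: "subexponential c" and u: "cmod u * norm z < 1"
  shows "(\<lambda>k. c k * hom_part f k z * u ^ k) sums multiplier c f (u *s z)"
proof -
  obtain B where B: "summable B" "\<forall>k w. norm w \<le> cmod u * norm z \<longrightarrow> cmod (c k * hom_part f k w) \<le> B k"
    using multiplier_majorant[OF f c _ u] by auto
  have "summable (\<lambda>k. c k * hom_part f k (u *s z))"
    using B(2) by (intro summable_comparison_test'[OF B(1), of 0]) (simp add: norm_vector_smult)
  then have "(\<lambda>k. c k * hom_part f k (u *s z)) sums multiplier c f (u *s z)"
    unfolding multiplier_def by (rule summable_sums)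
  then show ?thesis by (simp add: hom_part_smult[OF f] mult_ac)
qed

lemma multiplier_uniform_limit:
  assumes f: "line_holomorphic f" and c: "subexponential c" and r: "0 \<le> r" "r < 1"
  shows "uniform_limit (cball 0 r) (\<lambda>n z. \<Sum>k<n. c k * hom_part f k z) (multiplier c f) sequentially"
proof -
  obtain B where B: "summable B" "\<forall>k z. norm z \<le> r \<longrightarrow> cmod (c k * hom_part f k z) \<le> B k"
    using multiplier_majorant[OF f c r] by (elim exE conjE)
  show ?thesis
    unfolding multiplier_def[abs_def]
    by (rule Weierstrass_m_test[OF _ B(1)]) (use B(2) in simp)
qed

lemma line_holomorphic_multiplier:
  assumes f: "line_holomorphic (f :: complex ^ 'n::finite \<Rightarrow> complex)" and c: "subexponential c"
  shows "line_holomorphic (multiplier c f)"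
  unfolding line_holomorphic_def
proof (intro conjI allI)
  have cont: "continuous_on (cball 0 r) (multiplier c f)" if r: "0 \<le> r" "r < 1" for r
  proof (rule uniform_limit_theorem[OF _ multiplier_uniform_limit[OF f c r]])
    show "\<forall>\<^sub>F n in sequentially. continuous_on (cball 0 r) (\<lambda>z. \<Sum>k<n. c k * hom_part f k z)"
      by (intro always_eventually allI continuous_on_sum continuous_on_mult continuous_on_const mpoly_continuous mpoly_hom_part[OF f])
  qed simp
  show "continuous_on unit_ball (multiplier c f)"
  proof (intro continuous_at_imp_continuous_on ballI)
    fix z :: "complex ^ 'n" assume "z \<in> unit_ball"
    then have z: "norm z < 1" by simp
    define r where "r = (1 + norm z) / 2"
    have r: "0 \<le> r" "r < 1" "norm z < r" using z by (auto simp: r_def add_nonneg_nonneg)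
    have "continuous_on (ball 0 r) (multiplier c f)"
      by (rule continuous_on_subset[OF cont[OF r(1,2)]]) auto
    then show "isCont (multiplier c f) z"
      by (rule continuous_on_interior) (use r in simp)
  qed
  fix x y :: "complex ^ 'n"
  let ?S = "{u. x + u *s y \<in> unit_ball}"
  show "(\<lambda>u. multiplier c f (x + u *s y)) holomorphic_on ?S"
  proof (rule holomorphic_uniform_sequence[OF open_line])
    show "(\<lambda>u. \<Sum>k<n. c k * hom_part f k (x + u *s y)) holomorphic_on ?S" for n
      by (intro holomorphic_on_sum holomorphic_on_mult holomorphic_on_const
          holomorphic_on_subset[OF hom_part_line_holomorphic[OF f]]) simp
    fix u0 :: complex assume u0: "u0 \<in> ?S"
    define s where "s = norm (x + u0 *s y)"
    have s: "0 \<le> s" "s < 1" using u0 by (auto simp: s_def)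
    define d where "d = (1 - s) / (2 * (1 + norm y))"
    have y: "1 + norm y > 0" by (simp add: add_pos_nonneg)
    have d: "d > 0" using s y by (simp add: d_def)
    define r where "r = (1 + s) / 2"
    have r: "0 \<le> r" "r < 1" using s by (auto simp: r_def)
    have dy: "d * norm y \<le> (1 - s) / 2"
    proof -
      have "d * norm y \<le> d * (1 + norm y)" using d by (intro mult_left_mono) auto
      also have "\<dots> = (1 - s) / 2" using y by (simp add: d_def field_simps)
      finally show ?thesis .
    qed
    have sub: "x + u *s y \<in> cball 0 r" if "u \<in> cball u0 d" for u
    proof -
      have "x + u *s y = (x + u0 *s y) + (u - u0) *s y" by (simp add: vec_eq_iff algebra_simps)
      then have "norm (x + u *s y) \<le> s + cmod (u - u0) * norm y"
        unfolding s_def using norm_triangle_ineq[of "x + u0 *s y" "(u - u0) *s y"] by (simp only: norm_vector_smult)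
      also have "cmod (u - u0) * norm y \<le> d * norm y"
        using that by (intro mult_right_mono) (auto simp: dist_norm norm_minus_commute)
      finally have "norm (x + u *s y) \<le> r" using dy by (simp add: r_def field_simps)
      then show ?thesis by simp
    qed
    have "uniform_limit (cball u0 d) (\<lambda>n u. \<Sum>k<n. c k * hom_part f k (x + u *s y)) (\<lambda>u. multiplier c f (x + u *s y)) sequentially"
      unfolding uniform_limit_iff
    proof (intro allI impI)
      fix e :: real assume "e > 0"
      then have "\<forall>\<^sub>F n in sequentially. \<forall>z\<in>cball 0 r. dist (\<Sum>k<n. c k * hom_part f k z) (multiplier c f z) < e"
        using multiplier_uniform_limit[OF f c r] unfolding uniform_limit_iff by simp
      then show "\<forall>\<^sub>F n in sequentially. \<forall>u\<in>cball u0 d. dist (\<Sum>k<n. c k * hom_part f k (x + u *s y)) (multiplier c f (x + u *s y)) < e"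
        by eventually_elim (use sub in blast)
    qed
    moreover have "cball u0 d \<subseteq> ?S"
    proof
      fix u assume "u \<in> cball u0 d"
      from sub[OF this] show "u \<in> ?S" using r(2) by simp
    qed
    ultimately show "\<exists>d>0. cball u0 d \<subseteq> ?S \<and> uniform_limit (cball u0 d) (\<lambda>n u. \<Sum>k<n. c k * hom_part f k (x + u *s y)) (\<lambda>u. multiplier c f (x + u *s y)) sequentially"
      using d by (intro exI[of _ d]) simp
  qed
qed

section \<open>Mean values over circled sets\<close>

text \<open>Cauchy's integral formula on the unit circle, with the boundary values in absolute value.\<close>

lemma circle_mean_value:
  assumes "\<phi> holomorphic_on cball 0 1"
  shows "ennreal (cmod (\<phi> 0)) \<le> (\<integral>\<^sup>+t\<in>{0..1}. ennreal (cmod (\<phi> (exp (2 * of_real pi * \<i> * of_real t)))) \<partial>lborel)"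
proof -
  let ?e = "\<lambda>t::real. exp (2 * of_real pi * \<i> * of_real t) :: complex"
  have "((\<lambda>u. \<phi> u / (u - 0)) has_contour_integral (2 * of_real pi * \<i> * \<phi> 0)) (circlepath 0 1)"
    using assms by (intro Cauchy_integral_circlepath_simple) auto
  moreover have "\<phi> (circlepath 0 1 t) / (circlepath 0 1 t - 0) * vector_derivative (circlepath 0 1) (at t within {0..1})
      = (2 * of_real pi * \<i>) * \<phi> (?e t)" if "t \<in> {0..1}" for t
  proof -
    have "vector_derivative (circlepath 0 1) (at t within {0..1}) = 2 * of_real pi * \<i> * ?e t"
      using vector_derivative_circlepath01[of t 0 1] that by simp
    moreover have "circlepath 0 1 t = ?e t" by (simp add: circlepath)
    ultimately show ?thesis by (simp only:) simp
  qed
  ultimately have "((\<lambda>t. (2 * of_real pi * \<i>) * \<phi> (?e t)) has_integral (2 * of_real pi * \<i> * \<phi> 0)) {0..1}"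
    unfolding has_contour_integral_def by (rule has_integral_eq[rotated])
  from has_integral_mult_right[OF this, of "1 / (2 * of_real pi * \<i>)"]
  have hi: "((\<lambda>t. \<phi> (?e t)) has_integral \<phi> 0) {0..1}" by simp
  have "continuous_on {0..1} (\<lambda>t. \<phi> (?e t))"
  proof (rule continuous_on_compose2[OF holomorphic_on_imp_continuous_on[OF assms]])
    show "continuous_on {0..1} ?e" by (intro continuous_intros)
    show "?e ` {0..1} \<subseteq> cball 0 1" by auto
  qed
  then have si: "set_integrable lborel {0..1} (\<lambda>t. \<phi> (?e t))"
    by (rule borel_integrable_atLeastAtMost')
  have "\<phi> 0 = integral {0..1} (\<lambda>t. \<phi> (?e t))" using hi by (rule integral_unique[symmetric])
  also have "\<dots> = (LINT t:{0..1}|lborel. \<phi> (?e t))" by (rule set_borel_integral_eq_integral(2)[OF si, symmetric])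
  finally have "ennreal (cmod (\<phi> 0)) \<le> (\<integral>\<^sup>+t. norm (indicator {0..1} t *\<^sub>R \<phi> (?e t)) \<partial>lborel)"
    using integral_norm_bound_ennreal[OF si[unfolded set_integrable_def]] by (simp add: set_lebesgue_integral_def)
  also have "\<dots> = (\<integral>\<^sup>+t\<in>{0..1}. ennreal (cmod (\<phi> (?e t))) \<partial>lborel)"
    by (intro nn_integral_cong) (simp add: indicator_def)
  finally show ?thesis .
qed

lemma line_holomorphic_measurable:
  assumes "line_holomorphic g"
  shows "(\<lambda>w. indicator unit_ball w *\<^sub>R g w) \<in> borel_measurable borel"
  using assms unfolding line_holomorphic_def
  by (intro borel_measurable_continuous_on_indicator) auto

text \<open>For fixed $h \in H$ the value at $\zeta$ is at most the mean of $|g(\zeta + e^{2\pi i t}h)|$ over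
  $t \in [0,1]$. Integration over $h$ removes $t$, since the set and Lebesgue measure are
  invariant under multiplication by $e^{2\pi i t}$.\<close>

lemma circled_mean_value:
  fixes g :: "complex ^ 'n::finite \<Rightarrow> complex"
  assumes g: "line_holomorphic g" and H[measurable]: "H \<in> sets borel"
    and circled: "\<And>h c. h \<in> H \<Longrightarrow> cmod c \<le> 1 \<Longrightarrow> c *s h \<in> H"
    and sub: "\<And>h. h \<in> H \<Longrightarrow> \<zeta> + h \<in> unit_ball"
  shows "ennreal (cmod (g \<zeta>)) * emeasure lborel H \<le> (\<integral>\<^sup>+h. ennreal (cmod (g (\<zeta> + h))) * indicator H h \<partial>lborel)"
proof -
  let ?e = "\<lambda>t::real. exp (2 * of_real pi * \<i> * of_real t) :: complex"
  define G where "G w = ennreal (cmod (indicator unit_ball w *\<^sub>R g w))" for w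
  have [measurable]: "G \<in> borel_measurable borel"
    unfolding G_def using line_holomorphic_measurable[OF g] by measurable
  have ne: "cmod (?e t) = 1" for t by simp
  have inv: "indicator H (?e t *s h) = (indicator H h :: ennreal)" for t h
  proof -
    have "h = inverse (?e t) *s (?e t *s h)" by (simp add: vector_smult_assoc)
    then have "h \<in> H" if "?e t *s h \<in> H"
      using circled[OF that, of "inverse (?e t)"] by (simp add: norm_inverse)
    moreover have "?e t *s h \<in> H" if "h \<in> H" by (rule circled[OF that]) simp
    ultimately have iff: "?e t *s h \<in> H \<longleftrightarrow> h \<in> H" by (rule iffI)
    show ?thesis unfolding indicator_def iff by (rule refl)
  qed
  have "continuous_on UNIV (\<lambda>p. \<zeta> + ?e (snd p) *s (fst p :: complex ^ 'n))"
    by (intro continuous_intros)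
  then have "(\<lambda>p. \<zeta> + ?e (snd p) *s (fst p :: complex ^ 'n)) \<in> borel_measurable borel"
    by (rule borel_measurable_continuous_onI)
  then have [measurable]: "(\<lambda>p. \<zeta> + ?e (snd p) *s (fst p :: complex ^ 'n)) \<in> borel_measurable (borel \<Otimes>\<^sub>M borel)"
    by (simp add: borel_prod)
  have joint[measurable]: "(\<lambda>(h, t). G (\<zeta> + ?e t *s h) * indicator H h * indicator {0..1} t) \<in> borel_measurable (borel \<Otimes>\<^sub>M borel)"
    by measurable
  have point: "ennreal (cmod (g \<zeta>)) * indicator H h \<le> (\<integral>\<^sup>+t. G (\<zeta> + ?e t *s h) * indicator H h * indicator {0..1} t \<partial>lborel)" for h
  proof (cases "h \<in> H")
    case True
    have "(\<lambda>u. g (\<zeta> + u *s h)) holomorphic_on cball 0 1"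
      by (rule line_holomorphicD[OF g]) (use True circled sub in simp)
    from circle_mean_value[OF this] have "ennreal (cmod (g \<zeta>)) \<le> (\<integral>\<^sup>+t\<in>{0..1}. ennreal (cmod (g (\<zeta> + ?e t *s h))) \<partial>lborel)"
      by simp
    also have "\<dots> = (\<integral>\<^sup>+t. G (\<zeta> + ?e t *s h) * indicator H h * indicator {0..1} t \<partial>lborel)"
    proof (intro nn_integral_cong)
      fix t
      have "\<zeta> + ?e t *s h \<in> unit_ball" by (intro sub circled True) simp
      then show "ennreal (cmod (g (\<zeta> + ?e t *s h))) * indicator {0..1} t = G (\<zeta> + ?e t *s h) * indicator H h * indicator {0..1} t"
        using True unfolding G_def by (simp only: indicator_simps) simp
    qed
    finally show ?thesis using True by simp
  qed simp
  have "ennreal (cmod (g \<zeta>)) * emeasure lborel H = (\<integral>\<^sup>+h. ennreal (cmod (g \<zeta>)) * indicator H h \<partial>lborel)"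
    by (simp add: nn_integral_cmult)
  also have "\<dots> \<le> (\<integral>\<^sup>+h. \<integral>\<^sup>+t. G (\<zeta> + ?e t *s h) * indicator H h * indicator {0..1} t \<partial>lborel \<partial>lborel)"
    by (intro nn_integral_mono point)
  also have "\<dots> = (\<integral>\<^sup>+t. \<integral>\<^sup>+h. G (\<zeta> + ?e t *s h) * indicator H h * indicator {0..1} t \<partial>lborel \<partial>lborel)"
    using joint by (intro lborel_pair.Fubini') (simp add: split_beta')
  also have "\<dots> = (\<integral>\<^sup>+t. (\<integral>\<^sup>+h. G (\<zeta> + h) * indicator H h \<partial>lborel) * indicator {0..1} (t::real) \<partial>lborel)"
  proof (intro nn_integral_cong)
    fix t :: real
    have lin: "linear (\<lambda>h :: complex ^ 'n. ?e t *s h)"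
      by (auto simp: linear_iff vec_eq_iff algebra_simps)
    have "(\<lambda>h. G (\<zeta> + ?e t *s h) * indicator H h) = (\<lambda>h. (\<lambda>x. G (\<zeta> + x) * indicator H x) (?e t *s h))"
      by (simp only: inv)
    then have "(\<integral>\<^sup>+h. G (\<zeta> + ?e t *s h) * indicator H h \<partial>lborel) = (\<integral>\<^sup>+h. G (\<zeta> + h) * indicator H h \<partial>lborel)"
      using nn_integral_lborel_isometry[OF lin, of "\<lambda>x. G (\<zeta> + x) * indicator H x"] by (simp add: norm_vector_smult)
    moreover have [measurable]: "(\<lambda>h. \<zeta> + ?e t *s h) \<in> borel_measurable borel"
      by (intro borel_measurable_continuous_onI continuous_intros)
    ultimately show "(\<integral>\<^sup>+h. G (\<zeta> + ?e t *s h) * indicator H h * indicator {0..1} t \<partial>lborel) = (\<integral>\<^sup>+h. G (\<zeta> + h) * indicator H h \<partial>lborel) * indicator {0..1} t"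
      by (subst nn_integral_multc) simp_all
  qed
  also have "\<dots> = (\<integral>\<^sup>+h. G (\<zeta> + h) * indicator H h \<partial>lborel)"
    by (simp add: nn_integral_cmult)
  also have "\<dots> = (\<integral>\<^sup>+h. ennreal (cmod (g (\<zeta> + h))) * indicator H h \<partial>lborel)"
  proof (intro nn_integral_cong)
    fix h show "G (\<zeta> + h) * indicator H h = ennreal (cmod (g (\<zeta> + h))) * indicator H h"
      using sub[of h] by (cases "h \<in> H") (simp_all add: G_def)
  qed
  finally show ?thesis .
qed

section \<open>Pointwise bounds by kernel integrals\<close>

text \<open>Extension by zero, which turns a function on the ball into a Borel function on the whole space.\<close>

definition ball_ext :: "(complex ^ 'n::finite \<Rightarrow> complex) \<Rightarrow> complex ^ 'n \<Rightarrow> complex" where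
  "ball_ext g w = indicator unit_ball w *\<^sub>R g w"

definition kernel_integral :: "nat \<Rightarrow> nat \<Rightarrow> (complex ^ 'n::finite \<Rightarrow> complex) \<Rightarrow> complex ^ 'n \<Rightarrow> ennreal" where
  "kernel_integral N b g z =
     (\<integral>\<^sup>+w. ennreal (cmod (ball_ext g w) * (1 - (norm w)\<^sup>2) ^ N / cmod (1 - cinner z w) ^ b) \<partial>lborel)"

lemma ball_ext_measurable: "line_holomorphic g \<Longrightarrow> ball_ext g \<in> borel_measurable borel"
  unfolding ball_ext_def[abs_def] by (rule line_holomorphic_measurable)

lemma ball_ext_in: "norm w < 1 \<Longrightarrow> ball_ext g w = g w"
  by (simp add: ball_ext_def)
lemma ball_ext_out: "\<not> norm w < 1 \<Longrightarrow> ball_ext g w = 0"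
  by (simp add: ball_ext_def)

lemma ennreal_divide_bound:
  assumes "a > 0" "b \<ge> 0" "ennreal x * ennreal a \<le> ennreal b * X"
  shows "ennreal x \<le> ennreal (b / a) * X"
proof -
  have "ennreal x = ennreal (1 / a) * (ennreal x * ennreal a)"
    using assms(1) by (simp add: mult.left_commute ennreal_mult'[symmetric])
  also have "\<dots> \<le> ennreal (1 / a) * (ennreal b * X)"
    by (rule mult_left_mono[OF assms(3)]) simp
  also have "\<dots> = ennreal (b / a) * X"
    using assms(1,2) by (simp add: mult.assoc[symmetric] ennreal_mult'[symmetric])
  finally show ?thesis .
qed

lemma aniso_box_circled:
  assumes "h \<in> aniso_box \<xi> \<delta>" "cmod c \<le> 1"
  shows "c *s h \<in> aniso_box \<xi> \<delta>"
proof -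
  have h: "cmod (cinner h \<xi>) < \<delta>" "(norm h)\<^sup>2 < 2 * \<delta>" using assms(1) by (auto simp: aniso_box_def)
  have "cmod c * cmod (cinner h \<xi>) \<le> 1 * cmod (cinner h \<xi>)" by (rule mult_right_mono[OF assms(2)]) simp
  then have a: "cmod c * cmod (cinner h \<xi>) \<le> cmod (cinner h \<xi>)" by simp
  have b: "(norm (c *s h))\<^sup>2 \<le> (norm h)\<^sup>2"
    unfolding norm_vector_smult
  proof (rule power_mono)
    show "cmod c * norm h \<le> norm h" using mult_right_mono[OF assms(2), of "norm h"] by simp
  qed simp
  show ?thesis
    unfolding aniso_box_def mem_Collect_eq cinner_scale_left norm_mult
    by (rule conjI[OF le_less_trans[OF a h(1)] le_less_trans[OF b h(2)]])
qed

text \<open>On an anisotropic box about $z$ of size a small multiple of $1-|z|^2$, the weight $1-|w|^2$ is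
  not much smaller, and the kernel $|1-\langle z,w\rangle|$ not much larger, than $1-|z|^2$. The constant 1/8 leaves room for the cross term
  $2\,\mathrm{Re}\langle h,z\rangle$ and for $|h|^2$.\<close>

lemma kernel_near_diagonal:
  assumes z: "norm z < 1" and \<xi>: "norm \<xi> = 1" "z = norm z *\<^sub>R \<xi>" and h: "h \<in> aniso_box \<xi> ((1 - (norm z)\<^sup>2) / 8)"
  shows "norm (z + h) < 1" and "(1 - (norm z)\<^sup>2) / 2 \<le> 1 - (norm (z + h))\<^sup>2"
    and "cmod (1 - cinner z (z + h)) \<le> 2 * (1 - (norm z)\<^sup>2)"
proof -
  define \<delta> where "\<delta> = 1 - (norm z)\<^sup>2"
  have d: "\<delta> > 0" using z by (simp add: \<delta>_def power_less_one_iff)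
  have h': "cmod (cinner h \<xi>) < \<delta> / 8" "(norm h)\<^sup>2 < \<delta> / 4" using h by (auto simp: aniso_box_def \<delta>_def)
  have "cinner h z = of_real (norm z) * cinner h \<xi>" by (subst \<xi>(2)) (rule cinner_scaleR_right)
  then have "cmod (cinner h z) = norm z * cmod (cinner h \<xi>)" by (simp add: norm_mult)
  also have "\<dots> \<le> 1 * cmod (cinner h \<xi>)" using z by (intro mult_right_mono) auto
  finally have hz: "cmod (cinner h z) < \<delta> / 8" using h' by simp
  have "(norm (z + h))\<^sup>2 = (norm z)\<^sup>2 + 2 * Re (cinner h z) + (norm h)\<^sup>2"
    unfolding power2_norm_eq_inner cinner_Re by (simp add: inner_add_left inner_add_right inner_commute)
  moreover have "\<bar>Re (cinner h z)\<bar> < \<delta> / 8" using hz abs_Re_le_cmod[of "cinner h z"] by linarith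
  ultimately show lower: "(1 - (norm z)\<^sup>2) / 2 \<le> 1 - (norm (z + h))\<^sup>2"
    using h' by (simp add: \<delta>_def)
  then have "(norm (z + h))\<^sup>2 < 1\<^sup>2" using d by (simp add: \<delta>_def)
  then show "norm (z + h) < 1" by (rule power_less_imp_less_base) simp
  have "1 - cinner z (z + h) = of_real \<delta> - cinner z h"
    by (simp add: cinner_add_right cinner_self \<delta>_def)
  then have "cmod (1 - cinner z (z + h)) \<le> \<delta> + cmod (cinner z h)"
    using norm_triangle_ineq4[of "of_real \<delta>" "cinner z h"] d by simp
  moreover have "cmod (cinner z h) = cmod (cinner h z)" by (simp add: cinner_commute[of z h])
  ultimately show "cmod (1 - cinner z (z + h)) \<le> 2 * (1 - (norm z)\<^sup>2)"
    using hz d by (simp add: \<delta>_def)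
qed

text \<open>The bound that the weighted Bergman reproducing formula would give, without the formula. By the mean value
  property $|g(z)|$ is at most the average of $|g|$ over a box about $z$ of volume about
  $(1-|z|^2)^{n+1}$, and on that box the kernel is at least a constant times $(1-|z|^2)^{-n-1}$.\<close>

lemma pointwise_kernel_bound:
  "\<exists>C>0. \<forall>(g :: complex ^ 'n::finite \<Rightarrow> complex) z. line_holomorphic g \<longrightarrow> norm z < 1 \<longrightarrow>
     ennreal (cmod (g z)) \<le> ennreal C * kernel_integral N (CARD('n) + 1 + N) g z"
proof -
  let ?n1 = "CARD('n) + 1"
  obtain c1 where c1: "c1 > 0" "\<forall>(\<xi> :: complex ^ 'n) \<delta>. norm \<xi> = 1 \<longrightarrow> 0 < \<delta> \<longrightarrow> \<delta> \<le> 1 \<longrightarrow>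
     ennreal (c1 * \<delta> ^ ?n1) \<le> emeasure lborel (aniso_box \<xi> \<delta>)"
    using aniso_box_volume_ge[where ?'n = 'n] by (elim exE conjE)
  let ?K = "2 ^ N * 2 ^ (?n1 + N) :: real"
  have main: "ennreal (cmod (g z)) \<le> ennreal (?K * 8 ^ ?n1 / c1) * kernel_integral N (?n1 + N) g z"
    if g: "line_holomorphic g" and z: "norm z < 1" for g :: "complex ^ 'n \<Rightarrow> complex" and z
  proof -
    obtain \<xi> :: "complex ^ 'n" where \<xi>: "norm \<xi> = 1" "z = norm z *\<^sub>R \<xi>" by (rule unit_direction)
    define \<delta> where "\<delta> = 1 - (norm z)\<^sup>2"
    have d: "0 < \<delta>" "\<delta> \<le> 1" using z by (auto simp: \<delta>_def power_less_one_iff)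
    define H where "H = aniso_box \<xi> (\<delta> / 8)"
    have [measurable]: "H \<in> sets borel" by (simp add: H_def)
    note near = kernel_near_diagonal[OF z \<xi>, folded \<delta>_def, folded H_def]
    let ?k = "\<lambda>w. cmod (ball_ext g w) * (1 - (norm w)\<^sup>2) ^ N / cmod (1 - cinner z w) ^ (?n1 + N)"
    have [measurable]: "(\<lambda>w. ennreal (?k w)) \<in> borel_measurable borel"
      using ball_ext_measurable[OF g] by measurable
    have pt: "ennreal (cmod (g (z + h))) * indicator H h \<le> ennreal (?K * \<delta> ^ ?n1) * ennreal (?k (z + h))" for h
    proof (cases "h \<in> H")
      case True
      let ?w = "z + h"
      have w: "norm ?w < 1" "\<delta> / 2 \<le> 1 - (norm ?w)\<^sup>2" "cmod (1 - cinner z ?w) \<le> 2 * \<delta>" using near[OF True] .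
      have pos: "0 < cmod (1 - cinner z ?w)" using z w(1) by (intro kernel_pos) auto
      have "1 = ?K * \<delta> ^ ?n1 * ((\<delta> / 2) ^ N / (2 * \<delta>) ^ (?n1 + N))"
        using d by (simp add: power_add power_divide power_mult_distrib)
      also have "\<dots> \<le> ?K * \<delta> ^ ?n1 * ((1 - (norm ?w)\<^sup>2) ^ N / cmod (1 - cinner z ?w) ^ (?n1 + N))"
      proof (intro mult_left_mono frac_le power_mono)
        show "0 \<le> (1 - (norm ?w)\<^sup>2) ^ N" using w(2) d(1) by (intro zero_le_power) linarith
        show "0 < cmod (1 - cinner z ?w) ^ (?n1 + N)" using pos by (rule zero_less_power)
        show "0 \<le> ?K * \<delta> ^ ?n1" using d(1) by (intro mult_nonneg_nonneg zero_le_power) simp_all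
      qed (use w d in simp_all)
      finally have "cmod (g ?w) * 1 \<le> cmod (g ?w) * (?K * \<delta> ^ ?n1 * ((1 - (norm ?w)\<^sup>2) ^ N / cmod (1 - cinner z ?w) ^ (?n1 + N)))"
        by (rule mult_left_mono) simp
      also have "\<dots> = ?K * \<delta> ^ ?n1 * ?k ?w" by (simp add: ball_ext_in[OF w(1)] mult_ac)
      finally have "ennreal (cmod (g ?w)) \<le> ennreal (?K * \<delta> ^ ?n1 * ?k ?w)" by (simp add: ennreal_leI)
      also have "\<dots> = ennreal (?K * \<delta> ^ ?n1) * ennreal (?k ?w)" by (rule ennreal_mult') (use d in simp)
      finally show ?thesis using True by simp
    qed simp
    have "ennreal (cmod (g z)) * ennreal (c1 * (\<delta> / 8) ^ ?n1) \<le> ennreal (cmod (g z)) * emeasure lborel H"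
      unfolding H_def by (intro mult_left_mono c1(2)[rule_format]) (use \<xi> d in auto)
    also have "\<dots> \<le> (\<integral>\<^sup>+h. ennreal (cmod (g (z + h))) * indicator H h \<partial>lborel)"
    proof (rule circled_mean_value[OF g])
      show "c *s h \<in> H" if "h \<in> H" "cmod c \<le> 1" for h c using aniso_box_circled that by (simp add: H_def)
      show "z + h \<in> unit_ball" if "h \<in> H" for h using near(1)[OF that] by simp
    qed simp
    also have "\<dots> \<le> (\<integral>\<^sup>+h. ennreal (?K * \<delta> ^ ?n1) * ennreal (?k (z + h)) \<partial>lborel)"
      by (intro nn_integral_mono pt)
    also have "\<dots> = ennreal (?K * \<delta> ^ ?n1) * (\<integral>\<^sup>+h. ennreal (?k (z + h)) \<partial>lborel)"
      by (rule nn_integral_cmult) measurable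
    also have "(\<integral>\<^sup>+h. ennreal (?k (z + h)) \<partial>lborel) = kernel_integral N (?n1 + N) g z"
      unfolding kernel_integral_def by (rule nn_integral_lborel_translate) measurable
    finally have "ennreal (cmod (g z)) \<le> ennreal (?K * \<delta> ^ ?n1 / (c1 * (\<delta> / 8) ^ ?n1)) * kernel_integral N (?n1 + N) g z"
      using c1(1) d by (intro ennreal_divide_bound) auto
    also have "?K * \<delta> ^ ?n1 / (c1 * (\<delta> / 8) ^ ?n1) = ?K * 8 ^ ?n1 / c1"
      using c1(1) d by (simp add: power_divide field_simps)
    finally show ?thesis .
  qed
  show ?thesis
    by (rule exI[of _ "?K * 8 ^ ?n1 / c1"]) (use main c1(1) in simp)
qed

section \<open>Inverting first-order radial operators\<close>

text \<open>Nonresonance is automatically uniform, since only finitely many $k + a$ are small.\<close>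

lemma shifted_nat_bounded_below:
  fixes a :: real
  assumes "\<And>k::nat. real k + a \<noteq> 0"
  obtains \<eta> where "\<eta> > 0" "\<And>k::nat. \<eta> \<le> \<bar>real k + a\<bar>"
proof -
  obtain K :: nat where K: "real K > \<bar>a\<bar> + 1" using reals_Archimedean2 by blast
  let ?S = "insert 1 ((\<lambda>k::nat. \<bar>real k + a\<bar>) ` {..K})"
  show thesis
  proof (rule that[of "Min ?S"])
    show "Min ?S > 0" using assms by (subst Min_gr_iff) auto
    show "Min ?S \<le> \<bar>real k + a\<bar>" for k
    proof (cases "k \<le> K")
      case True then show ?thesis by (intro Min_le) auto
    next
      case False
      have "Min ?S \<le> 1" by (intro Min_le) auto
      also have "1 \<le> \<bar>real k + a\<bar>" using False K by linarith
      finally show ?thesis .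
    qed
  qed
qed

lemma subexponential_one: "subexponential (\<lambda>k. 1)"
  unfolding subexponential_def by (auto intro: summable_geometric)

lemma subexponential_shift:
  assumes "subexponential c"
  shows "subexponential (\<lambda>k. of_real (real k + a) * c k)"
  unfolding subexponential_def
proof (intro allI impI)
  fix r :: real assume r: "0 \<le> r" "r < 1"
  define \<rho> where "\<rho> = (1 + r) / 2"
  have \<rho>: "0 < \<rho>" "\<rho> < 1" "r < \<rho>" using r by (auto simp: \<rho>_def)
  define q where "q = r / \<rho>"
  have q: "0 \<le> q" "q < 1" using r \<rho> by (auto simp: q_def)
  have "(\<lambda>k. of_nat k * q ^ k) \<longlonglongrightarrow> 0" using q by (intro powser_times_n_limit_0) simp
  then have "Bseq (\<lambda>k. of_nat k * q ^ k)" by (intro convergent_imp_Bseq convergentI)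
  then obtain B where B: "B > 0" "\<forall>k. norm (of_nat k * q ^ k) \<le> B" by (rule BseqE)
  have "summable (\<lambda>k. (B + \<bar>a\<bar>) * (cmod (c k) * \<rho> ^ k))"
    using assms \<rho> unfolding subexponential_def by (intro summable_mult) simp
  then show "summable (\<lambda>k. cmod (of_real (real k + a) * c k) * r ^ k)"
  proof (rule summable_comparison_test')
    fix k :: nat
    have "r ^ k = q ^ k * \<rho> ^ k" using \<rho> by (simp add: q_def power_divide)
    have "\<bar>real k + a\<bar> * q ^ k \<le> (real k + \<bar>a\<bar>) * q ^ k" using q by (intro mult_right_mono) auto
    also have "\<dots> = real k * q ^ k + \<bar>a\<bar> * q ^ k" by (simp add: distrib_right)
    also have "\<dots> \<le> B + \<bar>a\<bar> * 1"
      using B(2)[rule_format, of k] q by (intro add_mono mult_left_mono) (auto simp: power_le_one)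
    finally have "\<bar>real k + a\<bar> * q ^ k * (cmod (c k) * \<rho> ^ k) \<le> (B + \<bar>a\<bar>) * (cmod (c k) * \<rho> ^ k)"
      using \<rho> by (intro mult_right_mono) auto
    moreover have "cmod (of_real (real k + a) * c k) * r ^ k = \<bar>real k + a\<bar> * q ^ k * (cmod (c k) * \<rho> ^ k)"
      unfolding \<open>r ^ k = q ^ k * \<rho> ^ k\<close> norm_mult norm_of_real by (simp only: mult_ac)
    moreover have "norm (cmod (of_real (real k + a) * c k) * r ^ k) = cmod (of_real (real k + a) * c k) * r ^ k"
      unfolding real_norm_def using r(1) by (intro abs_of_nonneg mult_nonneg_nonneg zero_le_power norm_ge_zero)
    ultimately show "norm (cmod (of_real (real k + a) * c k) * r ^ k) \<le> (B + \<bar>a\<bar>) * (cmod (c k) * \<rho> ^ k)"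
      by (simp only:)
  qed
qed

lemma hom_part_multiplier:
  assumes f: "line_holomorphic (f :: complex ^ 'n::finite \<Rightarrow> complex)" and c: "subexponential c"
  shows "hom_part (multiplier c f) k z = c k * hom_part f k z"
proof (rule hom_part_eqI[OF line_holomorphic_multiplier[OF f c], of "1 / (1 + norm z)"])
  have pos: "1 + norm z > 0" by (simp add: add_pos_nonneg)
  then show "1 / (1 + norm z) > 0" by simp
  show "1 / (1 + norm z) * norm z \<le> 1" using pos by (simp add: field_simps)
  fix u :: complex assume "cmod u < 1 / (1 + norm z)"
  then have "cmod u * (1 + norm z) < 1" using pos by (simp add: field_simps)
  moreover have "cmod u * norm z \<le> cmod u * (1 + norm z)" by (intro mult_left_mono) auto
  ultimately have "cmod u * norm z < 1" by linarith
  then show "(\<lambda>k. c k * hom_part f k z * u ^ k) sums multiplier c f (u *s z)"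
    by (rule multiplier_sums[OF f c])
qed

text \<open>Let $\varphi$ and $\psi$ be the restrictions to the ray through $z$ of a function and of its image under
  $a + R$, where $R$ is the radial derivative. Then $(s^a\varphi(s))' = s^{a-1}\psi(s)$, and integrating from 0
  would require $a > 0$. Integrating from $s = 1/2$ works for every $a$ outside
  $\{0,-1,-2,\dots\}$: the value at $1/2$ is controlled by the Taylor coefficients, which are those of
  $\psi$ divided by $k + a$, and hence by the supremum over a smaller ball.\<close>

lemma radial_ode_bound:
  fixes a :: real
  assumes a: "\<And>k::nat. real k + a \<noteq> 0"
  shows "\<exists>C>0. \<forall>(f :: complex ^ 'n::finite \<Rightarrow> complex) c z M. line_holomorphic f \<longrightarrow> subexponential c \<longrightarrow> norm z < 1 \<longrightarrow>
    (\<forall>w. norm w \<le> 3/4 \<longrightarrow> cmod (multiplier (\<lambda>k. of_real (real k + a) * c k) f w) \<le> M) \<longrightarrow>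
    ennreal (cmod (multiplier c f z)) \<le> ennreal C * (ennreal M +
      (\<integral>\<^sup>+s\<in>{1/2..1}. ennreal (cmod (multiplier (\<lambda>k. of_real (real k + a) * c k) f (of_real s *s z))) \<partial>lborel))"
proof -
  obtain \<eta> where \<eta>: "\<eta> > 0" "\<And>k::nat. \<eta> \<le> \<bar>real k + a\<bar>" using shifted_nat_bounded_below[OF a] by blast
  define C where "C = 2 powr (- a) * (3 / \<eta>) + 2 powr \<bar>a - 1\<bar>"
  have Cpos: "C > 0" using \<eta> by (simp add: C_def add_nonneg_pos)
  have "ennreal (cmod (multiplier c f z)) \<le> ennreal C * (ennreal M +
      (\<integral>\<^sup>+s\<in>{1/2..1}. ennreal (cmod (multiplier (\<lambda>k. of_real (real k + a) * c k) f (of_real s *s z))) \<partial>lborel))"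
    if f: "line_holomorphic f" and c: "subexponential c" and z: "norm z < 1"
      and M: "\<forall>w. norm w \<le> 3/4 \<longrightarrow> cmod (multiplier (\<lambda>k. of_real (real k + a) * c k) f w) \<le> M"
    for f :: "complex ^ 'n::finite \<Rightarrow> complex" and c z M
  proof -
    define c' where "c' = (\<lambda>k. of_real (real k + a) * c k)"
    have c': "subexponential c'" unfolding c'_def by (rule subexponential_shift[OF c])
    define \<phi> where "\<phi> u = multiplier c f (u *s z)" for u
    define \<psi> where "\<psi> u = multiplier c' f (u *s z)" for u
    define x where "x k = c k * hom_part f k z" for k
    have M': "cmod (multiplier c' f w) \<le> M" if "norm w \<le> 3/4" for w using M that by (simp add: c'_def)
    have M0: "M \<ge> 0" using order_trans[OF norm_ge_zero M'[of 0]] by simp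
    have \<phi>: "(\<lambda>k. x k * u ^ k) sums \<phi> u" if "cmod u * norm z < 1" for u
      unfolding \<phi>_def x_def by (rule multiplier_sums[OF f c that])
    have \<psi>: "(\<lambda>k. of_real (real k + a) * x k * u ^ k) sums \<psi> u" if "cmod u * norm z < 1" for u
      using multiplier_sums[OF f c' that] unfolding \<psi>_def x_def c'_def by (simp only: mult.assoc)
    \<comment> \<open>Cauchy's inequality on the ball of radius 3/4 costs a factor (4/3)^k, which the half-way point outweighs\<close>
    have xb: "cmod (x k * (1/2) ^ k) \<le> M / \<eta> * (2/3) ^ k" for k
    proof -
      have "cmod (c' k * hom_part f k z) \<le> M * (norm z / (3/4)) ^ k"
        unfolding hom_part_multiplier[OF f c', symmetric]
        by (rule hom_part_bound[OF line_holomorphic_multiplier[OF f c']]) (use M' in auto)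
      also have "\<dots> \<le> M * (4/3) ^ k" using z M0 by (intro mult_left_mono power_mono) auto
      finally have "\<bar>real k + a\<bar> * cmod (x k) \<le> M * (4/3) ^ k"
        unfolding x_def c'_def mult.assoc norm_mult norm_of_real .
      moreover have "\<eta> * cmod (x k) \<le> \<bar>real k + a\<bar> * cmod (x k)" by (rule mult_right_mono[OF \<eta>(2)]) simp
      ultimately have "cmod (x k) * \<eta> \<le> M * (4/3) ^ k" by (simp only: mult.commute[of _ \<eta>])
      then have "cmod (x k) \<le> M * (4/3) ^ k / \<eta>" by (simp only: pos_le_divide_eq[OF \<eta>(1)])
      then have "cmod (x k) * (1/2) ^ k \<le> M * (4/3) ^ k / \<eta> * (1/2) ^ k" by (rule mult_right_mono) simp
      also have "\<dots> = M / \<eta> * ((4/3) * (1/2)) ^ k" unfolding power_mult_distrib by (simp add: mult_ac)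
      finally show ?thesis by (simp add: norm_mult norm_power)
    qed
    have half: "cmod (\<phi> (1/2)) \<le> M / \<eta> * 3"
    proof -
      have g: "(\<lambda>k. M / \<eta> * (2/3) ^ k) sums (M / \<eta> * 3)"
        using geometric_sums[of "2/3::real"] by (intro sums_mult) simp
      have s: "(\<lambda>k. x k * (1/2) ^ k) sums \<phi> (1/2)" by (rule \<phi>) (use z in simp)
      from norm_suminf_le[OF xb sums_summable[OF g]] show ?thesis
        by (simp only: sums_unique[OF s, symmetric] sums_unique[OF g, symmetric])
    qed
    \<comment> \<open>the disc of radius K > 1 makes the end point s = 1 an interior point\<close>
    have ode: "\<exists>D. (\<phi> has_field_derivative D) (at (of_real s)) \<and> of_real a * \<phi> (of_real s) + of_real s * D = \<psi> (of_real s)"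
      if s: "s \<in> {1/2..1}" for s :: real
    proof -
      obtain K where K: "1 < K" "K * norm z < 1"
      proof (cases "z = 0")
        case True then show ?thesis using that[of 2] by simp
      next
        case False
        have "1 < 1 / norm z" using z False by simp
        then obtain K where "1 < K" "K < 1 / norm z" using dense by blast
        then show ?thesis using that[of K] False by (simp add: field_simps)
      qed
      have Kz: "cmod u * norm z < 1" if "cmod u < K" for u :: complex
        using mult_right_mono[OF less_imp_le[OF that] norm_ge_zero[of z]] K(2) by linarith
      let ?s = "complex_of_real s"
      have "\<phi> holomorphic_on ball 0 K"
        unfolding \<phi>_def[abs_def] by (rule line_holomorphic_slice[OF line_holomorphic_multiplier[OF f c]]) (use Kz in simp)
      then have D: "(\<phi> has_field_derivative deriv \<phi> ?s) (at ?s)"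
        by (rule holomorphic_derivI) (use s K in auto)
      have sK: "cmod ?s < K" using s K by simp
      have "(\<lambda>k. of_real (real k + a) * x k * ?s ^ k) sums (of_real a * \<phi> ?s + ?s * deriv \<phi> ?s)"
        by (rule power_series_euler[OF \<phi>[OF Kz] D sK])
      from sums_unique2[OF this \<psi>[OF Kz[OF sK]]] D show ?thesis by blast
    qed
    let ?I = "\<lambda>s::real. of_real (s powr a) * \<phi> (of_real s)"
    let ?J = "\<lambda>s::real. of_real (s powr (a - 1)) * \<psi> (of_real s)"
    have "(?J has_integral (?I 1 - ?I (1/2))) {1/2..1}"
    proof (rule fundamental_theorem_of_calculus)
      fix s :: real assume s: "s \<in> {1/2..1}"
      then have sp: "s > 0" by simp
      obtain D where D: "(\<phi> has_field_derivative D) (at (of_real s))" "of_real a * \<phi> (of_real s) + of_real s * D = \<psi> (of_real s)"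
        using ode[OF s] by (elim exE conjE)
      have "((\<lambda>s. \<phi> (of_real s)) has_vector_derivative D) (at s)"
        by (rule has_vector_derivative_real_field[OF D(1)])
      moreover have "((\<lambda>s. complex_of_real (s powr a)) has_vector_derivative of_real (a * s powr (a - 1))) (at s)"
        using sp by (intro has_vector_derivative_of_real) (auto intro!: derivative_eq_intros simp: has_real_derivative_iff_has_vector_derivative[symmetric])
      ultimately have "(?I has_vector_derivative (of_real (s powr a) * D + of_real (a * s powr (a - 1)) * \<phi> (of_real s))) (at s)"
        by (rule has_vector_derivative_mult[rotated])
      moreover have "of_real (s powr a) * D + of_real (a * s powr (a - 1)) * \<phi> (of_real s) = ?J s"
      proof -
        have "s powr a = s powr (a - 1) * s" using sp by (simp add: powr_diff)
        then show ?thesis unfolding D(2)[symmetric] by (simp add: algebra_simps)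
      qed
      ultimately show "(?I has_vector_derivative ?J s) (at s within {1/2..1})"
        by (simp add: has_vector_derivative_at_within)
    qed simp
    then have hi: "(?J has_integral (\<phi> 1 - of_real ((1/2) powr a) * \<phi> (1/2))) {1/2..1}" by simp
    have \<psi>cont: "continuous_on {1/2..1} (\<lambda>s. \<psi> (of_real s))"
    proof -
      have "(\<lambda>u. multiplier c' f (u *s z)) holomorphic_on cball 0 1"
      proof (rule line_holomorphic_slice[OF line_holomorphic_multiplier[OF f c']])
        fix u :: complex assume "u \<in> cball 0 1"
        then have "cmod u * norm z \<le> 1 * norm z" by (intro mult_right_mono) auto
        then show "cmod u * norm z < 1" using z by linarith
      qed
      then have "continuous_on (cball 0 1) \<psi>" unfolding \<psi>_def[abs_def] by (rule holomorphic_on_imp_continuous_on)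
      then show ?thesis by (rule continuous_on_compose2) (auto intro!: continuous_intros)
    qed
    then have Jcont: "continuous_on {1/2..1} ?J"
      by (intro continuous_intros) auto
    have si: "set_integrable lborel {1/2..1} ?J" by (rule borel_integrable_atLeastAtMost'[OF Jcont])
    have "\<phi> 1 - of_real ((1/2) powr a) * \<phi> (1/2) = integral {1/2..1} ?J" using hi by (rule integral_unique[symmetric])
    also have "\<dots> = (LINT s:{1/2..1}|lborel. ?J s)" by (rule set_borel_integral_eq_integral(2)[OF si, symmetric])
    finally have "ennreal (cmod (\<phi> 1 - of_real ((1/2) powr a) * \<phi> (1/2))) \<le> (\<integral>\<^sup>+s. norm (indicator {1/2..1} s *\<^sub>R ?J s) \<partial>lborel)"
      using integral_norm_bound_ennreal[OF si[unfolded set_integrable_def]] by (simp add: set_lebesgue_integral_def)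
    also have "\<dots> \<le> (\<integral>\<^sup>+s. ennreal (2 powr \<bar>a - 1\<bar>) * (ennreal (cmod (\<psi> (of_real s))) * indicator {1/2..1} s) \<partial>lborel)"
    proof (rule nn_integral_mono)
      fix s :: real
      show "ennreal (norm (indicator {1/2..1} s *\<^sub>R ?J s)) \<le> ennreal (2 powr \<bar>a - 1\<bar>) * (ennreal (cmod (\<psi> (of_real s))) * indicator {1/2..1} s)"
      proof (cases "s \<in> {1/2..1}")
        case True
        have "s powr (a - 1) \<le> 2 powr \<bar>a - 1\<bar>"
        proof (cases "a - 1 \<ge> 0")
          case True': True
          have "s powr (a - 1) \<le> 1 powr (a - 1)" using True True' by (intro powr_mono2) auto
          also have "1 powr (a - 1) \<le> 2 powr \<bar>a - 1\<bar>" using True' by (intro powr_mono_both) auto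
          finally show ?thesis .
        next
          case False
          have "s powr (a - 1) \<le> (1/2) powr (a - 1)" using True False by (intro powr_mono2') auto
          also have "\<dots> = 2 powr \<bar>a - 1\<bar>" using False by (simp add: powr_divide powr_minus_divide[symmetric])
          finally show ?thesis .
        qed
        then have "s powr (a - 1) * cmod (\<psi> (of_real s)) \<le> 2 powr \<bar>a - 1\<bar> * cmod (\<psi> (of_real s))"
          by (rule mult_right_mono) simp
        then show ?thesis using True by (simp add: norm_mult ennreal_mult'[symmetric] ennreal_leI)
      qed simp
    qed
    also have "\<dots> = ennreal (2 powr \<bar>a - 1\<bar>) * (\<integral>\<^sup>+s\<in>{1/2..1}. ennreal (cmod (\<psi> (of_real s))) \<partial>lborel)" (is "_ = _ * ?X")
    proof (rule nn_integral_cmult)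
      have "(\<lambda>s. indicator {1/2..1} s *\<^sub>R \<psi> (of_real s)) \<in> borel_measurable borel"
        using \<psi>cont by (intro borel_measurable_continuous_on_indicator) auto
      then have "(\<lambda>s. ennreal (cmod (indicator {1/2..1} s *\<^sub>R \<psi> (of_real s)))) \<in> borel_measurable borel" by measurable
      also have "(\<lambda>s. ennreal (cmod (indicator {1/2..1} s *\<^sub>R \<psi> (of_real s)))) = (\<lambda>s. ennreal (cmod (\<psi> (of_real s))) * indicator {1/2..1::real} s)"
        by (auto simp: indicator_def)
      finally show "(\<lambda>s. ennreal (cmod (\<psi> (of_real s))) * indicator {1/2..1::real} s) \<in> borel_measurable lborel" by simp
    qed
    finally have int: "ennreal (cmod (\<phi> 1 - of_real ((1/2) powr a) * \<phi> (1/2))) \<le> ennreal (2 powr \<bar>a - 1\<bar>) * ?X" .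
    have "cmod (\<phi> 1) \<le> cmod (of_real ((1/2) powr a) * \<phi> (1/2)) + cmod (\<phi> 1 - of_real ((1/2) powr a) * \<phi> (1/2))"
      by (rule norm_triangle_sub)
    also have "cmod (of_real ((1/2) powr a) * \<phi> (1/2)) = 2 powr (- a) * cmod (\<phi> (1/2))"
      unfolding norm_mult norm_of_real by (simp add: powr_divide powr_minus_divide)
    also have "2 powr (- a) * cmod (\<phi> (1/2)) \<le> 2 powr (- a) * (M / \<eta> * 3)" by (intro mult_left_mono half) simp
    finally have "ennreal (cmod (\<phi> 1)) \<le> ennreal (2 powr (- a) * (M / \<eta> * 3) + cmod (\<phi> 1 - of_real ((1/2) powr a) * \<phi> (1/2)))"
      by (simp add: ennreal_leI)
    also have "\<dots> = ennreal (2 powr (- a) * (3 / \<eta>)) * ennreal M + ennreal (cmod (\<phi> 1 - of_real ((1/2) powr a) * \<phi> (1/2)))"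
      using M0 \<eta>(1) by (simp add: ennreal_mult'[symmetric] mult_ac)
    also have "\<dots> \<le> ennreal C * ennreal M + ennreal C * ?X"
    proof (rule add_mono)
      show "ennreal (2 powr (- a) * (3 / \<eta>)) * ennreal M \<le> ennreal C * ennreal M"
        by (intro mult_right_mono ennreal_leI) (simp_all add: C_def)
      have "ennreal (2 powr \<bar>a - 1\<bar>) \<le> ennreal C" using \<eta>(1) by (intro ennreal_leI) (simp add: C_def)
      then have "ennreal (2 powr \<bar>a - 1\<bar>) * ?X \<le> ennreal C * ?X" by (rule mult_right_mono) simp
      then show "ennreal (cmod (\<phi> 1 - of_real ((1/2) powr a) * \<phi> (1/2))) \<le> ennreal C * ?X"
        using int by (rule order_trans[rotated])
    qed
    finally show ?thesis by (simp add: \<phi>_def \<psi>_def c'_def distrib_left)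
  qed
  then show ?thesis using Cpos by blast
qed

section \<open>Pointwise bounds by the radial derivative\<close>

text \<open>Both $1-s$ and $|1-u|$ are controlled by $|1-su|$, with constants 1 and 2.\<close>

lemma radial_kernel_lower:
  assumes u: "cmod u < 1" and s: "0 \<le> s" "s \<le> 1"
  shows "(1 - s + cmod (1 - u)) / 3 \<le> cmod (1 - of_real s * u)"
proof -
  have "cmod (of_real s * u) \<le> s * 1" unfolding norm_mult using u s by (intro mult_mono) auto
  then have 1: "1 - s \<le> cmod (1 - of_real s * u)" using norm_triangle_ineq2[of 1 "of_real s * u"] by simp
  have "1 - u = (1 - of_real s * u) - of_real (1 - s) * u" by (simp add: algebra_simps)
  then have le: "cmod (1 - u) \<le> cmod (1 - of_real s * u) + cmod (of_real (1 - s) * u)"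
    using norm_triangle_ineq4[of "1 - of_real s * u" "of_real (1 - s) * u"] by (simp only:)
  have eq: "cmod (of_real (1 - s) * u) = (1 - s) * cmod u"
    unfolding norm_mult norm_of_real using s by simp
  have le2: "cmod (1 - u) \<le> cmod (1 - of_real s * u) + (1 - s) * cmod u"
    using le unfolding eq .
  have "(1 - s) * cmod u \<le> 1 - s" using mult_left_mono[of "cmod u" 1 "1 - s"] u s by simp
  from order_trans[OF le2 add_left_mono[OF this]]
  have "1 - s + cmod (1 - u) \<le> 3 * cmod (1 - of_real s * u)" using 1 by linarith
  then show ?thesis by simp
qed

text \<open>Integration along a radius lowers the exponent of the kernel by one, as for
  $\int_0^1 (1-s+\delta)^{-b-2}\,ds \le \delta^{-b-1}$.\<close>

lemma radial_kernel_integral: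
  assumes u: "cmod u < 1" and d: "u \<noteq> 1"
  shows "(\<integral>\<^sup>+s\<in>{1/2..1}. ennreal (1 / cmod (1 - of_real s * u) ^ Suc (Suc b)) \<partial>lborel) \<le> ennreal (3 ^ Suc (Suc b)) * ennreal (1 / cmod (1 - u) ^ Suc b)"
proof -
  define \<delta> where "\<delta> = cmod (1 - u)"
  have dpos: "\<delta> > 0" using d by (simp add: \<delta>_def)
  define F where "F s = inverse (1 - s + \<delta>) ^ Suc b / real (Suc b)" for s
  define f where "f s = inverse (1 - s + \<delta>) ^ Suc (Suc b)" for s
  have [measurable]: "f \<in> borel_measurable borel" unfolding f_def by measurable
  have f0: "0 \<le> f s" if "s \<in> {1/2..1}" for s using that dpos unfolding f_def by (intro zero_le_power) simp
  have third: "1 / (x / 3) ^ Suc (Suc b) = 3 ^ Suc (Suc b) * inverse x ^ Suc (Suc b)" for x :: real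
    unfolding power_divide power_inverse
    by (simp only: divide_divide_eq_right mult_1_left) (simp only: divide_inverse)
  have pt: "ennreal (1 / cmod (1 - of_real s * u) ^ Suc (Suc b)) * indicator {1/2..1} s \<le> ennreal (3 ^ Suc (Suc b)) * (ennreal (f s) * indicator {1/2..1} s)" for s
  proof (cases "s \<in> {1/2..1}")
    case True
    then have pos: "0 < (1 - s + \<delta>) / 3" using dpos by simp
    have low: "(1 - s + \<delta>) / 3 \<le> cmod (1 - of_real s * u)"
      unfolding \<delta>_def by (rule radial_kernel_lower[OF u]) (use True in auto)
    have p2: "0 < cmod (1 - of_real s * u)" using pos low by linarith
    have "1 / cmod (1 - of_real s * u) ^ Suc (Suc b) \<le> 1 / ((1 - s + \<delta>) / 3) ^ Suc (Suc b)"
      by (rule divide_left_mono[OF power_mono[OF low less_imp_le[OF pos]] zero_le_one mult_pos_pos[OF zero_less_power[OF p2] zero_less_power[OF pos]]])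
    also have "\<dots> = 3 ^ Suc (Suc b) * f s" unfolding f_def by (rule third)
    finally have "ennreal (1 / cmod (1 - of_real s * u) ^ Suc (Suc b)) \<le> ennreal (3 ^ Suc (Suc b) * f s)" by (rule ennreal_leI)
    also have "\<dots> = ennreal (3 ^ Suc (Suc b)) * ennreal (f s)" by (rule ennreal_mult') simp
    finally show ?thesis using True by (simp only: indicator_simps mult_1_right)
  qed simp
  have "(\<integral>\<^sup>+s. ennreal (f s) * indicator {1/2..1} s \<partial>lborel) = ennreal (F 1 - F (1/2))"
  proof (rule nn_integral_FTC_Icc)
    fix s :: real assume s: "s \<in> {1/2..1}"
    then have "1 - s + \<delta> \<noteq> 0" using dpos by simp
    then have "((\<lambda>s. inverse (1 - s + \<delta>)) has_real_derivative inverse (1 - s + \<delta>) ^ 2) (at s)"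
      by (auto intro!: derivative_eq_intros simp: power2_eq_square)
    from DERIV_cdivide[OF DERIV_power[OF this, of "Suc b"], of "real (Suc b)"]
    have "(F has_real_derivative (real (Suc b) * ((inverse (1 - s + \<delta>))\<^sup>2 * inverse (1 - s + \<delta>) ^ (Suc b - Suc 0)) / real (Suc b))) (at s)"
      unfolding F_def .
    moreover have "real (Suc b) * ((inverse (1 - s + \<delta>))\<^sup>2 * inverse (1 - s + \<delta>) ^ (Suc b - Suc 0)) / real (Suc b) = f s"
      unfolding f_def power2_eq_square by (subst nonzero_mult_div_cancel_left) simp_all
    ultimately show "(F has_real_derivative f s) (at s)" by (simp only:)
    show "0 \<le> f s" by (rule f0[OF s])
  qed simp_all
  moreover have "F 1 - F (1/2) \<le> 1 / \<delta> ^ Suc b"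
  proof -
    have "0 \<le> F (1/2)" unfolding F_def using dpos by (intro divide_nonneg_nonneg zero_le_power) simp_all
    moreover have "F 1 \<le> inverse \<delta> ^ Suc b / 1"
      unfolding F_def using dpos by (simp only: diff_self add_0) (intro divide_left_mono zero_le_power, simp_all)
    moreover have "inverse \<delta> ^ Suc b / 1 = 1 / \<delta> ^ Suc b"
      unfolding power_inverse by (simp only: divide_inverse inverse_1 mult_1_left mult_1_right)
    ultimately show ?thesis by linarith
  qed
  ultimately have I: "(\<integral>\<^sup>+s. ennreal (f s) * indicator {1/2..1} s \<partial>lborel) \<le> ennreal (1 / \<delta> ^ Suc b)"
    by (simp only: ennreal_leI)
  have "(\<integral>\<^sup>+s\<in>{1/2..1}. ennreal (1 / cmod (1 - of_real s * u) ^ Suc (Suc b)) \<partial>lborel) \<le>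
      (\<integral>\<^sup>+s. ennreal (3 ^ Suc (Suc b)) * (ennreal (f s) * indicator {1/2..1} s) \<partial>lborel)"
    by (rule nn_integral_mono) (rule pt)
  also have "\<dots> = ennreal (3 ^ Suc (Suc b)) * (\<integral>\<^sup>+s. ennreal (f s) * indicator {1/2..1} s \<partial>lborel)"
    by (rule nn_integral_cmult) measurable
  also have "\<dots> \<le> ennreal (3 ^ Suc (Suc b)) * ennreal (1 / \<delta> ^ Suc b)"
    by (rule mult_left_mono[OF I]) simp
  finally show ?thesis by (simp only: \<delta>_def)
qed

lemma kernel_integral_cmult:
  assumes g: "line_holomorphic g" and c: "c \<ge> 0"
    and le: "\<And>w. norm w < 1 \<Longrightarrow> F w \<le> ennreal c * ennreal ((1 - (norm w)\<^sup>2) ^ N / cmod (1 - cinner z w) ^ b)"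
  shows "(\<integral>\<^sup>+w. ennreal (cmod (ball_ext g w)) * F w \<partial>lborel) \<le> ennreal c * kernel_integral N b g z"
proof -
  have [measurable]: "ball_ext g \<in> borel_measurable borel" by (rule ball_ext_measurable[OF g])
  have "(\<integral>\<^sup>+w. ennreal (cmod (ball_ext g w)) * F w \<partial>lborel)
     \<le> (\<integral>\<^sup>+w. ennreal c * ennreal (cmod (ball_ext g w) * (1 - (norm w)\<^sup>2) ^ N / cmod (1 - cinner z w) ^ b) \<partial>lborel)"
  proof (rule nn_integral_mono)
    fix w
    show "ennreal (cmod (ball_ext g w)) * F w \<le> ennreal c * ennreal (cmod (ball_ext g w) * (1 - (norm w)\<^sup>2) ^ N / cmod (1 - cinner z w) ^ b)"
    proof (cases "norm w < 1")
      case True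
      have "ennreal (cmod (ball_ext g w)) * F w \<le> ennreal (cmod (ball_ext g w)) * (ennreal c * ennreal ((1 - (norm w)\<^sup>2) ^ N / cmod (1 - cinner z w) ^ b))"
        by (rule mult_left_mono[OF le[OF True]]) simp
      also have "\<dots> = ennreal c * ennreal (cmod (ball_ext g w) * ((1 - (norm w)\<^sup>2) ^ N / cmod (1 - cinner z w) ^ b))"
        by (simp only: ennreal_mult'[OF norm_ge_zero] mult.left_commute)
      finally show ?thesis by simp
    qed (simp add: ball_ext_out)
  qed
  also have "\<dots> = ennreal c * kernel_integral N b g z"
    unfolding kernel_integral_def by (rule nn_integral_cmult) measurable
  finally show ?thesis .
qed

lemma kernel_integral_factor:
  "kernel_integral N b g z = (\<integral>\<^sup>+w. ennreal (cmod (ball_ext g w)) * ennreal ((1 - (norm w)\<^sup>2) ^ N / cmod (1 - cinner z w) ^ b) \<partial>lborel)"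
  unfolding kernel_integral_def by (simp only: ennreal_mult'[OF norm_ge_zero, symmetric] times_divide_eq_right)

text \<open>A kernel bound for $(a+R)h$ is transferred to $h$ itself by the radial equation and Tonelli's theorem. The supremum
  over the ball of radius 3/4 that appears there does no harm: on that ball the kernel is bounded, and on
  the whole ball it is bounded below because $|1-\langle z,w\rangle| < 2$.\<close>

lemma kernel_step:
  fixes a :: real
  assumes a: "\<And>k::nat. real k + a \<noteq> 0" and C: "C > 0"
  shows "\<exists>C'>0. \<forall>(f :: complex ^ 'n::finite \<Rightarrow> complex) g c z. line_holomorphic f \<longrightarrow> line_holomorphic g \<longrightarrow> subexponential c \<longrightarrow>
    (\<forall>w. norm w < 1 \<longrightarrow> ennreal (cmod (multiplier (\<lambda>k. of_real (real k + a) * c k) f w)) \<le> ennreal C * kernel_integral N (Suc (Suc b)) g w) \<longrightarrow>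
    norm z < 1 \<longrightarrow> ennreal (cmod (multiplier c f z)) \<le> ennreal C' * kernel_integral N (Suc b) g z"
proof -
  obtain A where A: "A > 0" "\<forall>(f :: complex ^ 'n \<Rightarrow> complex) c z M. line_holomorphic f \<longrightarrow> subexponential c \<longrightarrow> norm z < 1 \<longrightarrow>
    (\<forall>w. norm w \<le> 3/4 \<longrightarrow> cmod (multiplier (\<lambda>k. of_real (real k + a) * c k) f w) \<le> M) \<longrightarrow>
    ennreal (cmod (multiplier c f z)) \<le> ennreal A * (ennreal M +
      (\<integral>\<^sup>+s\<in>{1/2..1}. ennreal (cmod (multiplier (\<lambda>k. of_real (real k + a) * c k) f (of_real s *s z))) \<partial>lborel))"
    using radial_ode_bound[OF a, where ?'n = 'n] by (elim exE conjE)
  let ?K1 = "C * 4 ^ Suc (Suc b)" and ?K2 = "C * 3 ^ Suc (Suc b)"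
  define C' where "C' = A * (?K1 * 2 ^ Suc b + ?K2)"
  have C': "C' > 0" using A(1) C by (simp add: C'_def add_pos_pos)
  have "ennreal (cmod (multiplier c f z)) \<le> ennreal C' * kernel_integral N (Suc b) g z"
    if f: "line_holomorphic f" and g: "line_holomorphic g" and c: "subexponential c"
      and h: "\<forall>w. norm w < 1 \<longrightarrow> ennreal (cmod (multiplier (\<lambda>k. of_real (real k + a) * c k) f w)) \<le> ennreal C * kernel_integral N (Suc (Suc b)) g w"
      and z: "norm z < 1" for f g :: "complex ^ 'n \<Rightarrow> complex" and c z
  proof -
    have [measurable]: "ball_ext g \<in> borel_measurable borel" by (rule ball_ext_measurable[OF g])
    define h' where "h' = multiplier (\<lambda>k. of_real (real k + a) * c k) f"
    have h: "ennreal (cmod (h' w)) \<le> ennreal C * kernel_integral N (Suc (Suc b)) g w" if "norm w < 1" for w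
      using h that by (simp add: h'_def)
    \<comment> \<open>up to constants J bounds the kernel integral on the ball of radius 3/4 from above, and every kernel integral from below\<close>
    define J where "J = (\<integral>\<^sup>+w. ennreal (cmod (ball_ext g w)) * ennreal ((1 - (norm w)\<^sup>2) ^ N) \<partial>lborel)"
    let ?K = "kernel_integral N (Suc b) g z"
    have w0: "0 \<le> (1 - (norm w)\<^sup>2) ^ N" if "norm w < 1" for w :: "complex ^ 'n"
      using that by (intro zero_le_power) (simp add: power_le_one)
    have JK: "J \<le> ennreal (2 ^ Suc b) * ?K"
      unfolding J_def
    proof (rule kernel_integral_cmult[OF g])
      fix w :: "complex ^ 'n" assume w: "norm w < 1"
      have p: "0 < cmod (1 - cinner z w)" using z w by (intro kernel_pos) auto
      have "cmod (1 - cinner z w) ^ Suc b \<le> 2 ^ Suc b" using kernel_le_2[of z w] z w by (intro power_mono) auto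
      then have "1 \<le> 2 ^ Suc b / cmod (1 - cinner z w) ^ Suc b" using p by (simp del: power_Suc)
      from mult_left_mono[OF this w0[OF w]]
      have "(1 - (norm w)\<^sup>2) ^ N \<le> 2 ^ Suc b * ((1 - (norm w)\<^sup>2) ^ N / cmod (1 - cinner z w) ^ Suc b)" by (simp add: mult_ac del: power_Suc)
      from ennreal_leI[OF this] show "ennreal ((1 - (norm w)\<^sup>2) ^ N) \<le> ennreal (2 ^ Suc b) * ennreal ((1 - (norm w)\<^sup>2) ^ N / cmod (1 - cinner z w) ^ Suc b)"
        by (simp add: ennreal_mult'[symmetric] del: power_Suc)
    qed simp
    have KJ: "kernel_integral N (Suc (Suc b)) g w \<le> ennreal (4 ^ Suc (Suc b)) * J" if w: "norm w \<le> 3/4" for w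
    proof -
      have "kernel_integral N (Suc (Suc b)) g w \<le> (\<integral>\<^sup>+v. ennreal (4 ^ Suc (Suc b)) * (ennreal (cmod (ball_ext g v)) * ennreal ((1 - (norm v)\<^sup>2) ^ N)) \<partial>lborel)"
        unfolding kernel_integral_factor
      proof (rule nn_integral_mono)
        fix v :: "complex ^ 'n"
        show "ennreal (cmod (ball_ext g v)) * ennreal ((1 - (norm v)\<^sup>2) ^ N / cmod (1 - cinner w v) ^ Suc (Suc b)) \<le> ennreal (4 ^ Suc (Suc b)) * (ennreal (cmod (ball_ext g v)) * ennreal ((1 - (norm v)\<^sup>2) ^ N))"
        proof (cases "norm v < 1")
          case True
          have "1/4 \<le> cmod (1 - cinner w v)" using norm_le_kernel[of v w] True w by simp
          then have "(1/4) ^ Suc (Suc b) \<le> cmod (1 - cinner w v) ^ Suc (Suc b)" by (intro power_mono) auto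
          then have "(1 - (norm v)\<^sup>2) ^ N / cmod (1 - cinner w v) ^ Suc (Suc b) \<le> (1 - (norm v)\<^sup>2) ^ N / (1/4) ^ Suc (Suc b)"
          proof (rule divide_left_mono[OF _ w0[OF True] mult_pos_pos])
            have "0 < cmod (1 - cinner w v)" using \<open>1/4 \<le> cmod (1 - cinner w v)\<close> by linarith
            then show "0 < cmod (1 - cinner w v) ^ Suc (Suc b)" by (rule zero_less_power)
            show "(0::real) < (1/4) ^ Suc (Suc b)" by (rule zero_less_power) simp
          qed
          also have "\<dots> = 4 ^ Suc (Suc b) * (1 - (norm v)\<^sup>2) ^ N" by (simp only: power_divide) simp
          finally have "ennreal ((1 - (norm v)\<^sup>2) ^ N / cmod (1 - cinner w v) ^ Suc (Suc b)) \<le> ennreal (4 ^ Suc (Suc b)) * ennreal ((1 - (norm v)\<^sup>2) ^ N)"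
            by (subst ennreal_mult'[symmetric]) (simp_all only: ennreal_leI zero_le_power zero_le_numeral)
          from mult_left_mono[OF this, of "ennreal (cmod (ball_ext g v))"] show ?thesis by (simp only: mult.left_commute) simp
        qed (simp add: ball_ext_out)
      qed
      also have "\<dots> = ennreal (4 ^ Suc (Suc b)) * J" unfolding J_def by (rule nn_integral_cmult) measurable
      finally show ?thesis .
    qed
    show ?thesis
    proof (cases "J = \<infinity>")
      case True
      then have "ennreal (2 ^ Suc b) * ?K = \<infinity>" using JK by (simp add: top_unique)
      then have "?K = \<infinity>" by (simp add: ennreal_mult_eq_top_iff)
      then show ?thesis using C' by (simp add: ennreal_mult_top)
    next
      case False
      then obtain j where j: "j \<ge> 0" "J = ennreal j" by (cases J) auto
      define M where "M = ?K1 * j"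
      have hM: "cmod (h' w) \<le> M" if "norm w \<le> 3/4" for w
      proof -
        have "ennreal (cmod (h' w)) \<le> ennreal C * kernel_integral N (Suc (Suc b)) g w" by (rule h) (use that in simp)
        also have "\<dots> \<le> ennreal C * (ennreal (4 ^ Suc (Suc b)) * J)" by (rule mult_left_mono[OF KJ[OF that]]) simp
        also have "\<dots> = ennreal M"
          unfolding j(2) M_def using C j(1) by (simp add: ennreal_mult'[symmetric] mult.assoc del: power_Suc)
        finally show ?thesis using C j(1) by (simp add: ennreal_le_iff M_def del: power_Suc)
      qed
      have MK: "ennreal M \<le> ennreal (?K1 * 2 ^ Suc b) * ?K"
      proof -
        have "ennreal M = ennreal ?K1 * J" unfolding j(2) M_def using C by (simp add: ennreal_mult'[symmetric] del: power_Suc)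
        also have "\<dots> \<le> ennreal ?K1 * (ennreal (2 ^ Suc b) * ?K)" by (rule mult_left_mono[OF JK]) simp
        also have "\<dots> = ennreal (?K1 * 2 ^ Suc b) * ?K" using C by (simp add: ennreal_mult'[symmetric] mult.assoc[symmetric] del: power_Suc)
        finally show ?thesis .
      qed
      let ?F = "\<lambda>s w. ennreal (cmod (ball_ext g w)) * ennreal ((1 - (norm w)\<^sup>2) ^ N / cmod (1 - of_real s * cinner z w) ^ Suc (Suc b))"
      have "(\<integral>\<^sup>+s\<in>{1/2..1}. ennreal (cmod (h' (of_real s *s z))) \<partial>lborel)
          \<le> (\<integral>\<^sup>+s. ennreal C * (\<integral>\<^sup>+w. ?F s w * indicator {1/2..1} s \<partial>lborel) \<partial>lborel)"
      proof (rule nn_integral_mono)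
        fix s :: real
        show "ennreal (cmod (h' (of_real s *s z))) * indicator {1/2..1} s \<le> ennreal C * (\<integral>\<^sup>+w. ?F s w * indicator {1/2..1} s \<partial>lborel)"
        proof (cases "s \<in> {1/2..1}")
          case True
          have "s * norm z \<le> 1 * norm z" using True by (intro mult_right_mono) auto
          then have "norm (of_real s *s z) < 1" using True z by (simp add: norm_vector_smult)
          from h[OF this] show ?thesis using True
            unfolding kernel_integral_factor cinner_scale_left by (simp only: indicator_simps mult_1_right)
        qed simp
      qed
      also have "\<dots> = ennreal C * (\<integral>\<^sup>+s. \<integral>\<^sup>+w. ?F s w * indicator {1/2..1} s \<partial>lborel \<partial>lborel)"
        by (rule nn_integral_cmult) measurable
      also have "(\<integral>\<^sup>+s. \<integral>\<^sup>+w. ?F s w * indicator {1/2..1} s \<partial>lborel \<partial>lborel) = (\<integral>\<^sup>+w. \<integral>\<^sup>+s. ?F s w * indicator {1/2..1} s \<partial>lborel \<partial>lborel)"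
        by (rule lborel_pair.Fubini') measurable
      also have "\<dots> = (\<integral>\<^sup>+w. ennreal (cmod (ball_ext g w)) * (ennreal ((1 - (norm w)\<^sup>2) ^ N) * (\<integral>\<^sup>+s\<in>{1/2..1}. ennreal (1 / cmod (1 - of_real s * cinner z w) ^ Suc (Suc b)) \<partial>lborel)) \<partial>lborel)"
      proof (rule nn_integral_cong)
        fix w :: "complex ^ 'n"
        show "(\<integral>\<^sup>+s. ?F s w * indicator {1/2..1} s \<partial>lborel) = ennreal (cmod (ball_ext g w)) * (ennreal ((1 - (norm w)\<^sup>2) ^ N) * (\<integral>\<^sup>+s\<in>{1/2..1}. ennreal (1 / cmod (1 - of_real s * cinner z w) ^ Suc (Suc b)) \<partial>lborel))"
        proof (cases "norm w < 1")
          case True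
          have "?F s w * indicator {1/2..1} s = ennreal (cmod (ball_ext g w) * (1 - (norm w)\<^sup>2) ^ N) * (ennreal (1 / cmod (1 - of_real s * cinner z w) ^ Suc (Suc b)) * indicator {1/2..1} s)" for s
            using w0[OF True] by (simp only: ennreal_mult'[symmetric] mult.assoc[symmetric] mult_nonneg_nonneg norm_ge_zero) (simp add: ennreal_mult'[symmetric] del: power_Suc)
          then have "(\<integral>\<^sup>+s. ?F s w * indicator {1/2..1} s \<partial>lborel) = ennreal (cmod (ball_ext g w) * (1 - (norm w)\<^sup>2) ^ N) * (\<integral>\<^sup>+s\<in>{1/2..1}. ennreal (1 / cmod (1 - of_real s * cinner z w) ^ Suc (Suc b)) \<partial>lborel)"
            by (simp only:) (rule nn_integral_cmult, measurable)
          then show ?thesis by (simp only: ennreal_mult'[OF norm_ge_zero] mult.assoc)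
        qed (simp add: ball_ext_out)
      qed
      also have "\<dots> \<le> ennreal (3 ^ Suc (Suc b)) * ?K"
      proof (rule kernel_integral_cmult[OF g])
        fix w :: "complex ^ 'n" assume w: "norm w < 1"
        have p: "cinner z w \<noteq> 1" using kernel_pos[of z w] z w by auto
        have l: "cmod (cinner z w) < 1" by (rule cmod_cinner_less[OF z w])
        have "ennreal ((1 - (norm w)\<^sup>2) ^ N) * (\<integral>\<^sup>+s\<in>{1/2..1}. ennreal (1 / cmod (1 - of_real s * cinner z w) ^ Suc (Suc b)) \<partial>lborel)
          \<le> ennreal ((1 - (norm w)\<^sup>2) ^ N) * (ennreal (3 ^ Suc (Suc b)) * ennreal (1 / cmod (1 - cinner z w) ^ Suc b))"
          by (rule mult_left_mono[OF radial_kernel_integral[OF l p]]) simp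
        also have "\<dots> = ennreal (3 ^ Suc (Suc b)) * ennreal ((1 - (norm w)\<^sup>2) ^ N * (1 / cmod (1 - cinner z w) ^ Suc b))"
          by (simp only: ennreal_mult'[OF w0[OF w]] mult.left_commute)
        finally show "ennreal ((1 - (norm w)\<^sup>2) ^ N) * (\<integral>\<^sup>+s\<in>{1/2..1}. ennreal (1 / cmod (1 - of_real s * cinner z w) ^ Suc (Suc b)) \<partial>lborel)
          \<le> ennreal (3 ^ Suc (Suc b)) * ennreal ((1 - (norm w)\<^sup>2) ^ N / cmod (1 - cinner z w) ^ Suc b)" by (simp only: times_divide_eq_right mult_1_right)
      qed simp
      finally have int: "(\<integral>\<^sup>+s\<in>{1/2..1}. ennreal (cmod (h' (of_real s *s z))) \<partial>lborel) \<le> ennreal C * (ennreal (3 ^ Suc (Suc b)) * ?K)"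
        by (simp add: mult_left_mono del: power_Suc)
      have "ennreal (cmod (multiplier c f z)) \<le> ennreal A * (ennreal M + (\<integral>\<^sup>+s\<in>{1/2..1}. ennreal (cmod (h' (of_real s *s z))) \<partial>lborel))"
        unfolding h'_def by (rule A(2)[rule_format, OF f c z]) (use hM in \<open>simp add: h'_def\<close>)
      also have "\<dots> \<le> ennreal A * (ennreal (?K1 * 2 ^ Suc b) * ?K + ennreal C * (ennreal (3 ^ Suc (Suc b)) * ?K))"
        by (intro mult_left_mono add_mono MK int) simp
      also have "\<dots> = ennreal C' * ?K"
        using A(1) C by (simp add: C'_def distrib_left distrib_right ennreal_mult' ennreal_plus mult.assoc del: power_Suc)
      finally show ?thesis .
    qed
  qed
  then show ?thesis using C' by blast
qed

text \<open>The eigenvalue on homogeneous polynomials of degree $k$ of the product of the operators $a+j+R$ over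
  $i \le j < m$. The parameter $i$ serves to remove the factors one at a time.\<close>

definition shifted_product :: "real \<Rightarrow> nat \<Rightarrow> nat \<Rightarrow> nat \<Rightarrow> complex" where
  "shifted_product a i m k = (\<Prod>j\<in>{i..<m}. of_real (real k + (a + real j)))"

lemma subexponential_shifted_product: "subexponential (shifted_product a i m)"
proof (induction m)
  case 0
  show ?case using subexponential_one by (simp add: shifted_product_def[abs_def])
next
  case (Suc m)
  show ?case
  proof (cases "i \<le> m")
    case True
    have "shifted_product a i (Suc m) = (\<lambda>k. of_real (real k + (a + real m)) * shifted_product a i m k)"
      using True by (simp add: shifted_product_def fun_eq_iff mult.commute)
    then show ?thesis using subexponential_shift[OF Suc.IH, of "a + real m"] by (simp only:)
  next
    case False
    then show ?thesis using subexponential_one by (simp add: shifted_product_def[abs_def])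
  qed
qed

text \<open>Peeling off the $m$ first-order factors one after the other, each of which lowers the exponent of the kernel
  by one. This replaces the reproducing formula that expresses $f$ through its fractional radial derivative;
  the requirement $m \le N$ keeps the exponents positive in every step.\<close>

theorem radial_representation_bound:
  fixes a :: real
  assumes a: "\<And>k::nat. real k + a \<noteq> 0" and N: "m \<le> N"
  shows "\<exists>C>0. \<forall>(f :: complex ^ 'n::finite \<Rightarrow> complex) z. line_holomorphic f \<longrightarrow> norm z < 1 \<longrightarrow>
     ennreal (cmod (f z)) \<le> ennreal C * kernel_integral N (CARD('n) + 1 + N - m) (multiplier (shifted_product a 0 m) f) z"
proof -
  have "\<exists>C>0. \<forall>(f :: complex ^ 'n::finite \<Rightarrow> complex) z. line_holomorphic f \<longrightarrow> norm z < 1 \<longrightarrow>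
     ennreal (cmod (multiplier (shifted_product a i m) f z)) \<le> ennreal C * kernel_integral N (CARD('n) + 1 + N - i) (multiplier (shifted_product a 0 m) f) z"
    if "i \<le> m" for i
    using that
  proof (induction i)
    case 0
    obtain C where C: "C > 0" "\<forall>(g :: complex ^ 'n \<Rightarrow> complex) z. line_holomorphic g \<longrightarrow> norm z < 1 \<longrightarrow>
       ennreal (cmod (g z)) \<le> ennreal C * kernel_integral N (CARD('n) + 1 + N) g z"
      using pointwise_kernel_bound[where ?'n = 'n and N = N] by (elim exE conjE)
    have "line_holomorphic (multiplier (shifted_product a 0 m) f)" if "line_holomorphic f" for f :: "complex ^ 'n \<Rightarrow> complex"
      by (rule line_holomorphic_multiplier[OF that subexponential_shifted_product])
    then show ?case using C by (intro exI[of _ C]) simp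
  next
    case (Suc i)
    then obtain C where C: "C > 0" "\<forall>(f :: complex ^ 'n \<Rightarrow> complex) z. line_holomorphic f \<longrightarrow> norm z < 1 \<longrightarrow>
       ennreal (cmod (multiplier (shifted_product a i m) f z)) \<le> ennreal C * kernel_integral N (CARD('n) + 1 + N - i) (multiplier (shifted_product a 0 m) f) z"
      using Suc_leD by blast
    define b where "b = CARD('n) + N - Suc i"
    have b: "CARD('n) + 1 + N - Suc i = Suc b" "CARD('n) + 1 + N - i = Suc (Suc b)"
      using Suc.prems N by (auto simp: b_def)
    have ai: "real k + (a + real i) \<noteq> 0" for k using a[of "k + i"] by (simp add: algebra_simps)
    have split: "shifted_product a i m = (\<lambda>k. of_real (real k + (a + real i)) * shifted_product a (Suc i) m k)"
      using Suc.prems by (simp add: shifted_product_def fun_eq_iff prod.atLeast_Suc_lessThan)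
    obtain C' where C': "C' > 0" "\<forall>(f :: complex ^ 'n \<Rightarrow> complex) g c z. line_holomorphic f \<longrightarrow> line_holomorphic g \<longrightarrow> subexponential c \<longrightarrow>
      (\<forall>w. norm w < 1 \<longrightarrow> ennreal (cmod (multiplier (\<lambda>k. of_real (real k + (a + real i)) * c k) f w)) \<le> ennreal C * kernel_integral N (Suc (Suc b)) g w) \<longrightarrow>
      norm z < 1 \<longrightarrow> ennreal (cmod (multiplier c f z)) \<le> ennreal C' * kernel_integral N (Suc b) g z"
      using kernel_step[OF ai C(1), where ?'n = 'n and b = b and N = N] by (elim exE conjE)
    show ?case
      unfolding b(1)
    proof (intro exI[of _ C'] conjI allI impI C'(1))
      fix f :: "complex ^ 'n \<Rightarrow> complex" and z :: "complex ^ 'n" assume f: "line_holomorphic f" and z: "norm z < 1"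
      show "ennreal (cmod (multiplier (shifted_product a (Suc i) m) f z)) \<le> ennreal C' * kernel_integral N (Suc b) (multiplier (shifted_product a 0 m) f) z"
      proof (rule C'(2)[rule_format, OF f line_holomorphic_multiplier[OF f subexponential_shifted_product] subexponential_shifted_product _ z])
        fix w :: "complex ^ 'n" assume "norm w < 1"
        from C(2)[rule_format, OF f this]
        show "ennreal (cmod (multiplier (\<lambda>k. of_real (real k + (a + real i)) * shifted_product a (Suc i) m k) f w)) \<le> ennreal C * kernel_integral N (Suc (Suc b)) (multiplier (shifted_product a 0 m) f) w"
          unfolding split[symmetric] b(2) .
      qed
    qed
  qed
  from this[OF order_refl] show ?thesis
  proof (elim exE conjE, intro exI conjI allI impI)
    fix C and f :: "complex ^ 'n \<Rightarrow> complex" and z :: "complex ^ 'n"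
    assume C: "0 < C" "\<forall>(f :: complex ^ 'n \<Rightarrow> complex) z. line_holomorphic f \<longrightarrow> norm z < 1 \<longrightarrow>
     ennreal (cmod (multiplier (shifted_product a m m) f z)) \<le> ennreal C * kernel_integral N (CARD('n) + 1 + N - m) (multiplier (shifted_product a 0 m) f) z"
      and f: "line_holomorphic f" and z: "norm z < 1"
    have "multiplier (shifted_product a m m) f z = f z"
      using sums_unique[OF hom_part_sums[OF f, of 1 z]] z by (simp add: multiplier_def shifted_product_def)
    then show "ennreal (cmod (f z)) \<le> ennreal C * kernel_integral N (CARD('n) + 1 + N - m) (multiplier (shifted_product a 0 m) f) z"
      using C(2)[rule_format, OF f z] by simp
  qed
qed

section \<open>The Besov norm\<close>

lemma not_nonpos_Int_shift:
  fixes a :: real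
  assumes "a \<notin> \<int>\<^sub>\<le>\<^sub>0"
  shows "real k + a \<notin> \<int>\<^sub>\<le>\<^sub>0"
proof
  assume "real k + a \<in> \<int>\<^sub>\<le>\<^sub>0"
  then obtain i where "real k + a = - of_nat i" by (rule nonpos_Ints_cases')
  then have "a = - of_nat (i + k)" by simp
  then show False using assms by (metis minus_of_nat_in_nonpos_Ints)
qed

text \<open>For an integer order the quotient of Gamma functions is a quotient of Pochhammer symbols, that is, a
  polynomial in $k$ that splits into linear factors.\<close>

lemma radial_deriv_eq_multiplier:
  fixes f :: "complex ^ 'n::finite \<Rightarrow> complex"
  assumes f: "line_holomorphic f" and a: "real CARD('n) + 1 + \<alpha> \<notin> \<int>\<^sub>\<le>\<^sub>0" and z: "norm z < 1"
  shows "radial_deriv \<alpha> (real m) f z = of_real (1 / pochhammer (real CARD('n) + 1 + \<alpha>) m) * multiplier (shifted_product (real CARD('n) + 1 + \<alpha>) 0 m) f z"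
proof -
  let ?a = "real CARD('n) + 1 + \<alpha>"
  have coef: "Gamma ?a * Gamma (real CARD('n) + 1 + real k + \<alpha> + real m) / (Gamma (?a + real m) * Gamma (real CARD('n) + 1 + real k + \<alpha>))
      = 1 / pochhammer ?a m * pochhammer (real k + ?a) m" for k
  proof -
    have 1: "pochhammer ?a m = Gamma (?a + real m) / Gamma ?a" by (rule pochhammer_Gamma[OF a])
    have 2: "pochhammer (real k + ?a) m = Gamma (real k + ?a + real m) / Gamma (real k + ?a)"
      by (rule pochhammer_Gamma[OF not_nonpos_Int_shift[OF a]])
    have 3: "real CARD('n) + 1 + real k + \<alpha> = real k + ?a" by simp
    show ?thesis unfolding 1 2 3 by simp
  qed
  have sp: "complex_of_real (pochhammer (real k + ?a) m) = shifted_product ?a 0 m k" for k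
    by (simp add: pochhammer_prod shifted_product_def add.assoc)
  have "(\<lambda>k. shifted_product ?a 0 m k * hom_part f k z) sums multiplier (shifted_product ?a 0 m) f z"
    using multiplier_sums[OF f subexponential_shifted_product, of 1 z] z by simp
  from sums_mult[OF this, of "of_real (1 / pochhammer ?a m)"]
  have "(\<lambda>k. of_real (1 / pochhammer ?a m) * (shifted_product ?a 0 m k * hom_part f k z)) sums (of_real (1 / pochhammer ?a m) * multiplier (shifted_product ?a 0 m) f z)" .
  from sums_unique[OF this] show ?thesis
    unfolding radial_deriv_def Let_def homogeneous_expansion_eq_hom_part[OF f] coef of_real_mult sp mult.assoc by (rule sym)
qed

lemma pochhammer_nonzero:
  fixes a :: real
  assumes "a \<notin> \<int>\<^sub>\<le>\<^sub>0" shows "pochhammer a m \<noteq> 0"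
  using assms by (metis minus_of_nat_in_nonpos_Ints pochhammer_eq_0_iff)

lemma nn_integral_ball_volume:
  fixes F :: "complex ^ 'n::finite \<Rightarrow> ennreal"
  assumes "(\<lambda>z. F z * indicator unit_ball z) \<in> borel_measurable borel"
  shows "(\<integral>\<^sup>+z. F z \<partial>ball_volume) = (\<integral>\<^sup>+z. F z * indicator unit_ball z \<partial>lborel) / emeasure lborel (unit_ball :: (complex ^ 'n) set)"
proof -
  have "(\<integral>\<^sup>+z. F z \<partial>ball_volume) = (\<integral>\<^sup>+z. F z * indicator unit_ball z \<partial>uniform_measure lborel unit_ball)"
    unfolding ball_volume_def by (rule nn_integral_restrict_space) simp
  also have "\<dots> = (\<integral>\<^sup>+z. F z * indicator unit_ball z * indicator unit_ball z \<partial>lborel) / emeasure lborel (unit_ball :: (complex ^ 'n) set)"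
    by (rule nn_integral_uniform_measure) (use assms in simp_all)
  also have "(\<integral>\<^sup>+z. F z * indicator unit_ball z * indicator unit_ball z \<partial>lborel) = (\<integral>\<^sup>+z. F z * indicator unit_ball z \<partial>lborel)"
    by (intro nn_integral_cong) (simp add: indicator_def)
  finally show ?thesis .
qed

text \<open>The $p$-th power of the norm of a weighted Lebesgue space, with respect to unnormalised Lebesgue measure.\<close>

definition weighted_norm :: "real \<Rightarrow> real \<Rightarrow> (complex ^ 'n::finite \<Rightarrow> complex) \<Rightarrow> ennreal" where
  "weighted_norm p t h = (\<integral>\<^sup>+w. ennreal (cmod (ball_ext h w) powr p * (1 - (norm w)\<^sup>2) powr t) \<partial>lborel)"

lemma besov_norm_pow_eq:
  fixes f :: "complex ^ 'n::finite \<Rightarrow> complex"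
  assumes f: "line_holomorphic f" and a: "real CARD('n) + 1 + \<alpha> \<notin> \<int>\<^sub>\<le>\<^sub>0" and p: "p > 0"
  shows "besov_norm_pow m \<alpha> p \<sigma> f = ennreal (\<bar>1 / pochhammer (real CARD('n) + 1 + \<alpha>) m\<bar> powr p / measure lborel (unit_ball :: (complex ^ 'n) set))
     * weighted_norm p (m * p + \<sigma> * p - real CARD('n) - 1) (multiplier (shifted_product (real CARD('n) + 1 + \<alpha>) 0 m) f)"
proof -
  let ?a = "real CARD('n) + 1 + \<alpha>"
  let ?h = "multiplier (shifted_product ?a 0 m) f"
  let ?t = "m * p + \<sigma> * p - real CARD('n) - 1"
  let ?c = "\<bar>1 / pochhammer ?a m\<bar>"
  let ?V = "measure lborel (unit_ball :: (complex ^ 'n) set)"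
  have V: "?V > 0" by (simp add: content_ball_pos)
  have hl: "line_holomorphic ?h" by (rule line_holomorphic_multiplier[OF f subexponential_shifted_product])
  have [measurable]: "ball_ext ?h \<in> borel_measurable borel" by (rule ball_ext_measurable[OF hl])
  have pt: "ennreal (cmod (radial_deriv \<alpha> (real m) f z) powr p * (1 - (norm z)\<^sup>2) powr ?t) * indicator unit_ball z
     = ennreal (?c powr p) * ennreal (cmod (ball_ext ?h z) powr p * (1 - (norm z)\<^sup>2) powr ?t)" for z
  proof (cases "norm z < 1")
    case True
    have "cmod (radial_deriv \<alpha> (real m) f z) = ?c * cmod (ball_ext ?h z)"
      unfolding radial_deriv_eq_multiplier[OF f a True] ball_ext_in[OF True] norm_mult norm_of_real ..
    then have "cmod (radial_deriv \<alpha> (real m) f z) powr p * (1 - (norm z)\<^sup>2) powr ?t = ?c powr p * (cmod (ball_ext ?h z) powr p * (1 - (norm z)\<^sup>2) powr ?t)"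
      by (simp only: powr_mult abs_ge_zero norm_ge_zero mult.assoc)
    then show ?thesis using True by (simp only: ennreal_mult'[OF powr_ge_zero] mem_ball_0 indicator_simps mult_1_right)
  qed (use p in \<open>simp add: ball_ext_out\<close>)
  have "besov_norm_pow m \<alpha> p \<sigma> f = (\<integral>\<^sup>+z. ennreal (?c powr p) * ennreal (cmod (ball_ext ?h z) powr p * (1 - (norm z)\<^sup>2) powr ?t) \<partial>lborel) / emeasure lborel (unit_ball :: (complex ^ 'n) set)"
    unfolding besov_norm_pow_def pt[symmetric]
    by (rule nn_integral_ball_volume) (unfold pt, measurable)
  also have "(\<integral>\<^sup>+z. ennreal (?c powr p) * ennreal (cmod (ball_ext ?h z) powr p * (1 - (norm z)\<^sup>2) powr ?t) \<partial>lborel) = ennreal (?c powr p) * weighted_norm p ?t ?h"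
    unfolding weighted_norm_def by (rule nn_integral_cmult) measurable
  also have "ennreal (?c powr p) * weighted_norm p ?t ?h / emeasure lborel (unit_ball :: (complex ^ 'n) set) = ennreal (?c powr p / ?V) * weighted_norm p ?t ?h"
    unfolding emeasure_lborel_ball divide_ennreal_def inverse_ennreal[OF V] divide_inverse[of _ ?V] ennreal_mult'[OF powr_ge_zero]
    by (simp only: mult_ac)
  finally show ?thesis .
qed

section \<open>Hoelder's inequality\<close>

text \<open>Hoelder's inequality in the form in which it is used, with extended nonnegative integrals and only a bound for one factor.
  It follows by integrating Young's inequality for $(\tau x)(y/\tau)$ with the best $\tau$.\<close>

lemma holder_power:
  assumes p: "p > 1" and B: "B > 0" and F: "F \<ge> 0"
    and x[measurable]: "x \<in> borel_measurable M" and y[measurable]: "y \<in> borel_measurable M"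
    and pos: "\<And>w. 0 \<le> x w" "\<And>w. 0 \<le> y w"
    and le: "ennreal F \<le> (\<integral>\<^sup>+w. ennreal (x w * y w) \<partial>M)"
    and yB: "(\<integral>\<^sup>+w. ennreal (y w powr (p / (p - 1))) \<partial>M) \<le> ennreal B"
  shows "ennreal (F powr p) \<le> ennreal (B powr (p - 1)) * (\<integral>\<^sup>+w. ennreal (x w powr p) \<partial>M)"
proof (cases "(\<integral>\<^sup>+w. ennreal (x w powr p) \<partial>M) = \<infinity>")
  case True
  then show ?thesis using B by (simp add: ennreal_mult_top)
next
  case False
  define q where "q = p / (p - 1)"
  have q: "q > 1" "1 / p + 1 / q = 1" using p by (auto simp: q_def field_simps)
  obtain A where A: "A \<ge> 0" "(\<integral>\<^sup>+w. ennreal (x w powr p) \<partial>M) = ennreal A"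
    using False by (cases "\<integral>\<^sup>+w. ennreal (x w powr p) \<partial>M") auto
  \<comment> \<open>the integral A may vanish, so the optimal \<tau> is computed with a strictly larger number\<close>
  have "F powr p / B powr (p - 1) \<le> A'" if A': "A < A'" for A'
  proof -
    have A'0: "A' > 0" using A(1) A' by simp
    \<comment> \<open>this choice makes both terms of Young's inequality proportional to B powr (1/q) * A' powr (1/p)\<close>
    define \<tau> where "\<tau> = (B / A') powr (1 / (p * q))"
    have t: "\<tau> > 0" using B A'0 by (simp add: \<tau>_def)
    have young: "x w * y w \<le> \<tau> powr p / p * x w powr p + \<tau> powr (- q) / q * y w powr q" for w
    proof -
      have "x w * y w = (\<tau> * x w) * (y w / \<tau>)" using t by simp
      also have "\<dots> \<le> (\<tau> * x w) powr p / p + (y w / \<tau>) powr q / q"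
        by (rule Youngs_inequality) (use p q t pos[of w] in auto)
      also have "\<dots> = \<tau> powr p / p * x w powr p + \<tau> powr (- q) / q * y w powr q"
        using t pos[of w] by (simp add: powr_mult powr_divide powr_minus_divide)
      finally show ?thesis .
    qed
    have "ennreal F \<le> (\<integral>\<^sup>+w. ennreal (\<tau> powr p / p) * ennreal (x w powr p) + ennreal (\<tau> powr (- q) / q) * ennreal (y w powr q) \<partial>M)"
    proof (rule order_trans[OF le nn_integral_mono])
      fix w
      have "ennreal (x w * y w) \<le> ennreal (\<tau> powr p / p * x w powr p + \<tau> powr (- q) / q * y w powr q)"
        by (rule ennreal_leI[OF young])
      also have "\<dots> = ennreal (\<tau> powr p / p) * ennreal (x w powr p) + ennreal (\<tau> powr (- q) / q) * ennreal (y w powr q)"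
        using p q by (simp add: ennreal_mult'[symmetric] ennreal_plus[symmetric] del: ennreal_plus)
      finally show "ennreal (x w * y w) \<le> ennreal (\<tau> powr p / p) * ennreal (x w powr p) + ennreal (\<tau> powr (- q) / q) * ennreal (y w powr q)" .
    qed
    also have "\<dots> = ennreal (\<tau> powr p / p) * (\<integral>\<^sup>+w. ennreal (x w powr p) \<partial>M) + ennreal (\<tau> powr (- q) / q) * (\<integral>\<^sup>+w. ennreal (y w powr q) \<partial>M)"
      by (simp add: nn_integral_add nn_integral_cmult)
    also have "\<dots> \<le> ennreal (\<tau> powr p / p) * ennreal A' + ennreal (\<tau> powr (- q) / q) * ennreal B"
      unfolding A(2) using yB A' by (intro add_mono mult_left_mono) (simp_all add: q_def ennreal_leI)
    also have "\<dots> = ennreal (\<tau> powr p / p * A' + \<tau> powr (- q) / q * B)"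
      using p q A'0 B by (simp add: ennreal_mult'[symmetric] ennreal_plus[symmetric] del: ennreal_plus)
    finally have "F \<le> \<tau> powr p / p * A' + \<tau> powr (- q) / q * B"
      using p q A'0 B by (subst (asm) ennreal_le_iff) auto
    moreover have "\<tau> powr p * A' = B powr (1 / q) * A' powr (1 / p)"
    proof -
      have "\<tau> powr p = (B / A') powr (1 / q)" using p q by (simp add: \<tau>_def powr_powr)
      also have "\<dots> = B powr (1 / q) * A' powr (- (1 / q))" using B A'0 by (simp add: powr_divide powr_minus_divide)
      finally have "\<tau> powr p * A' = B powr (1 / q) * (A' powr (- (1 / q)) * A' powr 1)" using A'0 by simp
      also have "A' powr (- (1 / q)) * A' powr 1 = A' powr (1 / p)"
      proof -
        have "- (1 / q) + 1 = 1 / p" using q(2) by linarith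
        then show ?thesis by (simp only: powr_add[symmetric])
      qed
      finally show ?thesis .
    qed
    moreover have "\<tau> powr (- q) * B = B powr (1 / q) * A' powr (1 / p)"
    proof -
      have "\<tau> powr (- q) = (B / A') powr (- (1 / p))" using p q by (simp add: \<tau>_def powr_powr)
      also have "\<dots> = B powr (- (1 / p)) * A' powr (1 / p)" using B A'0 by (simp add: powr_divide powr_minus_divide)
      finally have "\<tau> powr (- q) * B = (B powr (- (1 / p)) * B powr 1) * A' powr (1 / p)" using B by simp
      also have "B powr (- (1 / p)) * B powr 1 = B powr (1 / q)"
      proof -
        have "- (1 / p) + 1 = 1 / q" using q(2) by linarith
        then show ?thesis by (simp only: powr_add[symmetric])
      qed
      finally show ?thesis .
    qed
    ultimately have "F \<le> B powr (1 / q) * A' powr (1 / p) / p + B powr (1 / q) * A' powr (1 / p) / q" by simp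
    also have "\<dots> = B powr (1 / q) * A' powr (1 / p) * (1 / p + 1 / q)" by (simp add: distrib_left)
    also have "\<dots> = B powr (1 / q) * A' powr (1 / p)" by (simp only: q(2) mult_1_right)
    finally have "F powr p \<le> (B powr (1 / q) * A' powr (1 / p)) powr p" using F p by (intro powr_mono2) auto
    also have "\<dots> = B powr (p / q) * A'" using p A'0 by (simp add: powr_mult powr_powr)
    also have "p / q = p - 1" using p by (simp add: q_def)
    finally show ?thesis using B by (simp add: field_simps)
  qed
  then have "F powr p / B powr (p - 1) \<le> A" by (rule dense_ge)
  then have "F powr p \<le> B powr (p - 1) * A" using B by (simp add: field_simps)
  then have "ennreal (F powr p) \<le> ennreal (B powr (p - 1) * A)" by (rule ennreal_leI)
  then show ?thesis unfolding A(2) by (simp add: ennreal_mult')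
qed

section \<open>Dyadic conditions that imply the Carleson property\<close>

text \<open>The number $k$ with $2^{-k} \le d < 2\cdot 2^{-k}$; it makes a weight indexed by scales into a function of
  the kernel.\<close>

definition dyadic_index :: "real \<Rightarrow> nat" where
  "dyadic_index d = nat \<lceil>- log 2 d\<rceil>"

lemma dyadic_index_eq:
  assumes "(1/2) ^ k \<le> d" "d < 2 * (1/2) ^ k"
  shows "dyadic_index d = k"
proof -
  have dpos: "d > 0" using assms(1) by (rule less_le_trans[rotated]) simp
  have half: "(1/2::real) ^ k = 2 powr (- real k)" by (simp add: powr_minus_divide powr_realpow power_divide)
  have "- real k = log 2 ((1/2) ^ k)" unfolding half by simp
  also have "\<dots> \<le> log 2 d" using assms(1) dpos by (subst log_le_cancel_iff) auto
  finally have 1: "- log 2 d \<le> real k" by simp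
  have "log 2 d < log 2 (2 * (1/2) ^ k)" using assms(2) dpos by (subst log_less_cancel_iff) auto
  also have "\<dots> = 1 - real k" unfolding half by (simp add: log_mult)
  finally have 2: "real k - 1 < - log 2 d" by simp
  have "\<lceil>- log 2 d\<rceil> = int k" by (rule ceiling_unique) (use 1 2 in simp_all)
  then show ?thesis by (simp add: dyadic_index_def)
qed

lemma dyadic_index_measurable[measurable]: "dyadic_index \<in> borel \<rightarrow>\<^sub>M count_space UNIV"
  unfolding dyadic_index_def[abs_def] by measurable

lemma powr_two_half: "(2::real) powr (x * real k) = ((1/2) ^ k) powr (- x)"
proof -
  have half: "(1/2::real) ^ k = 2 powr (- real k)" by (simp add: powr_minus_divide powr_realpow power_divide)
  show ?thesis unfolding half powr_powr by (simp add: mult.commute)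
qed

text \<open>A Carleson region of radius $4 \cdot 2^{-k}$ has volume $O(2^{-k(n+1)})$, so each scale contributes $O(\omega_k)$.
  Without the weight every scale would contribute a constant, and the integral would grow like
  $\log\frac{1}{1-|z|}$: this logarithm is what a summable weight removes.\<close>

lemma schur_test_lebesgue:
  assumes \<omega>: "\<And>k. \<omega> k > 0" "summable \<omega>"
  shows "\<exists>B>0. \<forall>z :: complex ^ 'n::finite. norm z < 1 \<longrightarrow>
    (\<integral>\<^sup>+w. ennreal (indicator unit_ball w * (cmod (1 - cinner z w) powr (- (real CARD('n) + 1)) * \<omega> (dyadic_index (cmod (1 - cinner z w))))) \<partial>lborel) \<le> ennreal B"
proof -
  obtain C where C: "C > 0" "\<forall>(\<xi> :: complex ^ 'n) \<delta>. norm \<xi> = 1 \<longrightarrow> \<delta> > 0 \<longrightarrow>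
     emeasure lborel (carleson_region \<delta> \<xi>) \<le> ennreal (C * \<delta> ^ (CARD('n) + 1))"
    using carleson_region_volume[where ?'n = 'n] by (elim exE conjE)
  let ?n1 = "CARD('n) + 1"
  define B where "B = C * 4 ^ ?n1 * (\<Sum>k. \<omega> k)"
  have B: "B > 0" using C(1) suminf_pos[OF \<omega>(2,1)] by (simp add: B_def)
  have "(\<integral>\<^sup>+w. ennreal (indicator unit_ball w * (cmod (1 - cinner z w) powr (- (real CARD('n) + 1)) * \<omega> (dyadic_index (cmod (1 - cinner z w))))) \<partial>lborel) \<le> ennreal B"
    if z: "norm z < 1" for z :: "complex ^ 'n"
  proof -
    let ?F = "\<lambda>w. ennreal (cmod (1 - cinner z w) powr (- (real CARD('n) + 1)) * \<omega> (dyadic_index (cmod (1 - cinner z w))))"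
    let ?c = "\<lambda>k. ennreal (((1/2) ^ k) powr (- (real CARD('n) + 1)) * \<omega> k)"
    let ?a = "\<lambda>k. ennreal (C * (4 * (1/2) ^ k) ^ ?n1)"
    have "(\<integral>\<^sup>+w. ennreal (indicator unit_ball w * (cmod (1 - cinner z w) powr (- (real CARD('n) + 1)) * \<omega> (dyadic_index (cmod (1 - cinner z w))))) \<partial>lborel) = (\<integral>\<^sup>+w. ?F w * indicator unit_ball w \<partial>lborel)"
      by (intro nn_integral_cong) (simp add: indicator_def)
    also have "\<dots> = (\<integral>\<^sup>+w. ?F w \<partial>restrict_space lborel unit_ball)"
      by (rule nn_integral_restrict_space[symmetric]) simp
    also have "\<dots> \<le> (\<Sum>k\<in>{k. 1 - norm z < 2 * (1/2) ^ k}. ?c k * ?a k)"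
    proof (rule nn_integral_kernel_le[OF _ z])
      show "sets (restrict_space lborel unit_ball) = sets (restrict_space borel (unit_ball :: (complex ^ 'n) set))"
        by (rule sets_restrict_space_cong) simp
      show "emeasure (restrict_space lborel unit_ball) (carleson_region (4 * (1/2) ^ k) \<xi>) \<le> ?a k" if "norm \<xi> = 1" for \<xi> :: "complex ^ 'n" and k
      proof -
        have "emeasure (restrict_space lborel unit_ball) (carleson_region (4 * (1/2) ^ k) \<xi>) = emeasure lborel (carleson_region (4 * (1/2) ^ k) \<xi>)"
          by (rule emeasure_restrict_space) (auto simp: carleson_region_def)
        then show ?thesis using C(2)[rule_format, OF that, of "4 * (1/2) ^ k"] by simp
      qed
      fix w :: "complex ^ 'n" and k
      assume w: "norm w < 1" "(1/2) ^ k \<le> cmod (1 - cinner w z)" "cmod (1 - cinner w z) < 2 * (1/2) ^ k"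
      have eq: "cmod (1 - cinner z w) = cmod (1 - cinner w z)" by (rule kernel_commute)
      have "cmod (1 - cinner w z) powr (- (real CARD('n) + 1)) \<le> ((1/2) ^ k) powr (- (real CARD('n) + 1))"
        by (rule powr_mono2') (use w(2) in simp_all)
      then show "?F w \<le> ?c k"
        unfolding eq dyadic_index_eq[OF w(2,3)] using \<omega>(1)[of k] by (intro ennreal_leI mult_right_mono) auto
    qed
    also have "\<dots> = (\<Sum>k\<in>{k. 1 - norm z < 2 * (1/2) ^ k}. ennreal (C * 4 ^ ?n1 * \<omega> k))"
    proof (intro sum.cong refl)
      fix k
      have "((1/2::real) ^ k) powr (- (real CARD('n) + 1)) * ((1/2) ^ k) ^ ?n1 = ((1/2) ^ k) powr (- (real CARD('n) + 1)) * ((1/2) ^ k) powr real ?n1"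
        by (subst powr_realpow) simp_all
      also have "\<dots> = 1" unfolding powr_add[symmetric] by simp
      finally have one: "((1/2::real) ^ k) powr (- (real CARD('n) + 1)) * ((1/2) ^ k) ^ ?n1 = 1" .
      have "((1/2) ^ k) powr (- (real CARD('n) + 1)) * \<omega> k * (C * (4 * (1/2) ^ k) ^ ?n1)
         = (((1/2) ^ k) powr (- (real CARD('n) + 1)) * ((1/2) ^ k) ^ ?n1) * (C * 4 ^ ?n1 * \<omega> k)"
        unfolding power_mult_distrib by (simp only: mult_ac)
      also have "\<dots> = C * 4 ^ ?n1 * \<omega> k" unfolding one by simp
      finally have eq: "((1/2) ^ k) powr (- (real CARD('n) + 1)) * \<omega> k * (C * (4 * (1/2) ^ k) ^ ?n1) = C * 4 ^ ?n1 * \<omega> k" .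
      show "?c k * ?a k = ennreal (C * 4 ^ ?n1 * \<omega> k)"
        by (rule trans[OF ennreal_mult'[symmetric] arg_cong[where f = ennreal, OF eq]]) (use \<omega>(1)[of k] in simp)
    qed
    also have "\<dots> = ennreal (\<Sum>k\<in>{k. 1 - norm z < 2 * (1/2) ^ k}. C * 4 ^ ?n1 * \<omega> k)"
      using C(1) \<omega>(1) by (intro sum_ennreal) (simp add: less_imp_le)
    also have "\<dots> \<le> ennreal B"
    proof (rule ennreal_leI)
      have "(\<Sum>k\<in>{k. 1 - norm z < 2 * (1/2) ^ k}. \<omega> k) \<le> (\<Sum>k. \<omega> k)"
        using finite_dyadic[of "1 - norm z"] z \<omega> by (intro sum_le_suminf) (auto intro: less_imp_le)
      then show "(\<Sum>k\<in>{k. 1 - norm z < 2 * (1/2) ^ k}. C * 4 ^ ?n1 * \<omega> k) \<le> B"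
        unfolding B_def sum_distrib_left[symmetric] using C(1) by (intro mult_left_mono) auto
    qed
    finally show ?thesis .
  qed
  then show ?thesis using B by blast
qed

text \<open>Each scale contributes $O(2^{k(e-s)})$: the powers of $\omega_k$ in the integrand and in the bound for the measure
  cancel, and the sum is dominated by the scale $2^{-k}$ close to $1-|w|$.\<close>

lemma schur_test_measure:
  fixes \<mu> :: "(complex ^ 'n::finite) measure"
  assumes \<mu>: "borel_measure_on_ball \<mu>" and \<omega>: "\<And>k. \<omega> k > 0" and p: "p > 1" and D: "D > 0"
    and meas: "\<And>\<xi> k. norm \<xi> = 1 \<Longrightarrow> emeasure \<mu> (carleson_region (4 * (1/2) ^ k) \<xi>) \<le> ennreal (D * (((1/2) ^ k) powr s * \<omega> k powr (p - 1)))"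
    and e: "e > s" "s \<ge> 0"
  shows "\<exists>C>0. \<forall>w. norm w < 1 \<longrightarrow>
    (\<integral>\<^sup>+z. ennreal (cmod (1 - cinner z w) powr (- e) * \<omega> (dyadic_index (cmod (1 - cinner z w))) powr (- (p - 1))) \<partial>\<mu>) \<le> ennreal (C * (1 - (norm w)\<^sup>2) powr (- (e - s)))"
proof -
  obtain C where C: "C > 0" "\<forall>x. 0 < x \<longrightarrow> x \<le> 1 \<longrightarrow> (\<Sum>k\<in>{k. x < 2 * (1/2) ^ k}. 2 powr ((e - s) * real k)) \<le> C * x powr (- (e - s))"
    using sum_dyadic_powr[of "e - s"] e by auto
  define C' where "C' = D * C * 2 powr (e - s)"
  have C': "C' > 0" using C(1) D by (simp add: C'_def)
  have "(\<integral>\<^sup>+z. ennreal (cmod (1 - cinner z w) powr (- e) * \<omega> (dyadic_index (cmod (1 - cinner z w))) powr (- (p - 1))) \<partial>\<mu>) \<le> ennreal (C' * (1 - (norm w)\<^sup>2) powr (- (e - s)))"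
    if w: "norm w < 1" for w
  proof -
    let ?c = "\<lambda>k. ennreal (((1/2) ^ k) powr (- e) * \<omega> k powr (- (p - 1)))"
    let ?a = "\<lambda>k. ennreal (D * (((1/2) ^ k) powr s * \<omega> k powr (p - 1)))"
    have "(\<integral>\<^sup>+z. ennreal (cmod (1 - cinner z w) powr (- e) * \<omega> (dyadic_index (cmod (1 - cinner z w))) powr (- (p - 1))) \<partial>\<mu>)
      \<le> (\<Sum>k\<in>{k. 1 - norm w < 2 * (1/2) ^ k}. ?c k * ?a k)"
    proof (rule nn_integral_kernel_le[OF _ w meas])
      show "sets \<mu> = sets (restrict_space borel unit_ball)" using \<mu> by (simp add: borel_measure_on_ball_def)
      fix z :: "complex ^ 'n" and k
      assume z: "norm z < 1" "(1/2) ^ k \<le> cmod (1 - cinner z w)" "cmod (1 - cinner z w) < 2 * (1/2) ^ k"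
      have "cmod (1 - cinner z w) powr (- e) \<le> ((1/2) ^ k) powr (- e)"
        by (rule powr_mono2') (use z(2) e in simp_all)
      then show "ennreal (cmod (1 - cinner z w) powr (- e) * \<omega> (dyadic_index (cmod (1 - cinner z w))) powr (- (p - 1))) \<le> ?c k"
        unfolding dyadic_index_eq[OF z(2,3)] by (intro ennreal_leI mult_right_mono) auto
    qed
    also have "\<dots> = (\<Sum>k\<in>{k. 1 - norm w < 2 * (1/2) ^ k}. ennreal (D * 2 powr ((e - s) * real k)))"
    proof (intro sum.cong refl)
      fix k
      have one: "\<omega> k powr (- (p - 1)) * \<omega> k powr (p - 1) = 1"
        unfolding powr_add[symmetric] using \<omega>[of k] by simp
      have "((1/2) ^ k) powr (- e) * \<omega> k powr (- (p - 1)) * (D * (((1/2) ^ k) powr s * \<omega> k powr (p - 1)))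
        = D * (((1/2) ^ k) powr (- e) * ((1/2) ^ k) powr s) * (\<omega> k powr (- (p - 1)) * \<omega> k powr (p - 1))"
        by (simp only: mult_ac)
      also have "((1/2) ^ k) powr (- e) * ((1/2) ^ k) powr s = 2 powr ((e - s) * real k)"
        unfolding powr_two_half powr_add[symmetric] by (rule arg_cong[where f = "\<lambda>x. _ powr x"]) simp
      finally have eq: "((1/2) ^ k) powr (- e) * \<omega> k powr (- (p - 1)) * (D * (((1/2) ^ k) powr s * \<omega> k powr (p - 1))) = D * 2 powr ((e - s) * real k)"
        unfolding one mult_1_right .
      show "?c k * ?a k = ennreal (D * 2 powr ((e - s) * real k))"
        by (rule trans[OF ennreal_mult'[symmetric] arg_cong[where f = ennreal, OF eq]]) simp
    qed
    also have "\<dots> = ennreal (D * (\<Sum>k\<in>{k. 1 - norm w < 2 * (1/2) ^ k}. 2 powr ((e - s) * real k)))"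
      unfolding sum_distrib_left using D by (intro sum_ennreal) simp
    also have "\<dots> \<le> ennreal (C' * (1 - (norm w)\<^sup>2) powr (- (e - s)))"
    proof (rule ennreal_leI)
      have "D * (\<Sum>k\<in>{k. 1 - norm w < 2 * (1/2) ^ k}. 2 powr ((e - s) * real k)) \<le> D * (C * (1 - norm w) powr (- (e - s)))"
        using C(2) w D by (intro mult_left_mono) auto
      also have "\<dots> \<le> D * (C * (((1 - (norm w)\<^sup>2) / 2) powr (- (e - s))))"
      proof (intro mult_left_mono powr_mono2')
        have "1 - (norm w)\<^sup>2 = (1 - norm w) * (1 + norm w)" by (simp add: power2_eq_square algebra_simps)
        also have "\<dots> \<le> (1 - norm w) * 2" using w by (intro mult_left_mono) auto
        finally show "(1 - (norm w)\<^sup>2) / 2 \<le> 1 - norm w" by simp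
        show "0 < (1 - (norm w)\<^sup>2) / 2" using w by (simp add: power_less_one_iff)
      qed (use e C(1) D in simp_all)
      also have "\<dots> = C' * (1 - (norm w)\<^sup>2) powr (- (e - s))"
      proof -
        have "0 \<le> 1 - (norm w)\<^sup>2" using w by (simp add: power_le_one)
        then have "((1 - (norm w)\<^sup>2) / 2) powr (- (e - s)) = (1 - (norm w)\<^sup>2) powr (- (e - s)) / 2 powr (- (e - s))"
          by (simp only: powr_divide zero_le_numeral)
        also have "\<dots> = (1 - (norm w)\<^sup>2) powr (- (e - s)) * 2 powr (e - s)"
          unfolding powr_minus by (simp only: divide_inverse inverse_inverse_eq)
        finally show ?thesis unfolding C'_def by (simp only: mult_ac)
      qed
      finally show "D * (\<Sum>k\<in>{k. 1 - norm w < 2 * (1/2) ^ k}. 2 powr ((e - s) * real k)) \<le> C' * (1 - (norm w)\<^sup>2) powr (- (e - s))" .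
    qed
    finally show ?thesis .
  qed
  then show ?thesis using C' by blast
qed

text \<open>The factorisation to which Hoelder's inequality is applied. The exponents are chosen such that the power
  $p/(p-1)$ of the second factor is $d^{-(n+1)}\omega$, whose integral over the ball is bounded; everything else goes
  into the first factor.\<close>

lemma weight_split:
  assumes p: "p > (1::real)" and d: "d > 0" and W: "W > 0" and h: "h \<ge> 0" and r: "r \<ge> 0"
  shows "h * r ^ N / d ^ (M + n1) = (h * r ^ N * d powr (- real M - real n1 / p) * W powr (- (1 - 1/p))) * (d powr (- (real n1 * (1 - 1/p))) * W powr (1 - 1/p))"
    and "(h * r ^ N * d powr (- real M - real n1 / p) * W powr (- (1 - 1/p))) powr p = h powr p * (r ^ N) powr p * (d powr (- (real M * p + real n1)) * W powr (- (p - 1)))"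
    and "(d powr (- (real n1 * (1 - 1/p))) * W powr (1 - 1/p)) powr (p / (p - 1)) = d powr (- real n1) * W"
proof -
  have "d powr (- real M - real n1 / p) * d powr (- (real n1 * (1 - 1/p))) = d powr (- real (M + n1))"
    unfolding powr_add[symmetric] by (simp add: algebra_simps)
  also have "\<dots> = inverse (d ^ (M + n1))" unfolding powr_minus powr_realpow[OF d] ..
  finally have 1: "d powr (- real M - real n1 / p) * d powr (- (real n1 * (1 - 1/p))) = inverse (d ^ (M + n1))" .
  have 2: "W powr (- (1 - 1/p)) * W powr (1 - 1/p) = 1"
    unfolding powr_add[symmetric] using W by simp
  have "(h * r ^ N * d powr (- real M - real n1 / p) * W powr (- (1 - 1/p))) * (d powr (- (real n1 * (1 - 1/p))) * W powr (1 - 1/p))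
    = h * r ^ N * (d powr (- real M - real n1 / p) * d powr (- (real n1 * (1 - 1/p)))) * (W powr (- (1 - 1/p)) * W powr (1 - 1/p))"
    by (simp only: mult_ac)
  also have "\<dots> = h * r ^ N / d ^ (M + n1)" unfolding 1 2 by (simp only: divide_inverse mult_1_right)
  finally show "h * r ^ N / d ^ (M + n1) = (h * r ^ N * d powr (- real M - real n1 / p) * W powr (- (1 - 1/p))) * (d powr (- (real n1 * (1 - 1/p))) * W powr (1 - 1/p))" by (rule sym)
  have e1: "(- real M - real n1 / p) * p = - (real M * p + real n1)" and e2: "- (1 - 1/p) * p = - (p - 1)"
    and e3: "- (real n1 * (1 - 1/p)) * (p / (p - 1)) = - real n1" and e4: "(1 - 1/p) * (p / (p - 1)) = 1"
    using p by (simp_all add: field_simps)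
  show "(h * r ^ N * d powr (- real M - real n1 / p) * W powr (- (1 - 1/p))) powr p = h powr p * (r ^ N) powr p * (d powr (- (real M * p + real n1)) * W powr (- (p - 1)))"
    using h r by (simp only: powr_mult mult_nonneg_nonneg zero_le_power powr_ge_zero powr_powr e1 e2 mult.assoc)
  show "(d powr (- (real n1 * (1 - 1/p))) * W powr (1 - 1/p)) powr (p / (p - 1)) = d powr (- real n1) * W"
    using W by (simp only: powr_mult powr_ge_zero powr_powr e3 e4 powr_one less_imp_le)
qed

text \<open>With $h = R^{\alpha,m}f$ up to a constant, the pointwise bound and Hoelder's inequality give
  $$|f(z)|^p \le C \int |h(w)|^p (1-|w|^2)^{Np} d^{-(Mp+n+1)} \omega^{-(p-1)}\, dv(w),$$
  where $d = |1-\langle z,w\rangle|$, $\omega$ is the weight at the scale of $d$, and $N = m + M$. Integrating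
  first over $z$ with respect to the measure leaves exactly the weight of the Besov norm.\<close>

theorem dyadic_carleson_sufficient:
  fixes \<mu> :: "(complex ^ 'n::finite) measure"
  assumes \<mu>: "borel_measure_on_ball \<mu>" and p: "p > 1" and \<sigma>: "\<sigma> \<ge> 0"
    and a: "real CARD('n) + 1 + \<alpha> \<notin> \<int>\<^sub>\<le>\<^sub>0"
    and \<omega>: "\<And>k. \<omega> k > 0" "summable \<omega>" and D: "D > 0"
    and meas: "\<And>\<xi> k. norm \<xi> = 1 \<Longrightarrow> emeasure \<mu> (carleson_region (4 * (1/2) ^ k) \<xi>) \<le> ennreal (D * (((1/2) ^ k) powr (\<sigma> * p) * \<omega> k powr (p - 1)))"
  shows "besov_carleson m \<alpha> p \<sigma> \<mu>"
proof -
  let ?a = "real CARD('n) + 1 + \<alpha>" and ?n1 = "CARD('n) + 1"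
  \<comment> \<open>any natural number M with M \<ge> \<sigma> will do, as it makes the kernel exponent exceed \<sigma> p\<close>
  define M where "M = nat \<lceil>\<sigma>\<rceil>"
  have M: "real M \<ge> \<sigma>" by (simp add: M_def real_nat_ceiling_ge)
  define N where "N = m + M"
  have a0: "real k + ?a \<noteq> 0" for k
    using not_nonpos_Int_shift[OF a, of k] by auto
  have b: "CARD('n) + 1 + N - m = M + ?n1" by (simp add: N_def)
  obtain C1 where C1: "C1 > 0" "\<forall>(f :: complex ^ 'n \<Rightarrow> complex) z. line_holomorphic f \<longrightarrow> norm z < 1 \<longrightarrow>
     ennreal (cmod (f z)) \<le> ennreal C1 * kernel_integral N (CARD('n) + 1 + N - m) (multiplier (shifted_product ?a 0 m) f) z"
    using radial_representation_bound[OF a0, where ?'n = 'n and m = m and N = N] by (auto simp: N_def)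
  obtain B where B: "B > 0" "\<forall>z :: complex ^ 'n. norm z < 1 \<longrightarrow>
    (\<integral>\<^sup>+w. ennreal (indicator unit_ball w * (cmod (1 - cinner z w) powr (- (real CARD('n) + 1)) * \<omega> (dyadic_index (cmod (1 - cinner z w))))) \<partial>lborel) \<le> ennreal B"
    using schur_test_lebesgue[OF \<omega>, where ?'n = 'n] by (elim exE conjE)
  define e where "e = real M * p + real ?n1"
  have Mp: "\<sigma> * p \<le> real M * p" using M p by (intro mult_right_mono) auto
  then have e: "e > \<sigma> * p" by (simp add: e_def)
  obtain C2 where C2: "C2 > 0" "\<forall>w. norm w < 1 \<longrightarrow>
    (\<integral>\<^sup>+z. ennreal (cmod (1 - cinner z w) powr (- e) * \<omega> (dyadic_index (cmod (1 - cinner z w))) powr (- (p - 1))) \<partial>\<mu>) \<le> ennreal (C2 * (1 - (norm w)\<^sup>2) powr (- (e - \<sigma> * p)))"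
    using schur_test_measure[OF \<mu> \<omega>(1) p D meas e] \<sigma> p by (auto simp del: minus_diff_eq)
  have sets: "sets \<mu> = sets (restrict_space borel unit_ball)" using \<mu> by (simp add: borel_measure_on_ball_def)
  have space: "space \<mu> = unit_ball" using sets_eq_imp_space_eq[OF sets] by (simp add: space_restrict_space)
  have [measurable]: "(unit_ball :: (complex ^ 'n) set) \<in> sets borel" by simp
  have id: "(\<lambda>z. z) \<in> \<mu> \<rightarrow>\<^sub>M borel"
    unfolding measurable_cong_sets[OF sets refl] by (rule measurable_restrict_space1) simp
  \<comment> \<open>the region of radius 4 is the whole ball; finiteness of the measure gives access to Tonelli's theorem\<close>
  have fin: "finite_measure \<mu>"
  proof
    obtain \<xi> :: "complex ^ 'n" where \<xi>: "norm \<xi> = 1" using unit_direction[of "0 :: complex ^ 'n"] by blast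
    have "carleson_region (4 * (1/2) ^ 0) \<xi> = space \<mu>"
      unfolding space carleson_region_def using kernel_le_2[of _ \<xi>] \<xi> by fastforce
    then have "emeasure \<mu> (space \<mu>) \<le> ennreal (D * (((1/2) ^ 0) powr (\<sigma> * p) * \<omega> 0 powr (p - 1)))"
      using meas[OF \<xi>, of 0] by simp
    then show "emeasure \<mu> (space \<mu>) \<noteq> \<infinity>" by (metis ennreal_neq_top infinity_ennreal_def neq_top_trans)
  qed
  interpret \<mu>: finite_measure \<mu> by (rule fin)
  interpret pair: pair_sigma_finite \<mu> "lborel :: (complex ^ 'n) measure" ..
  define c where "c = \<bar>1 / pochhammer ?a m\<bar> powr p / measure lborel (unit_ball :: (complex ^ 'n) set)"
  have cpos: "c > 0"
    unfolding c_def using pochhammer_nonzero[OF a, of m] content_ball_pos[of 1 "0 :: complex ^ 'n"] by simp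
  define K where "K = C1 powr p * B powr (p - 1) * C2"
  have K: "K > 0" using C1(1) B(1) C2(1) by (simp add: K_def)
  let ?t = "m * p + \<sigma> * p - real CARD('n) - 1"
  have main: "(\<integral>\<^sup>+z. ennreal (cmod (f z) powr p) \<partial>\<mu>) \<le> ennreal K * weighted_norm p ?t (multiplier (shifted_product ?a 0 m) f)"
    if f: "line_holomorphic f" for f :: "complex ^ 'n \<Rightarrow> complex"
  proof -
    let ?h = "multiplier (shifted_product ?a 0 m) f"
    have [measurable]: "ball_ext ?h \<in> borel_measurable borel"
      by (rule ball_ext_measurable[OF line_holomorphic_multiplier[OF f subexponential_shifted_product]])
    let ?d = "\<lambda>z w. cmod (1 - cinner z w)"
    let ?W = "\<lambda>z w. \<omega> (dyadic_index (?d z w))"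
    define G where "G = (\<lambda>z w. cmod (ball_ext ?h w) powr p * ((1 - (norm w)\<^sup>2) ^ N) powr p * (?d z w powr (- e) * ?W z w powr (- (p - 1))))"
    have prod: "(\<lambda>q. (fst q, snd q)) \<in> \<mu> \<Otimes>\<^sub>M lborel \<rightarrow>\<^sub>M borel \<Otimes>\<^sub>M (borel :: (complex ^ 'n) measure)"
      by (intro measurable_Pair measurable_compose[OF measurable_fst id] measurable_compose[OF measurable_snd, of "\<lambda>z. z"]) simp
    have "(\<lambda>q. ennreal (G (fst q) (snd q))) \<in> borel_measurable (borel \<Otimes>\<^sub>M borel)"
      unfolding G_def by measurable
    from measurable_compose[OF prod this]
    have joint: "(\<lambda>(z, w). ennreal (G z w)) \<in> borel_measurable (\<mu> \<Otimes>\<^sub>M lborel)"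
      by (simp add: split_beta')
    have point: "ennreal (cmod (f z) powr p) \<le> ennreal (C1 powr p * B powr (p - 1)) * (\<integral>\<^sup>+w. ennreal (G z w) \<partial>lborel)"
      if z: "norm z < 1" for z
    proof -
      \<comment> \<open>the maximum with 0 keeps x nonnegative outside the ball, where the function vanishes anyway\<close>
      define x where "x w = cmod (ball_ext ?h w) * (max 0 (1 - (norm w)\<^sup>2)) ^ N * ?d z w powr (- real M - real ?n1 / p) * ?W z w powr (- (1 - 1/p))" for w
      define y where "y w = indicator unit_ball w * (?d z w powr (- (real ?n1 * (1 - 1/p))) * ?W z w powr (1 - 1/p))" for w
      have xm: "x \<in> borel_measurable lborel" unfolding x_def by measurable
      have ym: "y \<in> borel_measurable lborel" unfolding y_def by measurable
      have dp: "?d z w > 0" if "norm w < 1" for w using z that by (intro kernel_pos) auto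
      have rr: "max 0 (1 - (norm w)\<^sup>2) = 1 - (norm w)\<^sup>2" "0 \<le> 1 - (norm w)\<^sup>2" if "norm w < 1" for w :: "complex ^ 'n"
        using that by (simp_all add: power_le_one max_absorb2)
      have xy: "cmod (ball_ext ?h w) * (1 - (norm w)\<^sup>2) ^ N / ?d z w ^ (M + ?n1) = x w * y w" for w
      proof (cases "norm w < 1")
        case True
        show ?thesis unfolding x_def y_def rr(1)[OF True]
          using weight_split(1)[OF p dp[OF True] \<omega>(1) norm_ge_zero rr(2)[OF True]] True by (simp only: mem_ball_0 indicator_simps mult_1_left)
      qed (simp add: x_def ball_ext_out)
      have "ennreal (cmod (f z)) \<le> ennreal C1 * kernel_integral N (M + ?n1) ?h z"
        using C1(2)[rule_format, OF f z] unfolding b .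
      then have "ennreal (1 / C1) * ennreal (cmod (f z)) \<le> ennreal (1 / C1) * (ennreal C1 * kernel_integral N (M + ?n1) ?h z)"
        by (rule mult_left_mono) simp
      then have kb: "ennreal (cmod (f z) / C1) \<le> kernel_integral N (M + ?n1) ?h z"
        using C1(1) by (simp add: mult.assoc[symmetric] ennreal_mult'[symmetric])
      have "ennreal ((cmod (f z) / C1) powr p) \<le> ennreal (B powr (p - 1)) * (\<integral>\<^sup>+w. ennreal (x w powr p) \<partial>lborel)"
      proof (rule holder_power[OF p B(1) _ xm ym])
        show "0 \<le> cmod (f z) / C1" using C1(1) by simp
        show "0 \<le> x w" "0 \<le> y w" for w unfolding x_def y_def by (intro mult_nonneg_nonneg zero_le_power, simp_all)+
        show "ennreal (cmod (f z) / C1) \<le> (\<integral>\<^sup>+w. ennreal (x w * y w) \<partial>lborel)"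
          using kb unfolding kernel_integral_def xy .
        have "y w powr (p / (p - 1)) = indicator unit_ball w * (?d z w powr (- (real CARD('n) + 1)) * ?W z w)" for w
        proof (cases "norm w < 1")
          case True
          have nn: "real ?n1 = real CARD('n) + 1" by simp
          have "(?d z w powr (- (real ?n1 * (1 - 1/p))) * ?W z w powr (1 - 1/p)) powr (p / (p - 1)) = ?d z w powr (- real ?n1) * ?W z w"
            by (rule weight_split(3)[OF p dp[OF True] \<omega>(1) norm_ge_zero[of "0::real"] rr(2)[OF True]])
          then show ?thesis using True by (simp only: y_def mem_ball_0 indicator_simps mult_1_left nn)
        qed (use p in \<open>simp add: y_def\<close>)
        then show "(\<integral>\<^sup>+w. ennreal (y w powr (p / (p - 1))) \<partial>lborel) \<le> ennreal B"
          using B(2)[rule_format, OF z] by (simp only:)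
      qed
      also have "(\<integral>\<^sup>+w. ennreal (x w powr p) \<partial>lborel) = (\<integral>\<^sup>+w. ennreal (G z w) \<partial>lborel)"
      proof (intro nn_integral_cong)
        fix w :: "complex ^ 'n"
        show "ennreal (x w powr p) = ennreal (G z w)"
        proof (cases "norm w < 1")
          case True
          show ?thesis unfolding x_def G_def rr(1)[OF True] e_def
            by (rule arg_cong[where f = ennreal], rule weight_split(2)[OF p dp[OF True] \<omega>(1) norm_ge_zero rr(2)[OF True]])
        qed (use p in \<open>simp add: x_def G_def ball_ext_out\<close>)
      qed
      finally have "ennreal (C1 powr p) * ennreal ((cmod (f z) / C1) powr p) \<le> ennreal (C1 powr p) * (ennreal (B powr (p - 1)) * (\<integral>\<^sup>+w. ennreal (G z w) \<partial>lborel))"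
        by (rule mult_left_mono) simp
      moreover have "ennreal (C1 powr p) * ennreal ((cmod (f z) / C1) powr p) = ennreal (cmod (f z) powr p)"
        using C1(1) by (simp add: ennreal_mult'[symmetric] powr_divide)
      ultimately show ?thesis by (simp add: ennreal_mult'[symmetric] mult.assoc[symmetric])
    qed
    have "(\<integral>\<^sup>+z. ennreal (cmod (f z) powr p) \<partial>\<mu>) \<le> (\<integral>\<^sup>+z. ennreal (C1 powr p * B powr (p - 1)) * (\<integral>\<^sup>+w. ennreal (G z w) \<partial>lborel) \<partial>\<mu>)"
      by (intro nn_integral_mono point) (simp add: space)
    also have "\<dots> = ennreal (C1 powr p * B powr (p - 1)) * (\<integral>\<^sup>+z. \<integral>\<^sup>+w. ennreal (G z w) \<partial>lborel \<partial>\<mu>)"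
      by (rule nn_integral_cmult) (rule lborel.borel_measurable_nn_integral[OF joint])
    also have "(\<integral>\<^sup>+z. \<integral>\<^sup>+w. ennreal (G z w) \<partial>lborel \<partial>\<mu>) = (\<integral>\<^sup>+w. \<integral>\<^sup>+z. ennreal (G z w) \<partial>\<mu> \<partial>lborel)"
      using joint by (rule pair.Fubini'[symmetric])
    also have "\<dots> \<le> (\<integral>\<^sup>+w. ennreal C2 * ennreal (cmod (ball_ext ?h w) powr p * (1 - (norm w)\<^sup>2) powr ?t) \<partial>lborel)"
    proof (rule nn_integral_mono)
      fix w :: "complex ^ 'n"
      show "(\<integral>\<^sup>+z. ennreal (G z w) \<partial>\<mu>) \<le> ennreal C2 * ennreal (cmod (ball_ext ?h w) powr p * (1 - (norm w)\<^sup>2) powr ?t)"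
      proof (cases "norm w < 1")
        case True
        then have r: "1 - (norm w)\<^sup>2 > 0" by (simp add: power_less_one_iff)
        let ?H = "cmod (ball_ext ?h w) powr p * ((1 - (norm w)\<^sup>2) ^ N) powr p"
        have "(\<integral>\<^sup>+z. ennreal (G z w) \<partial>\<mu>) = (\<integral>\<^sup>+z. ennreal ?H * ennreal (?d z w powr (- e) * ?W z w powr (- (p - 1))) \<partial>\<mu>)"
          unfolding G_def by (intro nn_integral_cong ennreal_mult') simp
        also have "\<dots> = ennreal ?H * (\<integral>\<^sup>+z. ennreal (?d z w powr (- e) * ?W z w powr (- (p - 1))) \<partial>\<mu>)"
        proof (rule nn_integral_cmult)
          have "(\<lambda>z. ennreal (?d z w powr (- e) * ?W z w powr (- (p - 1)))) \<in> borel_measurable borel" by measurable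
          from measurable_compose[OF id this]
          show "(\<lambda>z. ennreal (?d z w powr (- e) * ?W z w powr (- (p - 1)))) \<in> borel_measurable \<mu>" .
        qed
        also have "\<dots> \<le> ennreal ?H * ennreal (C2 * (1 - (norm w)\<^sup>2) powr (- (e - \<sigma> * p)))"
          by (intro mult_left_mono C2(2)[rule_format, OF True]) simp
        also have "\<dots> = ennreal (C2 * (cmod (ball_ext ?h w) powr p * (1 - (norm w)\<^sup>2) powr ?t))"
        proof -
          have "((1 - (norm w)\<^sup>2) ^ N) powr p * (1 - (norm w)\<^sup>2) powr (- (e - \<sigma> * p)) = (1 - (norm w)\<^sup>2) powr ?t"
            unfolding powr_realpow[OF r, symmetric] powr_powr powr_add[symmetric]
            by (rule arg_cong[where f = "\<lambda>x. _ powr x"]) (simp add: N_def e_def algebra_simps)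
          moreover have "?H * (C2 * (1 - (norm w)\<^sup>2) powr (- (e - \<sigma> * p))) = C2 * (cmod (ball_ext ?h w) powr p * (((1 - (norm w)\<^sup>2) ^ N) powr p * (1 - (norm w)\<^sup>2) powr (- (e - \<sigma> * p))))"
            by (simp only: mult_ac)
          ultimately have eq: "?H * (C2 * (1 - (norm w)\<^sup>2) powr (- (e - \<sigma> * p))) = C2 * (cmod (ball_ext ?h w) powr p * (1 - (norm w)\<^sup>2) powr ?t)"
            by (simp only:)
          show ?thesis by (rule trans[OF ennreal_mult'[symmetric] arg_cong[where f = ennreal, OF eq]]) simp
        qed
        also have "\<dots> = ennreal C2 * ennreal (cmod (ball_ext ?h w) powr p * (1 - (norm w)\<^sup>2) powr ?t)"
          by (rule ennreal_mult') (use C2(1) in simp)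
        finally show ?thesis .
      qed (use p in \<open>simp add: G_def ball_ext_out\<close>)
    qed
    also have "\<dots> = ennreal C2 * weighted_norm p ?t ?h"
      unfolding weighted_norm_def by (rule nn_integral_cmult) measurable
    finally have "(\<integral>\<^sup>+z. ennreal (cmod (f z) powr p) \<partial>\<mu>) \<le> ennreal (C1 powr p * B powr (p - 1)) * (ennreal C2 * weighted_norm p ?t ?h)"
      by (simp add: mult_left_mono)
    also have "\<dots> = ennreal K * weighted_norm p ?t ?h"
      by (simp add: K_def ennreal_mult' mult.assoc)
    finally show ?thesis .
  qed
  show ?thesis
    unfolding besov_carleson_def
  proof (intro exI[of _ "K / c"] conjI ballI)
    show "K / c > 0" using K cpos by (rule divide_pos_pos)
    fix f :: "complex ^ 'n \<Rightarrow> complex" assume "f \<in> besov_sobolev m p \<sigma>"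
    then have f: "line_holomorphic f" unfolding besov_sobolev_def by (auto intro: holomorphic_ball_imp_line)
    have "ennreal (K / c) * besov_norm_pow m \<alpha> p \<sigma> f = (ennreal (K / c) * ennreal c) * weighted_norm p ?t (multiplier (shifted_product ?a 0 m) f)"
      using besov_norm_pow_eq[OF f a, of p m \<sigma>, folded c_def] p by (simp only: mult.assoc)
    also have "ennreal (K / c) * ennreal c = ennreal K"
      using K cpos by (simp add: ennreal_mult'[symmetric])
    finally show "(\<integral>\<^sup>+z. ennreal (cmod (f z) powr p) \<partial>\<mu>) \<le> ennreal (K / c) * besov_norm_pow m \<alpha> p \<sigma> f"
      using main[OF f] by (simp only:)
  qed
qed

section \<open>Forelli-Rudin estimates\<close>

text \<open>The familiar asymptotics, left as a dyadic sum so that the critical exponent $b = n+1+t$ needs no separate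
  treatment: there each scale contributes a constant and the sum counts the scales.\<close>

lemma forelli_rudin:
  assumes t: "t > -1" and b: "b \<ge> 0"
  shows "\<exists>C>0. \<forall>w :: complex ^ 'n::finite. norm w < 1 \<longrightarrow>
    (\<integral>\<^sup>+z. ennreal (indicator unit_ball z * (cmod (1 - cinner z w) powr (- b) * (1 - (norm z)\<^sup>2) powr t)) \<partial>lborel)
      \<le> ennreal (C * (\<Sum>k\<in>{k. 1 - norm w < 2 * (1/2) ^ k}. 2 powr ((b - (real CARD('n) + 1 + t)) * real k)))"
proof -
  let ?e = "real CARD('n) + 1 + t"
  obtain C where C: "C > 0" "\<forall>(\<xi> :: complex ^ 'n) \<delta>. norm \<xi> = 1 \<longrightarrow> 0 < \<delta> \<longrightarrow>
    (\<integral>\<^sup>+z\<in>carleson_region \<delta> \<xi>. ennreal ((1 - (norm z)\<^sup>2) powr t) \<partial>lborel) \<le> ennreal (C * \<delta> powr ?e)"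
    using carleson_region_weighted_volume[OF t, where ?'n = 'n] by (elim exE conjE)
  let ?\<rho> = "\<lambda>z :: complex ^ 'n. ennreal ((1 - (norm z)\<^sup>2) powr t)"
  define M where "M = density (restrict_space lborel unit_ball) ?\<rho>"
  have [measurable]: "(unit_ball :: (complex ^ 'n) set) \<in> sets borel" by simp
  have rm: "g \<in> borel_measurable (restrict_space lborel (unit_ball :: (complex ^ 'n) set))" if "g \<in> borel_measurable borel" for g :: "complex ^ 'n \<Rightarrow> ennreal"
    by (rule measurable_restrict_space1) (use that in simp)
  have \<rho>m: "?\<rho> \<in> borel_measurable borel" by measurable
  have "(\<integral>\<^sup>+z. ennreal (indicator unit_ball z * (cmod (1 - cinner z w) powr (- b) * (1 - (norm z)\<^sup>2) powr t)) \<partial>lborel)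
      \<le> ennreal (C * 4 powr ?e * (\<Sum>k\<in>{k. 1 - norm w < 2 * (1/2) ^ k}. 2 powr ((b - ?e) * real k)))"
    if w: "norm w < 1" for w :: "complex ^ 'n"
  proof -
    let ?F = "\<lambda>z. ennreal (cmod (1 - cinner z w) powr (- b))"
    let ?c = "\<lambda>k. ennreal (((1/2) ^ k) powr (- b))" and ?a = "\<lambda>k. ennreal (C * (4 * (1/2) ^ k) powr ?e)"
    have Fm: "?F \<in> borel_measurable borel" by measurable
    have "(\<integral>\<^sup>+z. ennreal (indicator unit_ball z * (cmod (1 - cinner z w) powr (- b) * (1 - (norm z)\<^sup>2) powr t)) \<partial>lborel)
       = (\<integral>\<^sup>+z. ?\<rho> z * ?F z * indicator unit_ball z \<partial>lborel)"
      by (intro nn_integral_cong) (simp add: indicator_def ennreal_mult'[symmetric] mult.commute)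
    also have "\<dots> = (\<integral>\<^sup>+z. ?\<rho> z * ?F z \<partial>restrict_space lborel unit_ball)"
      by (rule nn_integral_restrict_space[symmetric]) simp
    also have "\<dots> = (\<integral>\<^sup>+z. ?F z \<partial>M)"
      unfolding M_def by (rule nn_integral_density[symmetric]) (rule rm[OF \<rho>m], rule rm[OF Fm])
    also have "\<dots> \<le> (\<Sum>k\<in>{k. 1 - norm w < 2 * (1/2) ^ k}. ?c k * ?a k)"
    proof (rule nn_integral_kernel_le[OF _ w])
      show "sets M = sets (restrict_space borel unit_ball)"
        unfolding M_def sets_density by (rule sets_restrict_space_cong) simp
      fix k
      show "emeasure M (carleson_region (4 * (1/2) ^ k) \<xi>) \<le> ?a k" if \<xi>: "norm \<xi> = 1" for \<xi> :: "complex ^ 'n"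
      proof -
        let ?Q = "carleson_region (4 * (1/2) ^ k) \<xi>"
        have sub: "?Q \<subseteq> unit_ball" by (auto simp: carleson_region_def)
        have "?Q \<in> sets (restrict_space lborel unit_ball)"
          using sub by (subst sets_restrict_space_iff) simp_all
        then have "emeasure M ?Q = (\<integral>\<^sup>+z. ?\<rho> z * indicator ?Q z \<partial>restrict_space lborel unit_ball)"
          unfolding M_def by (rule emeasure_density[OF rm[OF \<rho>m]])
        also have "\<dots> = (\<integral>\<^sup>+z. ?\<rho> z * indicator ?Q z * indicator unit_ball z \<partial>lborel)"
          by (rule nn_integral_restrict_space) simp
        also have "\<dots> = (\<integral>\<^sup>+z\<in>?Q. ?\<rho> z \<partial>lborel)"
          using sub by (intro nn_integral_cong) (auto simp: indicator_def)
        also have "\<dots> \<le> ?a k" using C(2)[rule_format, OF \<xi>, of "4 * (1/2) ^ k"] by simp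
        finally show ?thesis .
      qed
      fix z :: "complex ^ 'n"
      assume z: "norm z < 1" "(1/2) ^ k \<le> cmod (1 - cinner z w)"
      show "?F z \<le> ?c k" by (rule ennreal_leI, rule powr_mono2') (use z(2) b in simp_all)
    qed
    also have "\<dots> = (\<Sum>k\<in>{k. 1 - norm w < 2 * (1/2) ^ k}. ennreal (C * 4 powr ?e * 2 powr ((b - ?e) * real k)))"
    proof (intro sum.cong refl)
      fix k
      have "((1/2) ^ k) powr (- b) * (C * (4 * (1/2) ^ k) powr ?e) = C * 4 powr ?e * (((1/2::real) ^ k) powr (- b) * ((1/2) ^ k) powr ?e)"
        by (subst powr_mult) (simp_all only: mult_ac zero_le_numeral zero_le_power zero_le_divide_1_iff)
      also have "((1/2::real) ^ k) powr (- b) * ((1/2) ^ k) powr ?e = 2 powr ((b - ?e) * real k)"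
        unfolding powr_two_half powr_add[symmetric] by (rule arg_cong[where f = "\<lambda>x. _ powr x"]) simp
      finally have eq: "((1/2) ^ k) powr (- b) * (C * (4 * (1/2) ^ k) powr ?e) = C * 4 powr ?e * 2 powr ((b - ?e) * real k)" .
      show "?c k * ?a k = ennreal (C * 4 powr ?e * 2 powr ((b - ?e) * real k))"
        by (rule trans[OF ennreal_mult'[symmetric] arg_cong[where f = ennreal, OF eq]]) simp
    qed
    also have "\<dots> = ennreal (\<Sum>k\<in>{k. 1 - norm w < 2 * (1/2) ^ k}. C * 4 powr ?e * 2 powr ((b - ?e) * real k))"
      using C(1) by (intro sum_ennreal) simp
    finally show ?thesis unfolding sum_distrib_left .
  qed
  moreover have "C * 4 powr ?e > 0" using C(1) by simp
  ultimately show ?thesis by blast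
qed

section \<open>Functions of one variable with a pole or a logarithm at 1\<close>

text \<open>The span of $\log(1-u)$ and of the powers $(1-u)^{-i}$ with $i \le l$. It contains the test functions, and the Euler
  operator raises $l$ by one without leaving these classes.\<close>

inductive pole_class :: "nat \<Rightarrow> (complex \<Rightarrow> complex) \<Rightarrow> bool" where
  ln: "pole_class l (\<lambda>u. c * Ln (1 - u))"
| pow: "i \<le> l \<Longrightarrow> pole_class l (\<lambda>u. c * inverse (1 - u) ^ i)"
| add: "pole_class l f \<Longrightarrow> pole_class l g \<Longrightarrow> pole_class l (\<lambda>u. f u + g u)"

lemma one_minus_ne: "cmod u < 1 \<Longrightarrow> 1 - u \<noteq> 0"
  by auto

lemma one_minus_nonpos: "cmod u < 1 \<Longrightarrow> 1 - u \<notin> \<real>\<^sub>\<le>\<^sub>0"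
  using complex_Re_le_cmod[of u] by (auto simp: complex_nonpos_Reals_iff)

lemma pole_class_mono: "pole_class l f \<Longrightarrow> l \<le> l' \<Longrightarrow> pole_class l' f"
  by (induction rule: pole_class.induct) (auto intro: pole_class.intros)

lemma pole_class_scale: "pole_class l f \<Longrightarrow> pole_class l (\<lambda>u. a * f u)"
proof (induction rule: pole_class.induct)
  case (ln l c)
  then show ?case using pole_class.ln[of l "a * c"] by (simp add: mult.assoc)
next
  case (pow i l c)
  then show ?case using pole_class.pow[of i l "a * c"] by (simp add: mult.assoc)
next
  case (add l f g)
  then show ?case using pole_class.add[OF add.IH] by (simp add: distrib_left)
qed

lemma pole_class_euler:
  "pole_class l f \<Longrightarrow> \<exists>f' g. (\<forall>u. cmod u < 1 \<longrightarrow> (f has_field_derivative f' u) (at u)) \<and> pole_class (Suc l) g \<and>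
     (\<forall>u. cmod u < 1 \<longrightarrow> g u = u * f' u)"
proof (induction rule: pole_class.induct)
  case (ln l c)
  have "((\<lambda>u. c * Ln (1 - u)) has_field_derivative (- c * inverse (1 - u))) (at u)" if "cmod u < 1" for u
    using one_minus_nonpos[OF that] by (auto intro!: derivative_eq_intros simp: divide_inverse)
  moreover have "pole_class (Suc l) (\<lambda>u. c * inverse (1 - u) ^ 0 + (- c) * inverse (1 - u) ^ 1)"
    by (intro pole_class.intros) auto
  moreover have "c * inverse (1 - u) ^ 0 + (- c) * inverse (1 - u) ^ 1 = u * (- c * inverse (1 - u))" if "cmod u < 1" for u
    using one_minus_ne[OF that] by (simp add: field_simps)
  ultimately show ?case by (intro exI conjI allI impI) blast+
next
  case (pow i l c)
  have "((\<lambda>u. c * inverse (1 - u) ^ i) has_field_derivative (c * (of_nat i * inverse (1 - u) ^ Suc i))) (at u)" if "cmod u < 1" for u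
  proof (cases i)
    case 0 then show ?thesis by simp
  next
    case (Suc j)
    have "((\<lambda>u. inverse (1 - u)) has_field_derivative inverse (1 - u) ^ 2) (at u)"
      using one_minus_ne[OF that] by (auto intro!: derivative_eq_intros simp: power2_eq_square)
    from DERIV_cmult[OF DERIV_power[OF this, of i], of c]
    show ?thesis by (simp add: Suc power2_eq_square mult_ac)
  qed
  moreover have "pole_class (Suc l) (\<lambda>u. c * of_nat i * inverse (1 - u) ^ Suc i + (- c * of_nat i) * inverse (1 - u) ^ i)"
    using pow by (intro pole_class.intros) auto
  moreover have "c * of_nat i * inverse (1 - u) ^ Suc i + (- c * of_nat i) * inverse (1 - u) ^ i = u * (c * (of_nat i * inverse (1 - u) ^ Suc i))" if "cmod u < 1" for u
  proof -
    have "u * inverse (1 - u) = inverse (1 - u) - 1" using one_minus_ne[OF that] by (simp add: field_simps)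
    then have "u * (c * (of_nat i * inverse (1 - u) ^ Suc i)) = c * of_nat i * inverse (1 - u) ^ i * (inverse (1 - u) - 1)"
      by (simp add: mult_ac)
    then show ?thesis by (simp add: algebra_simps)
  qed
  ultimately show ?case by (intro exI conjI allI impI) blast+
next
  case (add l f g)
  obtain f' F where f: "\<forall>u. cmod u < 1 \<longrightarrow> (f has_field_derivative f' u) (at u)" "pole_class (Suc l) F" "\<forall>u. cmod u < 1 \<longrightarrow> F u = u * f' u"
    using add.IH(1) by (elim exE conjE)
  obtain g' G where g: "\<forall>u. cmod u < 1 \<longrightarrow> (g has_field_derivative g' u) (at u)" "pole_class (Suc l) G" "\<forall>u. cmod u < 1 \<longrightarrow> G u = u * g' u"
    using add.IH(2) by (elim exE conjE)
  show ?case
  proof (intro exI conjI allI impI)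
    show "((\<lambda>u. f u + g u) has_field_derivative f' u + g' u) (at u)" if "cmod u < 1" for u
      using f(1) g(1) that by (intro DERIV_add) simp_all
    show "pole_class (Suc l) (\<lambda>u. F u + G u)" by (rule pole_class.add[OF f(2) g(2)])
    show "F u + G u = u * (f' u + g' u)" if "cmod u < 1" for u
      using f(3) g(3) that by (simp add: distrib_left)
  qed
qed

lemma cmod_Ln_le:
  assumes "v \<noteq> 0" "cmod v < 2"
  shows "cmod (Ln v) \<le> (2 + 2 * pi) * inverse (cmod v)"
proof -
  have pos: "cmod v > 0" using assms by simp
  have inv: "inverse (cmod v) \<ge> 1/2" using pos assms by (simp add: field_simps)
  have "\<bar>ln (cmod v)\<bar> \<le> 2 * inverse (cmod v)"
  proof (cases "cmod v \<ge> 1")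
    case True
    then have "\<bar>ln (cmod v)\<bar> = ln (cmod v)" by simp
    also have "\<dots> \<le> cmod v - 1" using pos by (rule ln_le_minus_one)
    also have "\<dots> \<le> 1" using assms by simp
    finally show ?thesis using inv by linarith
  next
    case False
    then have "\<bar>ln (cmod v)\<bar> = ln (inverse (cmod v))" using pos by (simp add: ln_inverse)
    also have "\<dots> \<le> inverse (cmod v) - 1" using pos by (intro ln_le_minus_one) simp
    finally show ?thesis using inv by linarith
  qed
  moreover have "\<bar>Im (Ln v)\<bar> \<le> pi"
    using mpi_less_Im_Ln[OF assms(1)] Im_Ln_le_pi[OF assms(1)] by linarith
  moreover have "pi \<le> 2 * pi * inverse (cmod v)" using mult_left_mono[OF inv, of "2 * pi"] by simp
  moreover have "cmod (Ln v) \<le> \<bar>ln (cmod v)\<bar> + \<bar>Im (Ln v)\<bar>"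
    using cmod_le[of "Ln v"] assms(1) by simp
  ultimately show ?thesis unfolding distrib_right by linarith
qed

lemma inverse_power_le:
  assumes "0 < x" "x < (2::real)" "i \<le> l"
  shows "inverse x ^ i \<le> 2 ^ l * inverse x ^ l"
proof -
  have "1 \<le> 2 * inverse x" using assms by (simp add: field_simps)
  then have "(2 * inverse x) ^ i \<le> (2 * inverse x) ^ l" using assms(3) by (rule power_increasing[rotated])
  moreover have "inverse x ^ i \<le> (2 * inverse x) ^ i" using assms by (intro power_mono) auto
  ultimately show ?thesis by (simp add: power_mult_distrib)
qed

text \<open>The condition $l \ge 1$ is there for the logarithm, which is then dominated by the pole.\<close>

lemma pole_class_bound:
  "pole_class l f \<Longrightarrow> l \<ge> 1 \<Longrightarrow> \<exists>A>0. \<forall>u. cmod u < 1 \<longrightarrow> cmod (f u) \<le> A * inverse (cmod (1 - u)) ^ l"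
proof (induction rule: pole_class.induct)
  case (ln l c)
  show ?case
  proof (intro exI conjI allI impI)
    show "(cmod c + 1) * ((2 + 2 * pi) * 2 ^ l) > 0" by (intro mult_pos_pos) (simp_all add: add_nonneg_pos add_pos_pos pi_gt_zero)
    fix u assume u: "cmod u < 1"
    have d: "0 < cmod (1 - u)" "cmod (1 - u) < 2" using one_minus_ne[OF u] norm_triangle_ineq4[of 1 u] u by auto
    have "cmod (Ln (1 - u)) \<le> (2 + 2 * pi) * inverse (cmod (1 - u))" by (rule cmod_Ln_le) (use d in auto)
    also have "\<dots> \<le> (2 + 2 * pi) * (2 ^ l * inverse (cmod (1 - u)) ^ l)"
      using inverse_power_le[OF d, of 1 l] ln.prems by (intro mult_left_mono) (simp_all add: pi_ge_zero)
    finally have "cmod c * cmod (Ln (1 - u)) \<le> (cmod c + 1) * ((2 + 2 * pi) * (2 ^ l * inverse (cmod (1 - u)) ^ l))"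
      by (intro mult_mono) simp_all
    then show "cmod (c * Ln (1 - u)) \<le> (cmod c + 1) * ((2 + 2 * pi) * 2 ^ l) * inverse (cmod (1 - u)) ^ l"
      by (simp add: norm_mult mult.assoc)
  qed
next
  case (pow i l c)
  show ?case
  proof (intro exI conjI allI impI)
    show "(cmod c + 1) * 2 ^ l > 0" by (intro mult_pos_pos) (simp_all add: add_nonneg_pos)
    fix u assume u: "cmod u < 1"
    have d: "0 < cmod (1 - u)" "cmod (1 - u) < 2" using one_minus_ne[OF u] norm_triangle_ineq4[of 1 u] u by auto
    have "cmod c * inverse (cmod (1 - u)) ^ i \<le> (cmod c + 1) * (2 ^ l * inverse (cmod (1 - u)) ^ l)"
      using inverse_power_le[OF d pow.hyps] by (intro mult_mono) simp_all
    then show "cmod (c * inverse (1 - u) ^ i) \<le> (cmod c + 1) * 2 ^ l * inverse (cmod (1 - u)) ^ l"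
      by (simp add: norm_mult norm_power norm_inverse mult.assoc)
  qed
next
  case (add l f g)
  obtain A where A: "A > 0" "\<forall>u. cmod u < 1 \<longrightarrow> cmod (f u) \<le> A * inverse (cmod (1 - u)) ^ l"
    using add.IH(1)[OF add.prems] by (elim exE conjE)
  obtain B where B: "B > 0" "\<forall>u. cmod u < 1 \<longrightarrow> cmod (g u) \<le> B * inverse (cmod (1 - u)) ^ l"
    using add.IH(2)[OF add.prems] by (elim exE conjE)
  show ?case
  proof (intro exI conjI allI impI)
    show "A + B > 0" using A(1) B(1) by simp
    fix u assume u: "cmod u < 1"
    have "cmod (f u + g u) \<le> cmod (f u) + cmod (g u)" by (rule norm_triangle_ineq)
    also have "\<dots> \<le> A * inverse (cmod (1 - u)) ^ l + B * inverse (cmod (1 - u)) ^ l"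
      using A(2) B(2) u by (intro add_mono) simp_all
    finally show "cmod (f u + g u) \<le> (A + B) * inverse (cmod (1 - u)) ^ l" by (simp add: distrib_right)
  qed
qed

lemma pole_class_holomorphic:
  assumes "pole_class l f" shows "f holomorphic_on ball 0 1"
proof -
  obtain f' where "\<forall>u. cmod u < 1 \<longrightarrow> (f has_field_derivative f' u) (at u)"
    using pole_class_euler[OF assms] by (elim exE conjE)
  then have "\<forall>u\<in>ball 0 1. \<exists>d. (f has_field_derivative d) (at u)" by auto
  then show ?thesis by (subst holomorphic_on_open) simp_all
qed

lemma pole_class_shifted_product:
  assumes f: "pole_class l f" and s: "\<And>u. cmod u < 1 \<Longrightarrow> (\<lambda>k. b k * u ^ k) sums f u"
  shows "\<exists>g. pole_class (l + m) g \<and> (\<forall>u. cmod u < 1 \<longrightarrow> (\<lambda>k. shifted_product a 0 m k * b k * u ^ k) sums g u)"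
proof (induction m)
  case 0
  show ?case using f s by (intro exI[of _ f]) (simp add: shifted_product_def)
next
  case (Suc m)
  obtain g where g: "pole_class (l + m) g" "\<forall>u. cmod u < 1 \<longrightarrow> (\<lambda>k. shifted_product a 0 m k * b k * u ^ k) sums g u"
    using Suc by (elim exE conjE)
  obtain g' G where G: "\<forall>u. cmod u < 1 \<longrightarrow> (g has_field_derivative g' u) (at u)" "pole_class (Suc (l + m)) G" "\<forall>u. cmod u < 1 \<longrightarrow> G u = u * g' u"
    using pole_class_euler[OF g(1)] by (elim exE conjE)
  let ?a = "a + real m"
  have cls: "pole_class (l + Suc m) (\<lambda>u. of_real ?a * g u + G u)"
    using pole_class.add[OF pole_class_scale[OF pole_class_mono[OF g(1), of "Suc (l + m)"]] G(2)] by simp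
  have "(\<lambda>k. shifted_product a 0 (Suc m) k * b k * u ^ k) sums (of_real ?a * g u + G u)" if u: "cmod u < 1" for u
  proof -
    have "(\<lambda>k. of_real (real k + ?a) * (shifted_product a 0 m k * b k) * u ^ k) sums (of_real ?a * g u + u * g' u)"
      by (rule power_series_euler[OF _ _ u]) (use g(2) G(1) u in simp_all)
    moreover have "of_real (real k + ?a) * (shifted_product a 0 m k * b k) * u ^ k = shifted_product a 0 (Suc m) k * b k * u ^ k" for k
    proof -
      have "shifted_product a 0 (Suc m) k = shifted_product a 0 m k * of_real (real k + ?a)"
        unfolding shifted_product_def by (rule prod.atLeast0_lessThan_Suc)
      then show ?thesis by (simp only: mult_ac)
    qed
    ultimately show ?thesis using G(3) u by (simp only:)
  qed
  then show ?case using cls by (intro exI[of _ "\<lambda>u. of_real ?a * g u + G u"]) simp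
qed

section \<open>Ridge functions\<close>

text \<open>Functions of the form $z \mapsto \varphi(\langle z,w\rangle)$ reduce everything to one complex variable. For
  $|w| < 1$ the argument stays in a compact part of the unit disc.\<close>

lemma ridge_holomorphic:
  fixes w :: "complex ^ 'n::finite"
  assumes \<phi>: "\<phi> holomorphic_on ball 0 1" and w: "norm w < 1"
  shows "(\<lambda>z. \<phi> (cinner z w)) \<in> holomorphic_ball"
  unfolding holomorphic_ball_def
proof (intro CollectI ballI)
  fix z :: "complex ^ 'n" assume "z \<in> unit_ball"
  then have u: "cmod (cinner z w) < 1" using cmod_cinner_less w by simp
  have "bounded_linear (\<lambda>h :: complex ^ 'n. cinner h w)"
  proof (rule bounded_linear_intro[of _ "norm w"])
    show "cinner (x + y) w = cinner x w + cinner y w" for x y :: "complex ^ 'n" by (rule cinner_add_left)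
    show "cinner (r *\<^sub>R x) w = r *\<^sub>R cinner x w" for r and x :: "complex ^ 'n"
      unfolding cinner_scaleR_left by (rule scaleR_conv_of_real[symmetric])
    show "norm (cinner x w) \<le> norm x * norm w" for x :: "complex ^ 'n" by (rule cmod_cinner_le)
  qed
  then have 1: "((\<lambda>h. cinner h w) has_derivative (\<lambda>h. cinner h w)) (at z)"
    by (rule bounded_linear_imp_has_derivative)
  have "(\<phi> has_field_derivative deriv \<phi> (cinner z w)) (at (cinner z w))"
    using u by (intro holomorphic_derivI[OF \<phi>]) auto
  then have "(\<phi> has_derivative (\<lambda>h. deriv \<phi> (cinner z w) * h)) (at (cinner z w))"
    by (simp add: has_field_derivative_def)
  with 1 have "((\<lambda>z. \<phi> (cinner z w)) has_derivative (\<lambda>h. deriv \<phi> (cinner z w) * cinner h w)) (at z)"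
    by (rule has_derivative_compose)
  moreover have "\<forall>c v. deriv \<phi> (cinner z w) * cinner (c *s v) w = c * (deriv \<phi> (cinner z w) * cinner v w)"
    unfolding cinner_scale_left by simp
  ultimately show "\<exists>D. ((\<lambda>z. \<phi> (cinner z w)) has_derivative D) (at z) \<and> (\<forall>c v. D (c *s v) = c * D v)"
    by (intro exI conjI)
qed

lemma ridge_partial_derivs:
  fixes w :: "complex ^ 'n::finite"
  assumes \<phi>: "\<phi> holomorphic_on ball 0 1" and w: "norm w < 1" and z: "norm z < 1"
  shows "foldr partial_deriv js (\<lambda>z. \<phi> (cinner z w)) z = prod_list (map (\<lambda>j. cnj (w $ j)) js) * (deriv ^^ length js) \<phi> (cinner z w)"
  using z
proof (induction js arbitrary: z)
  case Nil
  then show ?case by simp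
next
  case (Cons j js)
  let ?P = "prod_list (map (\<lambda>j. cnj (w $ j)) js)" and ?\<psi> = "(deriv ^^ length js) \<phi>"
  let ?F = "foldr partial_deriv js (\<lambda>z. \<phi> (cinner z w))"
  have axis: "cinner (z + axis j t) w = cinner z w + t * cnj (w $ j)" for t
  proof -
    have "cinner (axis j t) w = (\<Sum>i\<in>UNIV. if i = j then t * cnj (w $ j) else 0)"
      unfolding cinner_def by (intro sum.cong refl) (simp add: axis_def)
    then show ?thesis by (simp add: cinner_add_left)
  qed
  have u: "cmod (cinner z w) < 1" by (rule cmod_cinner_less[OF Cons.prems w])
  have "?\<psi> holomorphic_on ball 0 1" by (rule holomorphic_higher_deriv[OF \<phi>]) simp
  then have "(?\<psi> has_field_derivative deriv ?\<psi> (cinner z w)) (at (cinner z w))"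
    using u by (intro holomorphic_derivI) auto
  then have d: "(?\<psi> has_field_derivative deriv ?\<psi> (cinner z w)) (at (cinner z w + 0 * cnj (w $ j)))" by simp
  have lin: "((\<lambda>t. cinner z w + t * cnj (w $ j)) has_field_derivative cnj (w $ j)) (at 0)"
    by (auto intro!: derivative_eq_intros)
  from DERIV_cmult[OF DERIV_chain2[OF d lin], of ?P]
  have "((\<lambda>t. ?P * ?\<psi> (cinner z w + t * cnj (w $ j))) has_field_derivative ?P * (deriv ?\<psi> (cinner z w) * cnj (w $ j))) (at 0)" .
  moreover have "\<forall>\<^sub>F t in nhds 0. ?F (z + axis j t) = ?P * ?\<psi> (cinner z w + t * cnj (w $ j))"
  proof -
    have "\<forall>\<^sub>F t in nhds 0. t \<in> ball (0::complex) (1 - norm z)"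
      using Cons.prems by (intro eventually_nhds_in_open) auto
    then show ?thesis
    proof eventually_elim
      case (elim t)
      have "norm (z + axis j t) \<le> norm z + cmod t"
      proof -
        have "axis j t = t *s axis j 1" by (simp add: vec_eq_iff axis_def)
        then have "norm (axis j t) = cmod t" by (simp add: norm_vector_smult norm_axis_1)
        then show ?thesis using norm_triangle_ineq[of z "axis j t"] by simp
      qed
      then have "norm (z + axis j t) < 1" using elim by simp
      from Cons.IH[OF this] show ?case unfolding axis .
    qed
  qed
  ultimately have "((\<lambda>t. ?F (z + axis j t)) has_field_derivative ?P * (deriv ?\<psi> (cinner z w) * cnj (w $ j))) (at 0)"
    by (subst DERIV_cong_ev[OF refl _ refl])
  then have "partial_deriv j ?F z = ?P * (deriv ?\<psi> (cinner z w) * cnj (w $ j))"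
    unfolding partial_deriv_def by (rule DERIV_imp_deriv)
  then show ?case by (simp add: mult_ac)
qed

lemma ridge_deriv_norm_bounded:
  fixes w :: "complex ^ 'n::finite"
  assumes \<phi>: "\<phi> holomorphic_on ball 0 1" and w: "norm w < 1"
  shows "\<exists>B\<ge>0. \<forall>z. norm z < 1 \<longrightarrow> deriv_norm m (\<lambda>z. \<phi> (cinner z w)) z \<le> B"
proof -
  let ?\<psi> = "(deriv ^^ m) \<phi>"
  have h: "?\<psi> holomorphic_on ball 0 1" by (rule holomorphic_higher_deriv[OF \<phi>]) simp
  have "continuous_on (cball 0 (norm w)) ?\<psi>"
    by (rule holomorphic_on_imp_continuous_on[OF holomorphic_on_subset[OF h]]) (use w in auto)
  then have "bounded (?\<psi> ` cball 0 (norm w))"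
    by (intro compact_imp_bounded compact_continuous_image compact_cball)
  then obtain K where K: "K > 0" "\<forall>x\<in>?\<psi> ` cball 0 (norm w). norm x \<le> K" unfolding bounded_pos by (elim exE conjE)
  let ?S = "{js :: 'n list. length js = m}"
  let ?P = "\<lambda>js. prod_list (map (\<lambda>j. cnj (w $ j)) js)"
  have "deriv_norm m (\<lambda>z. \<phi> (cinner z w)) z \<le> (\<Sum>js\<in>?S. cmod (?P js) * K)" if z: "norm z < 1" for z
  proof -
    have "cmod (cinner z w) \<le> norm z * norm w" by (rule cmod_cinner_le)
    also have "\<dots> \<le> 1 * norm w" using z by (intro mult_right_mono) auto
    finally have "cmod (?\<psi> (cinner z w)) \<le> K" using K(2) by simp
    have "deriv_norm m (\<lambda>z. \<phi> (cinner z w)) z \<le> (\<Sum>js\<in>?S. cmod (foldr partial_deriv js (\<lambda>z. \<phi> (cinner z w)) z))"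
      unfolding deriv_norm_def by (rule L2_set_le_sum) simp
    also have "\<dots> \<le> (\<Sum>js\<in>?S. cmod (?P js) * K)"
    proof (rule sum_mono)
      fix js assume "js \<in> ?S"
      then have "length js = m" by simp
      show "cmod (foldr partial_deriv js (\<lambda>z. \<phi> (cinner z w)) z) \<le> cmod (?P js) * K"
        unfolding ridge_partial_derivs[OF \<phi> w z] norm_mult \<open>length js = m\<close>
        by (rule mult_left_mono) (use \<open>cmod (?\<psi> (cinner z w)) \<le> K\<close> in simp_all)
    qed
    finally show ?thesis .
  qed
  moreover have "0 \<le> (\<Sum>js\<in>?S. cmod (?P js) * K)" using K(1) by (intro sum_nonneg) simp
  ultimately show ?thesis by blast
qed

text \<open>All derivatives are bounded on the ball, and the weight is integrable because $(m+\sigma)p > n$.\<close>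

lemma ridge_in_besov_sobolev:
  fixes w :: "complex ^ 'n::finite"
  assumes \<phi>: "\<phi> holomorphic_on ball 0 1" and w: "norm w < 1" and p: "p > 1" and m: "real CARD('n) / p < real m + \<sigma>"
  shows "(\<lambda>z. \<phi> (cinner z w)) \<in> besov_sobolev m p \<sigma>"
proof -
  let ?f = "\<lambda>z. \<phi> (cinner z w)"
  let ?t = "(real m + \<sigma>) * p - real CARD('n) - 1"
  have t: "?t > -1" using m p by (simp add: field_simps)
  obtain B where B: "B \<ge> 0" "\<forall>z. norm z < 1 \<longrightarrow> deriv_norm m ?f z \<le> B"
    using ridge_deriv_norm_bounded[OF \<phi> w, where m = m] by (elim exE conjE)
  obtain \<xi> :: "complex ^ 'n" where \<xi>: "norm \<xi> = 1" using unit_direction[of "0 :: complex ^ 'n"] by blast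
  obtain C where C: "C > 0" "\<forall>(\<xi> :: complex ^ 'n) \<delta>. norm \<xi> = 1 \<longrightarrow> 0 < \<delta> \<longrightarrow>
    (\<integral>\<^sup>+z\<in>carleson_region \<delta> \<xi>. ennreal ((1 - (norm z)\<^sup>2) powr ?t) \<partial>lborel) \<le> ennreal (C * \<delta> powr (real CARD('n) + 1 + ?t))"
    using carleson_region_weighted_volume[OF t, where ?'n = 'n] by (elim exE conjE)
  have [measurable]: "(unit_ball :: (complex ^ 'n) set) \<in> sets borel" by simp
  have spv: "space (ball_volume :: (complex ^ 'n) measure) = unit_ball" unfolding ball_volume_def by (simp add: space_restrict_space)
  then have spl: "space (ball_lambda :: (complex ^ 'n) measure) = unit_ball" unfolding ball_lambda_def by simp
  have vm: "g \<in> borel_measurable (ball_volume :: (complex ^ 'n) measure)" if "g \<in> borel_measurable borel" for g :: "complex ^ 'n \<Rightarrow> ennreal"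
    unfolding ball_volume_def using that by (intro measurable_restrict_space1) simp
  let ?dl = "\<lambda>z :: complex ^ 'n. ennreal ((1 - (norm z)\<^sup>2) powr (- real CARD('n) - 1))"
  let ?g = "\<lambda>z :: complex ^ 'n. ennreal (B powr p * (1 - (norm z)\<^sup>2) powr ((real m + \<sigma>) * p))"
  have gm: "?g \<in> borel_measurable borel" and dm: "?dl \<in> borel_measurable borel" by measurable
  have "(\<integral>\<^sup>+z. ennreal (((1 - (norm z)\<^sup>2) powr (m + \<sigma>) * deriv_norm m ?f z) powr p) \<partial>ball_lambda) \<le> (\<integral>\<^sup>+z. ?g z \<partial>ball_lambda)"
  proof (rule nn_integral_mono)
    fix z :: "complex ^ 'n" assume "z \<in> space ball_lambda"
    then have z: "norm z < 1" by (simp add: spl)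
    have dn: "0 \<le> deriv_norm m ?f z" by (simp add: deriv_norm_def L2_set_nonneg)
    have "((1 - (norm z)\<^sup>2) powr (m + \<sigma>) * deriv_norm m ?f z) powr p \<le> ((1 - (norm z)\<^sup>2) powr (m + \<sigma>) * B) powr p"
      using B(2) z dn p by (intro powr_mono2 mult_left_mono mult_nonneg_nonneg) simp_all
    also have "\<dots> = B powr p * (1 - (norm z)\<^sup>2) powr ((real m + \<sigma>) * p)"
      using B(1) by (simp add: powr_mult powr_powr mult.commute)
    finally show "ennreal (((1 - (norm z)\<^sup>2) powr (m + \<sigma>) * deriv_norm m ?f z) powr p) \<le> ?g z" by (rule ennreal_leI)
  qed
  also have "\<dots> = (\<integral>\<^sup>+z. ?dl z * ?g z \<partial>ball_volume)"
    unfolding ball_lambda_def by (rule nn_integral_density) (rule vm[OF dm], rule vm[OF gm])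
  also have "\<dots> = (\<integral>\<^sup>+z. ?dl z * ?g z * indicator unit_ball z \<partial>lborel) / emeasure lborel (unit_ball :: (complex ^ 'n) set)"
    by (rule nn_integral_ball_volume) measurable
  also have "(\<integral>\<^sup>+z. ?dl z * ?g z * indicator unit_ball z \<partial>lborel) = (\<integral>\<^sup>+z. ennreal (B powr p) * (ennreal ((1 - (norm z)\<^sup>2) powr ?t) * indicator (carleson_region 2 \<xi>) z) \<partial>lborel)"
  proof (rule nn_integral_cong)
    fix z :: "complex ^ 'n"
    have "z \<in> carleson_region 2 \<xi> \<longleftrightarrow> z \<in> unit_ball" using kernel_le_2[of z \<xi>] \<xi> by (auto simp: carleson_region_def)
    moreover have "(1 - (norm z)\<^sup>2) powr (- real CARD('n) - 1) * (B powr p * (1 - (norm z)\<^sup>2) powr ((real m + \<sigma>) * p)) = B powr p * (1 - (norm z)\<^sup>2) powr ?t"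
    proof -
      have "(1 - (norm z)\<^sup>2) powr ?t = (1 - (norm z)\<^sup>2) powr (- real CARD('n) - 1) * (1 - (norm z)\<^sup>2) powr ((real m + \<sigma>) * p)"
        unfolding powr_add[symmetric] by (rule arg_cong[where f = "\<lambda>x. _ powr x"]) simp
      then show ?thesis by (simp only: mult.left_commute)
    qed
    ultimately show "?dl z * ?g z * indicator unit_ball z = ennreal (B powr p) * (ennreal ((1 - (norm z)\<^sup>2) powr ?t) * indicator (carleson_region 2 \<xi>) z)"
      by (simp only: indicator_def ennreal_mult'[OF powr_ge_zero, symmetric] mult.assoc[symmetric])
  qed
  also have "\<dots> = ennreal (B powr p) * (\<integral>\<^sup>+z\<in>carleson_region 2 \<xi>. ennreal ((1 - (norm z)\<^sup>2) powr ?t) \<partial>lborel)"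
    by (rule nn_integral_cmult) measurable
  also have "\<dots> / emeasure lborel (unit_ball :: (complex ^ 'n) set) < \<infinity>"
  proof -
    have "(\<integral>\<^sup>+z\<in>carleson_region 2 \<xi>. ennreal ((1 - (norm z)\<^sup>2) powr ?t) \<partial>lborel) < \<infinity>"
      using C(2)[rule_format, OF \<xi>, of 2] by (simp add: le_less_trans)
    moreover have V: "measure lborel (unit_ball :: (complex ^ 'n) set) > 0" by (simp add: content_ball_pos)
    ultimately show ?thesis unfolding emeasure_lborel_ball divide_ennreal_def inverse_ennreal[OF V]
      by (simp add: ennreal_mult_less_top)
  qed
  finally have "(\<integral>\<^sup>+z. ennreal (((1 - (norm z)\<^sup>2) powr (m + \<sigma>) * deriv_norm m ?f z) powr p) \<partial>ball_lambda) < \<infinity>" .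
  then show ?thesis
    unfolding besov_sobolev_def using ridge_holomorphic[OF \<phi> w] by (simp add: ennreal_add_eq_top less_top)
qed

text \<open>On a ridge function the radial derivative acts as $u\frac{d}{du}$ on $\varphi$, so every one of the $m$ first-order
  factors raises the order of the pole by at most one.\<close>

lemma ridge_multiplier_bound:
  assumes f: "pole_class l \<phi>" and lm: "l + m \<ge> 1"
  shows "\<exists>A>0. \<forall>(w :: complex ^ 'n::finite) z. norm w < 1 \<longrightarrow> norm z < 1 \<longrightarrow>
     cmod (multiplier (shifted_product a 0 m) (\<lambda>z. \<phi> (cinner z w)) z) \<le> A * inverse (cmod (1 - cinner z w)) ^ (l + m)"
proof -
  have \<phi>: "\<phi> holomorphic_on ball 0 1" by (rule pole_class_holomorphic[OF f])
  define b where "b k = (deriv ^^ k) \<phi> 0 / fact k" for k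
  have s: "(\<lambda>k. b k * u ^ k) sums \<phi> u" if "cmod u < 1" for u
    using holomorphic_power_series[OF \<phi>, of u] that by (simp add: b_def)
  obtain g where g: "pole_class (l + m) g" "\<forall>u. cmod u < 1 \<longrightarrow> (\<lambda>k. shifted_product a 0 m k * b k * u ^ k) sums g u"
    using pole_class_shifted_product[OF f, where b = b and m = m and a = a] s by blast
  obtain A where A: "A > 0" "\<forall>u. cmod u < 1 \<longrightarrow> cmod (g u) \<le> A * inverse (cmod (1 - u)) ^ (l + m)"
    using pole_class_bound[OF g(1) lm] by (elim exE conjE)
  have "cmod (multiplier (shifted_product a 0 m) (\<lambda>z. \<phi> (cinner z w)) z) \<le> A * inverse (cmod (1 - cinner z w)) ^ (l + m)"
    if w: "norm w < 1" and z: "norm z < 1" for w z :: "complex ^ 'n"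
  proof -
    let ?f = "\<lambda>z. \<phi> (cinner z w)" and ?u = "cinner z w"
    have u: "cmod ?u < 1" by (rule cmod_cinner_less[OF z w])
    have lf: "line_holomorphic ?f" by (rule holomorphic_ball_imp_line[OF ridge_holomorphic[OF \<phi> w]])
    have "hom_part ?f k z = b k * ?u ^ k" for k
    proof (rule hom_part_eqI[OF lf, of 1])
      fix v :: complex assume v: "cmod v < 1"
      have "cmod (v * ?u) \<le> 1 * cmod ?u" unfolding norm_mult using v by (intro mult_right_mono) auto
      then have "cmod (v * ?u) < 1" using u by simp
      from s[OF this] show "(\<lambda>k. b k * ?u ^ k * v ^ k) sums \<phi> (cinner (v *s z) w)"
        by (simp add: cinner_scale_left power_mult_distrib mult_ac)
    qed (use z in simp_all)
    then have "multiplier (shifted_product a 0 m) ?f z = g ?u"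
      using sums_unique[OF g(2)[rule_format, OF u]] by (simp add: multiplier_def mult.assoc)
    then show ?thesis using A(2) u by simp
  qed
  then show ?thesis using A(1) by blast
qed

lemma nn_integral_lower_bound:
  assumes "A \<in> sets M" "\<And>z. z \<in> A \<Longrightarrow> c \<le> F z"
  shows "c * emeasure M A \<le> (\<integral>\<^sup>+z. F z \<partial>M)"
proof -
  have "c * emeasure M A = (\<integral>\<^sup>+z. c * indicator A z \<partial>M)" using assms(1) by (simp add: nn_integral_cmult_indicator)
  also have "\<dots> \<le> (\<integral>\<^sup>+z. F z \<partial>M)" using assms(2) by (intro nn_integral_mono) (simp add: indicator_def)
  finally show ?thesis .
qed

text \<open>The Carleson inequality applied to a ridge function. The Besov norm of a function with a pole of order $l$ is
  computed by the Forelli-Rudin estimate; with $l + m$ for the order of its $m$-th derivative, the exponent per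
  scale becomes $(l-\sigma)p$.\<close>

theorem ridge_test_estimate:
  fixes \<mu> :: "(complex ^ 'n::finite) measure"
  assumes car: "besov_carleson m \<alpha> p \<sigma> \<mu>" and m: "m > 0" and p: "p > 1" and ms: "real CARD('n) / p < real m + \<sigma>"
    and a: "real CARD('n) + 1 + \<alpha> \<notin> \<int>\<^sub>\<le>\<^sub>0" and f: "pole_class l \<phi>"
  shows "\<exists>C>0. \<forall>w. norm w < 1 \<longrightarrow> (\<integral>\<^sup>+z. ennreal (cmod (\<phi> (cinner z w)) powr p) \<partial>\<mu>)
     \<le> ennreal (C * (\<Sum>k\<in>{k. 1 - norm w < 2 * (1/2) ^ k}. 2 powr ((real l - \<sigma>) * p * real k)))"
proof -
  let ?a = "real CARD('n) + 1 + \<alpha>"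
  let ?t = "real m * p + \<sigma> * p - real CARD('n) - 1"
  let ?b = "real (l + m) * p"
  have t: "?t > -1" using ms p by (simp add: field_simps)
  have \<phi>: "\<phi> holomorphic_on ball 0 1" by (rule pole_class_holomorphic[OF f])
  obtain A where A: "A > 0" "\<forall>(w :: complex ^ 'n) z. norm w < 1 \<longrightarrow> norm z < 1 \<longrightarrow>
     cmod (multiplier (shifted_product ?a 0 m) (\<lambda>z. \<phi> (cinner z w)) z) \<le> A * inverse (cmod (1 - cinner z w)) ^ (l + m)"
    using ridge_multiplier_bound[OF f, of m, where ?'n = 'n and a = ?a] m by auto
  have b: "?b \<ge> 0" using p by simp
  obtain C where C: "C > 0" "\<forall>w :: complex ^ 'n. norm w < 1 \<longrightarrow>
    (\<integral>\<^sup>+z. ennreal (indicator unit_ball z * (cmod (1 - cinner z w) powr (- ?b) * (1 - (norm z)\<^sup>2) powr ?t)) \<partial>lborel)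
      \<le> ennreal (C * (\<Sum>k\<in>{k. 1 - norm w < 2 * (1/2) ^ k}. 2 powr ((?b - (real CARD('n) + 1 + ?t)) * real k)))"
    using forelli_rudin[OF t b, where ?'n = 'n] by (elim exE conjE)
  define c where "c = \<bar>1 / pochhammer ?a m\<bar> powr p / measure lborel (unit_ball :: (complex ^ 'n) set)"
  have c: "c > 0"
    unfolding c_def using pochhammer_nonzero[OF a, of m] content_ball_pos[of 1 "0 :: complex ^ 'n"] by simp
  obtain K where K: "K > 0" "\<forall>f\<in>besov_sobolev m p \<sigma>. (\<integral>\<^sup>+z. ennreal (cmod (f z) powr p) \<partial>\<mu>) \<le> ennreal K * besov_norm_pow m \<alpha> p \<sigma> f"
    using car unfolding besov_carleson_def by (elim exE conjE)
  have ex: "?b - (real CARD('n) + 1 + ?t) = (real l - \<sigma>) * p" by (simp add: algebra_simps)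
  have "(\<integral>\<^sup>+z. ennreal (cmod (\<phi> (cinner z w)) powr p) \<partial>\<mu>)
     \<le> ennreal (K * c * A powr p * C * (\<Sum>k\<in>{k. 1 - norm w < 2 * (1/2) ^ k}. 2 powr ((real l - \<sigma>) * p * real k)))"
    if w: "norm w < 1" for w :: "complex ^ 'n"
  proof -
    let ?f = "\<lambda>z. \<phi> (cinner z w)" and ?S = "\<Sum>k\<in>{k. 1 - norm w < 2 * (1/2) ^ k}. 2 powr ((real l - \<sigma>) * p * real k)"
    let ?h = "multiplier (shifted_product ?a 0 m) ?f"
    have lf: "line_holomorphic ?f" by (rule holomorphic_ball_imp_line[OF ridge_holomorphic[OF \<phi> w]])
    have "weighted_norm p ?t ?h \<le> (\<integral>\<^sup>+z. ennreal (A powr p) * ennreal (indicator unit_ball z * (cmod (1 - cinner z w) powr (- ?b) * (1 - (norm z)\<^sup>2) powr ?t)) \<partial>lborel)"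
      unfolding weighted_norm_def
    proof (rule nn_integral_mono)
      fix z :: "complex ^ 'n"
      show "ennreal (cmod (ball_ext ?h z) powr p * (1 - (norm z)\<^sup>2) powr ?t) \<le> ennreal (A powr p) * ennreal (indicator unit_ball z * (cmod (1 - cinner z w) powr (- ?b) * (1 - (norm z)\<^sup>2) powr ?t))"
      proof (cases "norm z < 1")
        case True
        have d: "0 < cmod (1 - cinner z w)" using True w by (intro kernel_pos) auto
        have "cmod (ball_ext ?h z) powr p \<le> (A * inverse (cmod (1 - cinner z w)) ^ (l + m)) powr p"
          unfolding ball_ext_in[OF True] using A(2) w True p by (intro powr_mono2) simp_all
        also have "\<dots> = A powr p * cmod (1 - cinner z w) powr (- ?b)"
        proof -
          have "inverse (cmod (1 - cinner z w)) ^ (l + m) = cmod (1 - cinner z w) powr (- real (l + m))"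
            unfolding power_inverse powr_minus powr_realpow[OF d] ..
          then have "(A * inverse (cmod (1 - cinner z w)) ^ (l + m)) powr p = A powr p * (cmod (1 - cinner z w) powr (- real (l + m))) powr p"
            using A(1) by (simp only: powr_mult less_imp_le powr_ge_zero)
          then show ?thesis by (simp only: powr_powr mult_minus_left)
        qed
        finally have "cmod (ball_ext ?h z) powr p * (1 - (norm z)\<^sup>2) powr ?t \<le> A powr p * cmod (1 - cinner z w) powr (- ?b) * (1 - (norm z)\<^sup>2) powr ?t"
          by (rule mult_right_mono) simp
        then have "ennreal (cmod (ball_ext ?h z) powr p * (1 - (norm z)\<^sup>2) powr ?t) \<le> ennreal (A powr p * (cmod (1 - cinner z w) powr (- ?b) * (1 - (norm z)\<^sup>2) powr ?t))"
          unfolding mult.assoc by (rule ennreal_leI)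
        then show ?thesis using True by (simp only: ennreal_mult'[OF powr_ge_zero[of A]] mem_ball_0 indicator_simps mult_1_left)
      qed (use p in \<open>simp add: ball_ext_out\<close>)
    qed
    also have "\<dots> = ennreal (A powr p) * (\<integral>\<^sup>+z. ennreal (indicator unit_ball z * (cmod (1 - cinner z w) powr (- ?b) * (1 - (norm z)\<^sup>2) powr ?t)) \<partial>lborel)"
    proof (rule nn_integral_cmult)
      have [measurable]: "(unit_ball :: (complex ^ 'n) set) \<in> sets borel" by simp
      show "(\<lambda>z. ennreal (indicator unit_ball z * (cmod (1 - cinner z w) powr (- ?b) * (1 - (norm z)\<^sup>2) powr ?t))) \<in> borel_measurable lborel" by measurable
    qed
    also have "\<dots> \<le> ennreal (A powr p) * ennreal (C * ?S)"
      using C(2)[rule_format, OF w] unfolding ex by (rule mult_left_mono) simp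
    finally have W: "weighted_norm p ?t ?h \<le> ennreal (A powr p) * ennreal (C * ?S)" .
    have "(\<integral>\<^sup>+z. ennreal (cmod (?f z) powr p) \<partial>\<mu>) \<le> ennreal K * besov_norm_pow m \<alpha> p \<sigma> ?f"
      by (rule K(2)[rule_format, OF ridge_in_besov_sobolev[OF \<phi> w p ms]])
    also have "\<dots> = ennreal K * (ennreal c * weighted_norm p ?t ?h)"
      using besov_norm_pow_eq[OF lf a, of p m \<sigma>, folded c_def] p by (simp only:)
    also have "\<dots> \<le> ennreal K * (ennreal c * (ennreal (A powr p) * ennreal (C * ?S)))"
      by (intro mult_left_mono W) simp_all
    also have "\<dots> = ennreal (K * c * A powr p * C * ?S)"
      using K(1) c by (simp add: ennreal_mult'[symmetric] mult.assoc)
    finally show ?thesis .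
  qed
  moreover have "K * c * A powr p * C > 0" using K(1) c A(1) C(1) by simp
  ultimately show ?thesis by blast
qed

section \<open>Suprema of quotients\<close>

lemma SUP_ratio_finiteD:
  assumes "(SUP (\<xi>, \<delta>) \<in> X. f \<xi> \<delta> / ennreal (g \<delta>)) < \<infinity>"
  shows "\<exists>S>0. \<forall>\<xi> \<delta>. (\<xi>, \<delta>) \<in> X \<longrightarrow> g \<delta> > 0 \<longrightarrow> f \<xi> \<delta> \<le> ennreal (S * g \<delta>)"
proof -
  let ?T = "SUP (\<xi>, \<delta>) \<in> X. f \<xi> \<delta> / ennreal (g \<delta>)"
  obtain s where s: "s \<ge> 0" "?T = ennreal s" using assms by (cases ?T) auto
  have "f \<xi> \<delta> \<le> ennreal ((s + 1) * g \<delta>)" if X: "(\<xi>, \<delta>) \<in> X" and g: "g \<delta> > 0" for \<xi> \<delta>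
  proof -
    have "f \<xi> \<delta> / ennreal (g \<delta>) \<le> ?T" by (rule SUP_upper2[OF X]) simp
    then have "f \<xi> \<delta> / ennreal (g \<delta>) \<le> ennreal s" unfolding s(2) .
    then have "f \<xi> \<delta> / ennreal (g \<delta>) * ennreal (g \<delta>) \<le> ennreal s * ennreal (g \<delta>)" by (rule mult_right_mono) simp
    also have "f \<xi> \<delta> / ennreal (g \<delta>) * ennreal (g \<delta>) = f \<xi> \<delta>"
      using g by (simp add: divide_ennreal_def inverse_ennreal mult.assoc ennreal_mult'[symmetric])
    also have "ennreal s * ennreal (g \<delta>) = ennreal (s * g \<delta>)" using s by (simp add: ennreal_mult')
    also have "\<dots> \<le> ennreal ((s + 1) * g \<delta>)" using g by (intro ennreal_leI mult_right_mono) auto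
    finally show ?thesis .
  qed
  then show ?thesis using s(1) by (intro exI[of _ "s + 1"]) simp
qed

lemma SUP_ratio_finiteI:
  assumes "\<And>\<xi> \<delta>. (\<xi>, \<delta>) \<in> X \<Longrightarrow> g \<delta> > 0 \<and> f \<xi> \<delta> \<le> ennreal (S * g \<delta>)"
  shows "(SUP (\<xi>, \<delta>) \<in> X. f \<xi> \<delta> / ennreal (g \<delta>)) < \<infinity>"
proof -
  have "(SUP (\<xi>, \<delta>) \<in> X. f \<xi> \<delta> / ennreal (g \<delta>)) \<le> ennreal S"
  proof (rule SUP_least)
    fix x assume "x \<in> X"
    then obtain \<xi> \<delta> where x: "x = (\<xi>, \<delta>)" "(\<xi>, \<delta>) \<in> X" by (cases x) simp
    have g: "g \<delta> > 0" and f: "f \<xi> \<delta> \<le> ennreal (S * g \<delta>)" using assms[OF x(2)] by auto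
    have "f \<xi> \<delta> / ennreal (g \<delta>) \<le> ennreal (S * g \<delta>) / ennreal (g \<delta>)" by (rule divide_right_mono_ennreal[OF f])
    also have "\<dots> = ennreal S"
      using g by (simp add: divide_ennreal_def inverse_ennreal ennreal_mult''[symmetric] mult.assoc)
    finally show "(case x of (\<xi>, \<delta>) \<Rightarrow> f \<xi> \<delta> / ennreal (g \<delta>)) \<le> ennreal S" by (simp add: x)
  qed
  then show ?thesis by (rule le_less_trans) simp
qed

section \<open>Growth of Carleson measures on Carleson regions\<close>

lemma carleson_region_sets:
  assumes "borel_measure_on_ball \<mu>"
  shows "carleson_region \<delta> \<xi> \<in> sets \<mu>" "unit_ball \<in> sets \<mu>"
proof -
  have s: "sets \<mu> = sets (restrict_space borel unit_ball)" using assms by (simp add: borel_measure_on_ball_def)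
  show "carleson_region \<delta> \<xi> \<in> sets \<mu>"
    unfolding s by (subst sets_restrict_space_iff) (auto simp: carleson_region_def[abs_def] intro: carleson_region_measurable[unfolded carleson_region_def])
  show "unit_ball \<in> sets \<mu>" unfolding s by (subst sets_restrict_space_iff) auto
qed

text \<open>The test function 1, which in the classes above is the pole of order 0.\<close>

lemma carleson_total_mass_finite:
  fixes \<mu> :: "(complex ^ 'n::finite) measure"
  assumes \<mu>: "borel_measure_on_ball \<mu>"
    and car: "besov_carleson m \<alpha> p \<sigma> \<mu>" and m: "m > 0" and p: "p > 1" and ms: "real CARD('n) / p < real m + \<sigma>"
    and a: "real CARD('n) + 1 + \<alpha> \<notin> \<int>\<^sub>\<le>\<^sub>0"
  shows "\<exists>T>0. emeasure \<mu> unit_ball \<le> ennreal T"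
proof -
  have pc: "pole_class 0 (\<lambda>u. 1 * inverse (1 - u) ^ 0)" by (rule pole_class.pow) simp
  obtain C where C: "C > 0" "\<forall>w. norm w < 1 \<longrightarrow> (\<integral>\<^sup>+z. ennreal (cmod (1 * inverse (1 - cinner z w) ^ 0) powr p) \<partial>\<mu>)
     \<le> ennreal (C * (\<Sum>k\<in>{k. 1 - norm w < 2 * (1/2) ^ k}. 2 powr ((real 0 - \<sigma>) * p * real k)))"
    using ridge_test_estimate[OF car m p ms a pc] by (elim exE conjE)
  let ?T = "C * (\<Sum>k\<in>{k. 1 - norm (0 :: complex ^ 'n) < 2 * (1/2) ^ k}. 2 powr ((real 0 - \<sigma>) * p * real k))"
  have T0: "?T \<ge> 0" using C(1) by (intro mult_nonneg_nonneg sum_nonneg) simp_all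
  have "1 * emeasure \<mu> unit_ball \<le> (\<integral>\<^sup>+z. ennreal (cmod (1 * inverse (1 - cinner z 0) ^ 0) powr p) \<partial>\<mu>)"
    by (rule nn_integral_lower_bound[OF carleson_region_sets(2)[OF \<mu>]]) simp
  also have "\<dots> \<le> ennreal ?T" using C(2)[rule_format, of 0] by simp
  also have "\<dots> \<le> ennreal (?T + 1)" by (rule ennreal_leI) simp
  finally have "emeasure \<mu> unit_ball \<le> ennreal (?T + 1)" by simp
  then show ?thesis using T0 by (intro exI[of _ "?T + 1"]) simp
qed

lemma emeasure_region_le_ball:
  assumes "borel_measure_on_ball \<mu>"
  shows "emeasure \<mu> (carleson_region \<delta> \<xi>) \<le> emeasure \<mu> unit_ball"
  by (rule emeasure_mono[OF _ carleson_region_sets(2)[OF assms]]) (auto simp: carleson_region_def)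

text \<open>The point $(1-\delta)\xi$ is the substitute for $\xi$ inside the ball: replacing $\xi$ by it changes the kernel by
  less than $\delta$.\<close>

lemma kernel_at_top_of_region:
  fixes \<xi> :: "complex ^ 'n::finite"
  assumes \<xi>: "norm \<xi> = 1" and d: "0 < \<delta>" "\<delta> \<le> 1" and z: "z \<in> carleson_region \<delta> \<xi>"
  shows "cmod (1 - cinner z ((1 - \<delta>) *\<^sub>R \<xi>)) < 2 * \<delta>" "0 < cmod (1 - cinner z ((1 - \<delta>) *\<^sub>R \<xi>))" "norm ((1 - \<delta>) *\<^sub>R \<xi>) = 1 - \<delta>"
proof -
  have z: "norm z < 1" "cmod (1 - cinner z \<xi>) < \<delta>" using z by (auto simp: carleson_region_def)
  show n: "norm ((1 - \<delta>) *\<^sub>R \<xi>) = 1 - \<delta>" using d \<xi> by simp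
  show "0 < cmod (1 - cinner z ((1 - \<delta>) *\<^sub>R \<xi>))" 
  proof (rule kernel_pos[OF z(1)])
    show "norm ((1 - \<delta>) *\<^sub>R \<xi>) \<le> 1" unfolding n using d by simp
  qed
  have "1 - cinner z ((1 - \<delta>) *\<^sub>R \<xi>) = (1 - cinner z \<xi>) + of_real \<delta> * cinner z \<xi>"
    unfolding cinner_scaleR_right by (simp add: algebra_simps)
  then have "cmod (1 - cinner z ((1 - \<delta>) *\<^sub>R \<xi>)) \<le> cmod (1 - cinner z \<xi>) + cmod (of_real \<delta> * cinner z \<xi>)"
    using norm_triangle_ineq[of "1 - cinner z \<xi>" "of_real \<delta> * cinner z \<xi>"] by (simp only:)
  also have "cmod (of_real \<delta> * cinner z \<xi>) = \<delta> * cmod (cinner z \<xi>)" using d by (simp add: norm_mult)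
  also have "\<delta> * cmod (cinner z \<xi>) \<le> \<delta> * 1"
    using cmod_cinner_le[of z \<xi>] \<xi> z(1) d by (intro mult_left_mono) auto
  finally show "cmod (1 - cinner z ((1 - \<delta>) *\<^sub>R \<xi>)) < 2 * \<delta>" using z(2) by simp
qed

lemma ennreal_mult_le_imp:
  assumes "c > 0" "ennreal c * X \<le> ennreal y" "y \<ge> 0"
  shows "X \<le> ennreal (y / c)"
proof -
  have "X = ennreal (1 / c) * (ennreal c * X)" using assms(1) by (simp add: mult.assoc[symmetric] ennreal_mult'[symmetric])
  also have "\<dots> \<le> ennreal (1 / c) * ennreal y" by (rule mult_left_mono[OF assms(2)]) simp
  also have "\<dots> = ennreal (y / c)" using assms by (simp add: ennreal_mult'[symmetric])
  finally show ?thesis .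
qed

text \<open>The test function $(1-\langle z,w\rangle)^{-s}$ with $w = (1-\delta)\xi$ and $\delta \le 1$ is at least $(2\delta)^{-s}$ on the region, and
  for an integer $s > \sigma$ the $p$-th power of its Besov norm is $O(\delta^{-(s-\sigma)p})$. The quotient is
  $O(\delta^{\sigma p})$. For $\delta > 1$ the total mass suffices.\<close>

lemma carleson_region_bound_sobolev:
  fixes \<mu> :: "(complex ^ 'n::finite) measure"
  assumes \<mu>: "borel_measure_on_ball \<mu>"
    and car: "besov_carleson m \<alpha> p \<sigma> \<mu>" and m: "m > 0" and p: "p > 1" and \<sigma>: "\<sigma> > 0" and ms: "real CARD('n) / p < real m + \<sigma>"
    and a: "real CARD('n) + 1 + \<alpha> \<notin> \<int>\<^sub>\<le>\<^sub>0"
  shows "\<exists>K>0. \<forall>\<xi> \<delta>. norm \<xi> = 1 \<longrightarrow> 0 < \<delta> \<longrightarrow> emeasure \<mu> (carleson_region \<delta> \<xi>) \<le> ennreal (K * \<delta> powr (\<sigma> * p))"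
proof -
  define s where "s = nat \<lceil>\<sigma>\<rceil> + 1"
  have s: "real s > \<sigma>" using real_nat_ceiling_ge[of \<sigma>] by (simp add: s_def)
  define \<beta> where "\<beta> = (real s - \<sigma>) * p"
  have \<beta>: "\<beta> > 0" using s p by (simp add: \<beta>_def)
  have pc: "pole_class s (\<lambda>u. 1 * inverse (1 - u) ^ s)" by (rule pole_class.pow) simp
  obtain C where C: "C > 0" "\<forall>w. norm w < 1 \<longrightarrow> (\<integral>\<^sup>+z. ennreal (cmod (1 * inverse (1 - cinner z w) ^ s) powr p) \<partial>\<mu>)
     \<le> ennreal (C * (\<Sum>k\<in>{k. 1 - norm w < 2 * (1/2) ^ k}. 2 powr ((real s - \<sigma>) * p * real k)))"
    using ridge_test_estimate[OF car m p ms a pc] by (elim exE conjE)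
  obtain C' where C': "C' > 0" "\<forall>x. 0 < x \<longrightarrow> x \<le> 1 \<longrightarrow> (\<Sum>k\<in>{k. x < 2 * (1/2) ^ k}. 2 powr (\<beta> * real k)) \<le> C' * x powr (- \<beta>)"
    using sum_dyadic_powr[OF \<beta>] by (elim exE conjE)
  obtain T where T: "T > 0" "emeasure \<mu> unit_ball \<le> ennreal T"
    using carleson_total_mass_finite[OF \<mu> car m p ms a] by (elim exE conjE)
  define K where "K = C * C' * 2 powr (real s * p) + T"
  have K: "K > 0" using C(1) C'(1) T(1) by (simp add: K_def add_pos_pos)
  have "emeasure \<mu> (carleson_region \<delta> \<xi>) \<le> ennreal (K * \<delta> powr (\<sigma> * p))" if \<xi>: "norm \<xi> = 1" and d: "0 < \<delta>" for \<xi> \<delta>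
  proof (cases "\<delta> \<le> 1")
    case False
    have "emeasure \<mu> (carleson_region \<delta> \<xi>) \<le> ennreal T"
      by (rule order_trans[OF emeasure_region_le_ball[OF \<mu>] T(2)])
    also have "\<dots> \<le> ennreal (K * \<delta> powr (\<sigma> * p))"
    proof (rule ennreal_leI)
      have "1 \<le> \<delta> powr (\<sigma> * p)" using False \<sigma> p by (intro ge_one_powr_ge_zero) auto
      moreover have "T \<le> K" using C(1) C'(1) by (simp add: K_def)
      ultimately have "T * 1 \<le> K * \<delta> powr (\<sigma> * p)" using T(1) K by (intro mult_mono) auto
      then show "T \<le> K * \<delta> powr (\<sigma> * p)" by simp
    qed
    finally show ?thesis .
  next
    case True
    let ?w = "(1 - \<delta>) *\<^sub>R \<xi>"
    have nw: "norm ?w = 1 - \<delta>" using True d \<xi> by simp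
    let ?c = "(2 * \<delta>) powr (- (real s * p))"
    have "ennreal ?c * emeasure \<mu> (carleson_region \<delta> \<xi>) \<le> (\<integral>\<^sup>+z. ennreal (cmod (1 * inverse (1 - cinner z ?w) ^ s) powr p) \<partial>\<mu>)"
    proof (rule nn_integral_lower_bound[OF carleson_region_sets(1)[OF \<mu>]], rule ennreal_leI)
      fix z assume z: "z \<in> carleson_region \<delta> \<xi>"
      note k = kernel_at_top_of_region[OF \<xi> d True z]
      have "?c \<le> cmod (1 - cinner z ?w) powr (- (real s * p))"
        using k(1,2) p by (intro powr_mono2') auto
      also have "\<dots> = (cmod (1 - cinner z ?w) powr (- real s)) powr p" by (simp only: powr_powr mult_minus_left)
      also have "cmod (1 - cinner z ?w) powr (- real s) = cmod (1 * inverse (1 - cinner z ?w) ^ s)"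
        unfolding powr_minus powr_realpow[OF k(2)] by (simp add: norm_power norm_inverse power_inverse)
      finally show "?c \<le> cmod (1 * inverse (1 - cinner z ?w) ^ s) powr p" .
    qed
    also have "\<dots> \<le> ennreal (C * (C' * \<delta> powr (- \<beta>)))"
    proof -
      have "(\<Sum>k\<in>{k. 1 - norm ?w < 2 * (1/2) ^ k}. 2 powr ((real s - \<sigma>) * p * real k)) \<le> C' * \<delta> powr (- \<beta>)"
        using C'(2)[rule_format, OF d True] unfolding nw \<beta>_def by simp
      then have "ennreal (C * (\<Sum>k\<in>{k. 1 - norm ?w < 2 * (1/2) ^ k}. 2 powr ((real s - \<sigma>) * p * real k))) \<le> ennreal (C * (C' * \<delta> powr (- \<beta>)))"
        using C(1) by (intro ennreal_leI mult_left_mono) simp_all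
      moreover have "norm ?w < 1" using nw d by simp
      ultimately show ?thesis using C(2) order_trans by blast
    qed
    finally have "emeasure \<mu> (carleson_region \<delta> \<xi>) \<le> ennreal (C * (C' * \<delta> powr (- \<beta>)) / ?c)"
      using d C(1) C'(1) by (intro ennreal_mult_le_imp) simp_all
    also have "\<dots> \<le> ennreal (K * \<delta> powr (\<sigma> * p))"
    proof (rule ennreal_leI)
      have "1 / ?c = (2 * \<delta>) powr (real s * p)" by (simp add: powr_minus_divide)
      also have "\<dots> = 2 powr (real s * p) * \<delta> powr (real s * p)" using d by (simp add: powr_mult)
      finally have inv: "1 / ?c = 2 powr (real s * p) * \<delta> powr (real s * p)" .
      have "\<delta> powr (- \<beta>) * \<delta> powr (real s * p) = \<delta> powr (\<sigma> * p)"
        unfolding powr_add[symmetric] \<beta>_def by (rule arg_cong[where f = "\<lambda>x. _ powr x"]) (simp add: algebra_simps)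
      then have "C * (C' * \<delta> powr (- \<beta>)) * (1 / ?c) = C * C' * 2 powr (real s * p) * \<delta> powr (\<sigma> * p)"
        unfolding inv by (metis (no_types, opaque_lifting) mult.assoc mult.commute)
      also have "\<dots> \<le> K * \<delta> powr (\<sigma> * p)" using T(1) by (intro mult_right_mono) (simp_all add: K_def)
      finally show "C * (C' * \<delta> powr (- \<beta>)) / ?c \<le> K * \<delta> powr (\<sigma> * p)" by simp
    qed
    finally show ?thesis .
  qed
  then show ?thesis using K by blast
qed

text \<open>For $\sigma = 0$ a logarithm is the better test function: with $w = (1-\delta)\xi$ it is at least a constant times
  $\log\frac{2}{\delta}$ on the region, whereas the $p$-th power of its Besov norm is bounded by the
  number of scales between $\delta$ and 1, which is $O(\log\frac{2}{\delta})$. The quotient is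
  $O((\log\frac{2}{\delta})^{1-p})$. Regions of radius above $1/4$ are estimated by the total mass.\<close>

lemma carleson_region_bound_dirichlet:
  fixes \<mu> :: "(complex ^ 'n::finite) measure"
  assumes \<mu>: "borel_measure_on_ball \<mu>"
    and car: "besov_carleson m \<alpha> p 0 \<mu>" and m: "m > 0" and p: "p > 1" and ms: "real CARD('n) / p < real m + 0"
    and a: "real CARD('n) + 1 + \<alpha> \<notin> \<int>\<^sub>\<le>\<^sub>0"
  shows "\<exists>K>0. \<forall>\<xi> \<delta>. norm \<xi> = 1 \<longrightarrow> 0 < \<delta> \<longrightarrow> \<delta> < 2 \<longrightarrow> emeasure \<mu> (carleson_region \<delta> \<xi>) \<le> ennreal (K * ln (2 / \<delta>) powr (1 - p))"
proof -
  have pc: "pole_class 0 (\<lambda>u. 1 * Ln (1 - u))" by (rule pole_class.ln)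
  obtain C where C: "C > 0" "\<forall>w. norm w < 1 \<longrightarrow> (\<integral>\<^sup>+z. ennreal (cmod (1 * Ln (1 - cinner z w)) powr p) \<partial>\<mu>)
     \<le> ennreal (C * (\<Sum>k\<in>{k. 1 - norm w < 2 * (1/2) ^ k}. 2 powr ((real 0 - 0) * p * real k)))"
    using ridge_test_estimate[OF car m p ms a pc] by (elim exE conjE)
  obtain T where T: "T > 0" "emeasure \<mu> unit_ball \<le> ennreal T"
    using carleson_total_mass_finite[OF \<mu> car m p ms a] by (elim exE conjE)
  define K where "K = C * 3 * 3 powr p + T * ln 8 powr (p - 1)"
  have K: "K > 0" using C(1) T(1) by (simp add: K_def add_pos_nonneg)
  have "emeasure \<mu> (carleson_region \<delta> \<xi>) \<le> ennreal (K * ln (2 / \<delta>) powr (1 - p))"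
    if \<xi>: "norm \<xi> = 1" and d: "0 < \<delta>" "\<delta> < 2" for \<xi> \<delta>
  proof (cases "\<delta> \<le> 1/4")
    case False
    have L: "0 < ln (2 / \<delta>)" "ln (2 / \<delta>) \<le> ln 8"
      using d False by (auto simp: field_simps)
    have "emeasure \<mu> (carleson_region \<delta> \<xi>) \<le> ennreal T"
      by (rule order_trans[OF emeasure_region_le_ball[OF \<mu>] T(2)])
    also have "\<dots> \<le> ennreal (K * ln (2 / \<delta>) powr (1 - p))"
    proof (rule ennreal_leI)
      have "T = T * ln 8 powr (p - 1) * ln 8 powr (1 - p)"
        unfolding mult.assoc powr_add[symmetric] by simp
      also have "\<dots> \<le> T * ln 8 powr (p - 1) * ln (2 / \<delta>) powr (1 - p)"
        using L p T(1) by (intro mult_left_mono powr_mono2') auto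
      also have "\<dots> \<le> K * ln (2 / \<delta>) powr (1 - p)" using C(1) by (intro mult_right_mono) (simp_all add: K_def)
      finally show "T \<le> K * ln (2 / \<delta>) powr (1 - p)" .
    qed
    finally show ?thesis .
  next
    case True
    define L where "L = ln (2 / \<delta>)"
    have ln2: "1/2 < ln (2::real)" using ln2_ge_two_thirds by linarith
    \<comment> \<open>for \<delta> \<le> 1/4 the logarithm of 1 / (2 \<delta>) is at least a third of L\<close>
    have split: "L = 2 * ln 2 + ln (1 / (2 * \<delta>))"
    proof -
      have "2 / \<delta> = 4 * (1 / (2 * \<delta>))" using d by simp
      then have "L = ln 4 + ln (1 / (2 * \<delta>))" 
      proof -
        have "ln (4 * (1 / (2 * \<delta>))) = ln 4 + ln (1 / (2 * \<delta>))" using d by (subst ln_mult) simp_all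
        then show ?thesis unfolding L_def \<open>2 / \<delta> = 4 * (1 / (2 * \<delta>))\<close> .
      qed
      moreover have "ln (4::real) = 2 * ln 2" using ln_realpow[of 2 2] by simp
      ultimately show ?thesis by simp
    qed
    have "ln 2 \<le> ln (1 / (2 * \<delta>))" using d True by (subst ln_le_cancel_iff) (auto simp: field_simps)
    then have third: "L / 3 \<le> ln (1 / (2 * \<delta>))" and L1: "1 \<le> L" using split ln2 by linarith+
    have d1: "\<delta> \<le> 1" using True by simp
    let ?w = "(1 - \<delta>) *\<^sub>R \<xi>"
    have nw: "norm ?w = 1 - \<delta>" using d1 d \<xi> by simp
    let ?c = "(L / 3) powr p"
    have "ennreal ?c * emeasure \<mu> (carleson_region \<delta> \<xi>) \<le> (\<integral>\<^sup>+z. ennreal (cmod (1 * Ln (1 - cinner z ?w)) powr p) \<partial>\<mu>)"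
    proof (rule nn_integral_lower_bound[OF carleson_region_sets(1)[OF \<mu>]], rule ennreal_leI)
      fix z assume z: "z \<in> carleson_region \<delta> \<xi>"
      note k = kernel_at_top_of_region[OF \<xi> d(1) d1 z]
      have "ln (cmod (1 - cinner z ?w)) \<le> ln (2 * \<delta>)" using k(1,2) d(1) by (subst ln_le_cancel_iff) auto
      moreover have "ln (1 / (2 * \<delta>)) = - ln (2 * \<delta>)" using d by (simp add: ln_div)
      moreover have "Re (Ln (1 - cinner z ?w)) = ln (cmod (1 - cinner z ?w))" using k(2) by (intro Re_Ln) auto
      moreover have "- Re (Ln (1 - cinner z ?w)) \<le> cmod (Ln (1 - cinner z ?w))"
        using abs_Re_le_cmod[of "Ln (1 - cinner z ?w)"] by linarith
      ultimately have "L / 3 \<le> cmod (1 * Ln (1 - cinner z ?w))" using third by (simp only: mult_1_left)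
      then show "?c \<le> cmod (1 * Ln (1 - cinner z ?w)) powr p" using L1 p by (intro powr_mono2) auto
    qed
    also have "\<dots> \<le> ennreal (C * (3 * L))"
    proof -
      have "(\<Sum>k\<in>{k. 1 - norm ?w < 2 * (1/2::real) ^ k}. 2 powr ((real 0 - 0) * p * real k)) = real (card {k. \<delta> < 2 * (1/2::real) ^ k})"
        unfolding nw by simp
      also have "\<dots> \<le> 1 + log 2 (2 / \<delta>)" by (rule card_dyadic_le[OF d(1) d1])
      also have "\<dots> = 1 + L / ln 2" by (simp add: log_def L_def)
      also have "L / ln 2 \<le> 2 * L"
      proof -
        have "L * 1 \<le> L * (2 * ln 2)" using ln2 L1 by (intro mult_left_mono) auto
        then show ?thesis using ln2 by (simp add: field_simps)
      qed
      finally have "(\<Sum>k\<in>{k. 1 - norm ?w < 2 * (1/2::real) ^ k}. 2 powr ((real 0 - 0) * p * real k)) \<le> 3 * L" using L1 by simp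
      then have "ennreal (C * (\<Sum>k\<in>{k. 1 - norm ?w < 2 * (1/2::real) ^ k}. 2 powr ((real 0 - 0) * p * real k))) \<le> ennreal (C * (3 * L))"
        using C(1) by (intro ennreal_leI mult_left_mono) simp_all
      moreover have "norm ?w < 1" using nw d by simp
      ultimately show ?thesis using C(2) order_trans by blast
    qed
    finally have "emeasure \<mu> (carleson_region \<delta> \<xi>) \<le> ennreal (C * (3 * L) / ?c)"
      using L1 C(1) by (intro ennreal_mult_le_imp) simp_all
    also have "\<dots> \<le> ennreal (K * ln (2 / \<delta>) powr (1 - p))"
    proof (rule ennreal_leI)
      have "C * (3 * L) / ?c = C * 3 * 3 powr p * (L / L powr p)" using L1 by (simp add: powr_divide)
      also have "L / L powr p = L powr (1 - p)" using L1 by (simp add: powr_diff)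
      also have "C * 3 * 3 powr p * L powr (1 - p) \<le> K * L powr (1 - p)" using T(1) by (intro mult_right_mono) (simp_all add: K_def)
      finally show "C * (3 * L) / ?c \<le> K * ln (2 / \<delta>) powr (1 - p)" by (simp only: L_def)
    qed
    finally show ?thesis .
  qed
  then show ?thesis using K by blast
qed

section \<open>Growth conditions with a margin\<close>

text \<open>The margin $\varepsilon$ is spent on the geometric weight $\omega_k = 2^{-k\varepsilon/(p-1)}$.\<close>

lemma sufficiency_sobolev:
  fixes \<mu> :: "(complex ^ 'n::finite) measure"
  assumes \<mu>: "borel_measure_on_ball \<mu>" and p: "p > 1" and \<sigma>: "\<sigma> \<ge> 0"
    and a: "real CARD('n) + 1 + \<alpha> \<notin> \<int>\<^sub>\<le>\<^sub>0" and \<epsilon>: "\<epsilon> > 0"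
    and q: "q_carleson ((\<sigma> * p + \<epsilon>) / real CARD('n)) \<mu>"
  shows "besov_carleson m \<alpha> p \<sigma> \<mu>"
proof -
  let ?e = "\<sigma> * p + \<epsilon>"
  have n: "real CARD('n) * (?e / real CARD('n)) = ?e" by simp
  obtain S where S: "S > 0" "\<forall>\<xi> \<delta>. (\<xi>, \<delta>) \<in> unit_sphere \<times> {0<..} \<longrightarrow> \<delta> powr ?e > 0 \<longrightarrow> emeasure \<mu> (carleson_region \<delta> \<xi>) \<le> ennreal (S * \<delta> powr ?e)"
    using SUP_ratio_finiteD[OF q[unfolded q_carleson_def n]] by (elim exE conjE)
  define \<omega> where "\<omega> k = ((1/2::real) ^ k) powr (\<epsilon> / (p - 1))" for k :: nat
  define r where "r = (1/2::real) powr (\<epsilon> / (p - 1))"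
  have r: "0 < r" "r < 1" unfolding r_def using \<epsilon> p powr01_less_one[of "1/2" "\<epsilon> / (p - 1)"] by simp_all
  have \<omega>r: "\<omega> k = r ^ k" for k
  proof -
    have "\<omega> k = (1/2) powr (real k * (\<epsilon> / (p - 1)))" unfolding \<omega>_def by (simp add: powr_powr flip: powr_realpow)
    also have "\<dots> = r powr real k" unfolding r_def powr_powr by (simp only: mult.commute)
    also have "\<dots> = r ^ k" by (rule powr_realpow[OF r(1)])
    finally show ?thesis .
  qed
  show ?thesis
  proof (rule dyadic_carleson_sufficient[OF \<mu> p \<sigma> a])
    show "\<omega> k > 0" for k by (simp add: \<omega>_def)
    show "summable \<omega>" unfolding \<omega>r[abs_def] using r by (intro summable_geometric) simp
    show "S * 4 powr ?e > 0" using S(1) by simp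
    fix \<xi> :: "complex ^ 'n" and k :: nat assume \<xi>: "norm \<xi> = 1"
    have "emeasure \<mu> (carleson_region (4 * (1/2) ^ k) \<xi>) \<le> ennreal (S * (4 * (1/2) ^ k) powr ?e)"
      using S(2)[rule_format, of \<xi> "4 * (1/2) ^ k"] \<xi> by simp
    also have "S * (4 * (1/2) ^ k) powr ?e = S * 4 powr ?e * (((1/2) ^ k) powr (\<sigma> * p) * \<omega> k powr (p - 1))"
    proof -
      have "\<omega> k powr (p - 1) = ((1/2) ^ k) powr \<epsilon>" unfolding \<omega>_def powr_powr using p by simp
      then show ?thesis by (simp only: powr_mult powr_add zero_le_numeral zero_le_power zero_le_divide_1_iff mult_ac)
    qed
    finally show "emeasure \<mu> (carleson_region (4 * (1/2) ^ k) \<xi>) \<le> ennreal (S * 4 powr ?e * (((1/2) ^ k) powr (\<sigma> * p) * \<omega> k powr (p - 1)))" .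
  qed
qed

text \<open>By the parallelogram law $|1-u|$ and $|1+u|$ cannot both be at least $3/2$ when $|u| \le 1$.\<close>

lemma unit_ball_two_regions:
  fixes \<xi> :: "complex ^ 'n::finite"
  assumes "norm \<xi> = 1"
  shows "unit_ball \<subseteq> carleson_region (3/2) \<xi> \<union> carleson_region (3/2) (- \<xi>)"
proof
  fix z :: "complex ^ 'n" assume "z \<in> unit_ball"
  then have z: "norm z < 1" by simp
  let ?u = "cinner z \<xi>"
  have m: "cinner z (- \<xi>) = - ?u" using cinner_scaleR_right[of z "-1" \<xi>] by simp
  have u: "cmod ?u \<le> 1" using cmod_cinner_le[of z \<xi>] assms z by simp
  have "(cmod (1 - ?u))\<^sup>2 + (cmod (1 + ?u))\<^sup>2 = 2 + 2 * (cmod ?u)\<^sup>2"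
    unfolding cmod_power2 by (simp add: power2_eq_square algebra_simps)
  moreover have "(cmod ?u)\<^sup>2 \<le> 1" using u by (simp add: power_le_one)
  moreover have "(3/2)\<^sup>2 \<le> (cmod (1 - ?u))\<^sup>2" if "3/2 \<le> cmod (1 - ?u)" using that by (intro power_mono) auto
  moreover have "(3/2)\<^sup>2 \<le> (cmod (1 + ?u))\<^sup>2" if "3/2 \<le> cmod (1 + ?u)" using that by (intro power_mono) auto
  ultimately have "cmod (1 - ?u) < 3/2 \<or> cmod (1 + ?u) < 3/2" by (force simp: power2_eq_square)
  then show "z \<in> carleson_region (3/2) \<xi> \<union> carleson_region (3/2) (- \<xi>)"
    using z m by (auto simp: carleson_region_def)
qed

text \<open>Here the margin $\varepsilon$ is spent on the weight $\omega_k = (k+1)^{-1-\varepsilon/(p-1)}$, whose power $p-1$ is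
  comparable to the value of $(\log\frac{2}{\delta})^{1-p-\varepsilon}$ at $\delta = 4\cdot 2^{-k}$.\<close>

lemma sufficiency_dirichlet:
  fixes \<mu> :: "(complex ^ 'n::finite) measure"
  assumes \<mu>: "borel_measure_on_ball \<mu>" and p: "p > 1"
    and a: "real CARD('n) + 1 + \<alpha> \<notin> \<int>\<^sub>\<le>\<^sub>0" and \<epsilon>: "\<epsilon> > 0"
    and sup: "(SUP (\<xi>, \<delta>) \<in> unit_sphere \<times> {0<..<2}.
                  emeasure \<mu> (carleson_region \<delta> \<xi>) / ennreal (ln (2 / \<delta>) powr (1 - p - \<epsilon>))) < \<infinity>"
  shows "besov_carleson m \<alpha> p 0 \<mu>"
proof -
  define x where "x = p - 1 + \<epsilon>"
  have x: "x > 0" "1 - p - \<epsilon> = - x" using p \<epsilon> by (simp_all add: x_def)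
  obtain S where S: "S > 0" "\<forall>\<xi> \<delta>. (\<xi>, \<delta>) \<in> unit_sphere \<times> {0<..<2} \<longrightarrow> ln (2 / \<delta>) powr (- x) > 0 \<longrightarrow> emeasure \<mu> (carleson_region \<delta> \<xi>) \<le> ennreal (S * ln (2 / \<delta>) powr (- x))"
    using SUP_ratio_finiteD[OF sup[unfolded x(2)]] by (elim exE conjE)
  have region: "emeasure \<mu> (carleson_region \<delta> \<xi>) \<le> ennreal (S * ln (2 / \<delta>) powr (- x))" if "norm \<xi> = 1" "0 < \<delta>" "\<delta> < 2" for \<xi> \<delta>
  proof -
    have "ln (2 / \<delta>) > 0" using that by (simp add: field_simps)
    then show ?thesis using S(2)[rule_format, of \<xi> \<delta>] that by simp
  qed
  \<comment> \<open>the regions of radius 4 and 2 (k < 2) are outside the range of the hypothesis, and are covered by two regions of radius 3/2\<close>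
  define c0 where "c0 = ln (2 / (3/2::real)) powr (- x)"
  have c0: "c0 > 0" by (simp add: c0_def)
  define D where "D = S * 6 powr x + 2 * (S * c0) * 2 powr x"
  have D: "D > 0" using S(1) c0 by (simp add: D_def add_pos_pos)
  define \<omega> where "\<omega> k = (real k + 1) powr (- (x / (p - 1)))" for k :: nat
  have \<omega>p: "\<omega> k powr (p - 1) = (real k + 1) powr (- x)" for k
    unfolding \<omega>_def powr_powr using p by simp
  show ?thesis
  proof (rule dyadic_carleson_sufficient[OF \<mu> p order_refl a])
    show "\<omega> k > 0" for k by (simp add: \<omega>_def)
    have "- (x / (p - 1)) < -1" using p \<epsilon> by (simp add: x_def field_simps)
    then have "summable (\<lambda>k. real k powr (- (x / (p - 1))))" by (simp add: summable_real_powr_iff)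
    then have "summable (\<lambda>k. real (k + 1) powr (- (x / (p - 1))))" by (rule summable_ignore_initial_segment)
    then show "summable \<omega>" unfolding \<omega>_def[abs_def] by (simp add: add.commute)
    show "D > 0" by (rule D)
    fix \<xi> :: "complex ^ 'n" and k :: nat assume \<xi>: "norm \<xi> = 1"
    have "emeasure \<mu> (carleson_region (4 * (1/2) ^ k) \<xi>) \<le> ennreal (D * (real k + 1) powr (- x))"
    proof (cases "k < 2")
      case True
      have "emeasure \<mu> (carleson_region (4 * (1/2) ^ k) \<xi>) \<le> emeasure \<mu> (carleson_region (3/2) \<xi> \<union> carleson_region (3/2) (- \<xi>))"
        using unit_ball_two_regions[OF \<xi>] by (intro emeasure_mono sets.Un carleson_region_sets[OF \<mu>]) (auto simp: carleson_region_def)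
      also have "\<dots> \<le> emeasure \<mu> (carleson_region (3/2) \<xi>) + emeasure \<mu> (carleson_region (3/2) (- \<xi>))"
        by (intro emeasure_subadditive carleson_region_sets[OF \<mu>])
      also have "\<dots> \<le> ennreal (S * c0) + ennreal (S * c0)"
        unfolding c0_def using \<xi> by (intro add_mono region) simp_all
      also have "\<dots> = ennreal (2 * (S * c0))"
        using S(1) c0 by (subst ennreal_plus[symmetric]) simp_all
      also have "\<dots> \<le> ennreal (D * (real k + 1) powr (- x))"
      proof (rule ennreal_leI)
        have "2 powr (- x) \<le> (real k + 1) powr (- x)" using True x(1) by (intro powr_mono2') auto
        moreover have "2 powr x * 2 powr (- x) = (1::real)" unfolding powr_add[symmetric] by simp
        ultimately have "1 \<le> 2 powr x * (real k + 1) powr (- x)" using mult_left_mono[of "2 powr (- x)" "(real k + 1) powr (- x)" "2 powr x"] by simp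
        then have "2 * (S * c0) * 1 \<le> 2 * (S * c0) * (2 powr x * (real k + 1) powr (- x))" using S(1) c0 by (intro mult_left_mono) simp_all
        also have "\<dots> \<le> D * (real k + 1) powr (- x)"
          unfolding mult.assoc[symmetric] using S(1) by (intro mult_right_mono) (simp_all add: D_def)
        finally show "2 * (S * c0) \<le> D * (real k + 1) powr (- x)" by simp
      qed
      finally show ?thesis .
    next
      case False
      define j where "j = k - 2"
      have k: "k = j + 2" using False by (simp add: j_def)
      have \<delta>: "4 * (1/2::real) ^ k = (1/2) ^ j" by (simp add: k power_add)
      have "2 / (1/2::real) ^ j = 2 ^ (j + 1)" by (simp add: power_divide)
      then have lnj: "ln (2 / (1/2::real) ^ j) = real (j + 1) * ln 2" by (simp only: ln_realpow zero_less_numeral)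
      have low: "(real k + 1) / 6 \<le> ln (2 / (1/2::real) ^ j)"
      proof -
        have "(real k + 1) / 6 \<le> real (j + 1) * (1/2)" by (simp add: k field_simps)
        also have "\<dots> \<le> real (j + 1) * ln 2" using ln2_ge_two_thirds by (intro mult_left_mono) auto
        finally show ?thesis unfolding lnj .
      qed
      have "(1/2::real) ^ j \<le> 1" by (simp add: power_le_one)
      then have "emeasure \<mu> (carleson_region ((1/2) ^ j) \<xi>) \<le> ennreal (S * ln (2 / (1/2) ^ j) powr (- x))"
        by (intro region[OF \<xi>]) auto
      also have "\<dots> \<le> ennreal (D * (real k + 1) powr (- x))"
      proof (rule ennreal_leI)
        have "ln (2 / (1/2) ^ j) powr (- x) \<le> ((real k + 1) / 6) powr (- x)" using low x(1) by (intro powr_mono2') auto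
        also have "\<dots> = 6 powr x * (real k + 1) powr (- x)" by (simp add: powr_divide powr_minus field_simps)
        finally have "S * ln (2 / (1/2) ^ j) powr (- x) \<le> S * (6 powr x * (real k + 1) powr (- x))" using S(1) by (intro mult_left_mono) simp_all
        also have "\<dots> \<le> D * (real k + 1) powr (- x)"
          unfolding mult.assoc[symmetric] using S(1) c0 by (intro mult_right_mono) (simp_all add: D_def)
        finally show "S * ln (2 / (1/2) ^ j) powr (- x) \<le> D * (real k + 1) powr (- x)" .
      qed
      finally show ?thesis unfolding \<delta> .
    qed
    then show "emeasure \<mu> (carleson_region (4 * (1/2) ^ k) \<xi>) \<le> ennreal (D * (((1/2) ^ k) powr (0 * p) * \<omega> k powr (p - 1)))"
      unfolding \<omega>p by simp
  qed
qed

section \<open>Carleson measures for Besov-Sobolev spaces\<close>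

theorem theorem2p1:
  fixes \<mu> :: "(complex ^ 'n::finite) measure"
    and m :: nat and \<sigma> p \<alpha> :: real
  assumes "CARD('n) > 1"
    and "m > 0" and "0 \<le> \<sigma>" and "1 < p"
    and "real m + \<sigma> > real CARD('n) / p"
    and "real CARD('n) + \<alpha> \<notin> {x \<in> \<int>. x < 0}"
    and "real CARD('n) + \<alpha> + real m \<notin> {x \<in> \<int>. x < 0}"
    and "borel_measure_on_ball \<mu>"
  shows "(\<sigma> > 0 \<longrightarrow>
            (besov_carleson m \<alpha> p \<sigma> \<mu> \<longrightarrow> q_carleson (\<sigma> * p / real CARD('n)) \<mu>) \<and>
            (\<forall>\<epsilon>>0. q_carleson ((\<sigma> * p + \<epsilon>) / real CARD('n)) \<mu> \<longrightarrow> besov_carleson m \<alpha> p \<sigma> \<mu>)) \<and>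
         (\<sigma> = 0 \<longrightarrow>
            (besov_carleson m \<alpha> p 0 \<mu> \<longrightarrow>
               (SUP (\<xi>, \<delta>) \<in> unit_sphere \<times> {0<..<2}.
                  emeasure \<mu> (carleson_region \<delta> \<xi>) / ennreal (ln (2 / \<delta>) powr (1 - p))) < \<infinity>) \<and>
            (\<forall>\<epsilon>>0.
               (SUP (\<xi>, \<delta>) \<in> unit_sphere \<times> {0<..<2}.
                  emeasure \<mu> (carleson_region \<delta> \<xi>) / ennreal (ln (2 / \<delta>) powr (1 - p - \<epsilon>))) < \<infinity> \<longrightarrow>
               besov_carleson m \<alpha> p 0 \<mu>))"
proof -
  note m = assms(2) and \<sigma> = assms(3) and p = assms(4) and ms = assms(5) and \<mu> = assms(8)
  have a: "real CARD('n) + 1 + \<alpha> \<notin> \<int>\<^sub>\<le>\<^sub>0"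
  proof
    assume "real CARD('n) + 1 + \<alpha> \<in> \<int>\<^sub>\<le>\<^sub>0"
    then obtain i where "real CARD('n) + 1 + \<alpha> = - of_nat i" by (rule nonpos_Ints_cases')
    then have "real CARD('n) + \<alpha> = of_int (- int (i + 1))" by simp
    then have "real CARD('n) + \<alpha> \<in> \<int>" by (simp only: Ints_of_int)
    moreover have "real CARD('n) + \<alpha> < 0" using \<open>real CARD('n) + 1 + \<alpha> = - of_nat i\<close> by simp
    ultimately show False using assms(6) by simp
  qed
  have nec1: "q_carleson (\<sigma> * p / real CARD('n)) \<mu>" if pos: "\<sigma> > 0" and car: "besov_carleson m \<alpha> p \<sigma> \<mu>"
  proof -
    obtain K where K: "K > 0" "\<forall>\<xi> \<delta>. norm \<xi> = 1 \<longrightarrow> 0 < \<delta> \<longrightarrow> emeasure \<mu> (carleson_region \<delta> \<xi>) \<le> ennreal (K * \<delta> powr (\<sigma> * p))"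
      using carleson_region_bound_sobolev[OF \<mu> car m p pos ms a] by (elim exE conjE)
    have n: "real CARD('n) * (\<sigma> * p / real CARD('n)) = \<sigma> * p" by simp
    show ?thesis
      unfolding q_carleson_def n by (rule SUP_ratio_finiteI[of _ _ _ K]) (use K(2) in simp)
  qed
  have nec2: "(SUP (\<xi>, \<delta>) \<in> unit_sphere \<times> {0<..<2}. emeasure \<mu> (carleson_region \<delta> \<xi>) / ennreal (ln (2 / \<delta>) powr (1 - p))) < \<infinity>"
    if zero: "\<sigma> = 0" and car: "besov_carleson m \<alpha> p 0 \<mu>"
  proof -
    obtain K where K: "K > 0" "\<forall>\<xi> \<delta>. norm \<xi> = 1 \<longrightarrow> 0 < \<delta> \<longrightarrow> \<delta> < 2 \<longrightarrow> emeasure \<mu> (carleson_region \<delta> \<xi>) \<le> ennreal (K * ln (2 / \<delta>) powr (1 - p))"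
      using carleson_region_bound_dirichlet[OF \<mu> car m p ms[unfolded zero] a] by (elim exE conjE)
    show ?thesis
    proof (rule SUP_ratio_finiteI[of _ _ _ K])
      fix \<xi> :: "complex ^ 'n" and \<delta> :: real assume "(\<xi>, \<delta>) \<in> unit_sphere \<times> {0<..<2}"
      then have x: "norm \<xi> = 1" "0 < \<delta>" "\<delta> < 2" by auto
      then have "ln (2 / \<delta>) > 0" by (simp add: field_simps)
      then show "0 < ln (2 / \<delta>) powr (1 - p) \<and> emeasure \<mu> (carleson_region \<delta> \<xi>) \<le> ennreal (K * ln (2 / \<delta>) powr (1 - p))"
        using K(2)[rule_format, OF x] by simp
    qed
  qed
  show ?thesis
    using nec1 nec2 sufficiency_sobolev[OF \<mu> p \<sigma> a] sufficiency_dirichlet[OF \<mu> p a] by blast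
qed

end
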